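(* The coordinate matrices of the two word lists $\mathcal W_{\mathrm{lean}}$ and $\mathcal W_{\mathrm{bal}}$ satisfy $$\det C_{\mathrm{lean}}=\frac{10-7\sqrt2}{32}\neq0,\qquad \det C_{\mathrm{bal}}=-\frac{140+91\sqrt2}{16}\neq0 .$$ Consequently the maps $\Psi_{\mathcal W_{\mathrm{lean}}},\Psi_{\mathcal W_{\mathrm{bal}}}:\mathbb R^{14}\to G_2$ are analytic local diffeomorphisms at the origin.
   Context: Octonions: $\mathbb O$ has real basis $1,e_1,\dots,e_7$ with $1$ the identity, $e_i^2=-1$, and multiplication given by the oriented triples $(123),(145),(176),(246),(257),(347),(365)$: for a triple $(abc)$, $e_ae_b=e_c$, $e_be_c=e_a$, $e_ce_a=e_b$, and reversing the order changes the sign. $G_2=\operatorname{Aut}(\mathbb O)$, $\mathfrak g_2=\operatorname{Der}(\mathbb O)$, acting on $V=\operatorname{Im}\mathbb O$. $D_{ij}=D_{e_i,e_j}\in\mathfrak g_2$ with $D_{a,b}(x)=[[a,b],x]-3[a,b,x]$, where $[a,b]=ab-ba$ and $[a,b,x]=(ab)x-a(bx)$. Ordered basis of $\mathfrak g_2$: $(D_1,\dots,D_{14}):=(D_{12},D_{13},D_{14},D_{15},D_{16},D_{17},D_{23},D_{24},D_{25},D_{26},D_{27},D_{45},D_{46},D_{47})$. $S\in G_2$ is the involution $S(e_1)=e_1$, $e_2\leftrightarrow e_4$, $e_3\leftrightarrow e_5$, $S(e_6)=-e_6$, $S(e_7)=-e_7$. Let $X=D_{46}+D_{47}$, $A=e^{\pi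 X/(8\sqrt2)}$, $a=A^{-1}$. A word in $\{A,a,S\}$ denotes the ordered matrix product of its letters; $I$ is the identity (empty word). For a list $\mathcal W=(g_1,\dots,g_{14})$ of such words, $$\Psi_{\mathcal W}(t_1,\dots,t_{14})=\prod_{j=1}^{14}g_je^{t_jX}g_j^{-1}$$ (ordered by increasing $j$ from left to right), and the matrix $C_{\mathcal W}$ is defined by $g_jXg_j^{-1}=\sum_{i=1}^{14}(C_{\mathcal W})_{ij}D_i$. The lists are $\mathcal W_{\mathrm{lean}}=(I,\ S,\ AS,\ aS,\ AAS,\ aaS,\ SAS,\ SaS,\ AAAS,\ ASAS,\ aSAS,\ SAAS,\ ASAAS,\ SASAS)$, $\mathcal W_{\mathrm{bal}}=(I,\ AAS,\ aaS,\ AASAS,\ AASaS,\ aaSAS,\ aaSaS,\ ASAAAS,\ aSAAAS,\ SAAAAS,\ SAASAS,\ SAASaS,\ SaaSAS,\ SaaSaS)$, and $C_{\mathrm{lean}},C_{\mathrm{bal}}$ are the corresponding matrices. "Analytic local diffeomorphism at the origin" means restricting to an analytic diffeomorphism between a neighborhood of $0\in\mathbb R^{14}$ and a neighborhood of the identity in $G_2$. *)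

theory Defs
  imports "HOL-Analysis.Analysis"
begin

text \<open>
  Coordinate \<open>i\<close> of an octonion belongs to the basis element \<open>oct_e i\<close>, and \<open>oct_e 0\<close> is
  the identity 1. In the numeral type 8 the indices 0, ..., 7 are distinct (and 8 = 0).
\<close>

type_synonym octonion = "real ^ 8"

type_synonym oct_matrix = "real ^ 8 ^ 8"

definition oct_e :: "8 \<Rightarrow> octonion" where
  "oct_e i = axis i 1"

definition oct_triples :: "(8 \<times> 8 \<times> 8) set" where
  "oct_triples = {(1,2,3), (1,4,5), (1,7,6), (2,4,6), (2,5,7), (3,4,7), (3,6,5)}"

definition oct_oriented :: "8 \<Rightarrow> 8 \<Rightarrow> 8 \<Rightarrow> bool" where
  "oct_oriented i j k \<longleftrightarrow>
     (i,j,k) \<in> oct_triples \<or> (j,k,i) \<in> oct_triples \<or> (k,i,j) \<in> oct_triples"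

definition oct_basis_mult :: "8 \<Rightarrow> 8 \<Rightarrow> octonion" where
  "oct_basis_mult i j =
     (if i = 0 then oct_e j
      else if j = 0 then oct_e i
      else if i = j then - oct_e 0
      else (\<Sum>k\<in>UNIV. (if oct_oriented i j k then 1 else if oct_oriented j i k then -1 else 0)
                         *\<^sub>R oct_e k))"

definition oct_mult :: "octonion \<Rightarrow> octonion \<Rightarrow> octonion"  (infixl \<open>\<odot>\<close> 70) where
  "x \<odot> y = (\<Sum>i\<in>UNIV. \<Sum>j\<in>UNIV. (x $ i * y $ j) *\<^sub>R oct_basis_mult i j)"

definition oct_commutator :: "octonion \<Rightarrow> octonion \<Rightarrow> octonion" where
  "oct_commutator a b = a \<odot> b - b \<odot> a"

definition oct_associator :: "octonion \<Rightarrow> octonion \<Rightarrow> octonion \<Rightarrow> octonion" where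
  "oct_associator a b x = (a \<odot> b) \<odot> x - a \<odot> (b \<odot> x)"

text \<open>
  Linear maps of the octonions are written as 8 by 8 matrices in the basis 1, e1, ..., e7.
  Automorphisms fix 1 and derivations kill 1, and both preserve the imaginary octonions; their
  matrices on the imaginary octonions are the blocks with indices 1, ..., 7, and passing
  between the two is compatible with products, linear combinations and exponentials.
\<close>

definition G2 :: "oct_matrix set" where
  "G2 = {M. invertible M \<and> (\<forall>x y. M *v (x \<odot> y) = (M *v x) \<odot> (M *v y))}"

definition oct_D :: "octonion \<Rightarrow> octonion \<Rightarrow> oct_matrix" where
  "oct_D a b =
     matrix (\<lambda>x. oct_commutator (oct_commutator a b) x - 3 *\<^sub>R oct_associator a b x)"

definition Dij :: "8 \<Rightarrow> 8 \<Rightarrow> oct_matrix" where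
  "Dij i j = oct_D (oct_e i) (oct_e j)"

definition g2_basis :: "oct_matrix list" where
  "g2_basis = [Dij 1 2, Dij 1 3, Dij 1 4, Dij 1 5, Dij 1 6, Dij 1 7,
               Dij 2 3, Dij 2 4, Dij 2 5, Dij 2 6, Dij 2 7,
               Dij 4 5, Dij 4 6, Dij 4 7]"

text \<open>
  The library's \<open>*\<close> and \<open>^\<close> on vectors act componentwise, so matrix powers iterate \<open>**\<close>.
\<close>

definition mat_exp :: "real ^ 'n ^ 'n \<Rightarrow> real ^ 'n ^ 'n" where
  "mat_exp M = (\<Sum>k. (1 / fact k) *\<^sub>R (((**) M ^^ k) (mat 1)))"

definition X :: oct_matrix where
  "X = Dij 4 6 + Dij 4 7"

datatype letter = LA | La | LS

definition A_mat :: oct_matrix where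
  "A_mat = mat_exp ((pi / (8 * sqrt 2)) *\<^sub>R X)"

definition S_mat :: oct_matrix where
  "S_mat = matrix (\<lambda>x.
     x $ 0 *\<^sub>R oct_e 0 + x $ 1 *\<^sub>R oct_e 1 +
     x $ 2 *\<^sub>R oct_e 4 + x $ 4 *\<^sub>R oct_e 2 +
     x $ 3 *\<^sub>R oct_e 5 + x $ 5 *\<^sub>R oct_e 3 -
     x $ 6 *\<^sub>R oct_e 6 - x $ 7 *\<^sub>R oct_e 7)"

fun letter_mat :: "letter \<Rightarrow> oct_matrix" where
  "letter_mat LA = A_mat"
| "letter_mat La = matrix_inv A_mat"
| "letter_mat LS = S_mat"

definition mat_list_prod :: "(real ^ 'n ^ 'n) list \<Rightarrow> real ^ 'n ^ 'n" where
  "mat_list_prod Ms = foldr (**) Ms (mat 1)"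

definition word_mat :: "letter list \<Rightarrow> oct_matrix" where
  "word_mat w = mat_list_prod (map letter_mat w)"

text \<open>
  Lists are indexed from 0, so the indices 1, ..., 14 become 0, ..., 13; \<open>of_nat\<close> maps
  these bijectively onto the numeral type 14.
\<close>

definition Psi :: "letter list list \<Rightarrow> real ^ 14 \<Rightarrow> oct_matrix" where
  "Psi W t = mat_list_prod
     (map (\<lambda>j. word_mat (W ! j) ** mat_exp ((t $ of_nat j) *\<^sub>R X) ** matrix_inv (word_mat (W ! j)))
          [0..<14])"

definition C_mat :: "letter list list \<Rightarrow> real ^ 14 ^ 14" where
  "C_mat W = (THE C. \<forall>j<14.
     word_mat (W ! j) ** X ** matrix_inv (word_mat (W ! j)) =
       (\<Sum>i<14. (C $ of_nat i $ of_nat j) *\<^sub>R (g2_basis ! i)))"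

definition W_lean :: "letter list list" where
  "W_lean =
    [[],
     [LS],
     [LA, LS],
     [La, LS],
     [LA, LA, LS],
     [La, La, LS],
     [LS, LA, LS],
     [LS, La, LS],
     [LA, LA, LA, LS],
     [LA, LS, LA, LS],
     [La, LS, LA, LS],
     [LS, LA, LA, LS],
     [LA, LS, LA, LA, LS],
     [LS, LA, LS, LA, LS]]"

definition W_bal :: "letter list list" where
  "W_bal =
    [[],
     [LA, LA, LS],
     [La, La, LS],
     [LA, LA, LS, LA, LS],
     [LA, LA, LS, La, LS],
     [La, La, LS, LA, LS],
     [La, La, LS, La, LS],
     [LA, LS, LA, LA, LA, LS],
     [La, LS, LA, LA, LA, LS],
     [LS, LA, LA, LA, LA, LS],
     [LS, LA, LA, LS, LA, LS],
     [LS, LA, LA, LS, La, LS],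
     [LS, La, La, LS, LA, LS],
     [LS, La, La, LS, La, LS]]"

text \<open>
  Analyticity at a point: expansion into a power series in the coordinates, convergent on a
  neighbourhood. The multi-indices are the functions from \<open>Basis\<close> to the natural numbers,
  taken extensional so that each occurs once.
\<close>

definition real_analytic_at ::
    "('a::euclidean_space \<Rightarrow> 'b::real_normed_vector) \<Rightarrow> 'a \<Rightarrow> bool" where
  "real_analytic_at f x \<longleftrightarrow>
     (\<exists>c :: ('a \<Rightarrow> nat) \<Rightarrow> 'b. \<exists>r>0. \<forall>h. norm h < r \<longrightarrow>
        ((\<lambda>\<alpha>. (\<Prod>b\<in>Basis. (h \<bullet> b) ^ \<alpha> b) *\<^sub>R c \<alpha>) has_sum f (x + h))
          (Basis \<rightarrow>\<^sub>E UNIV))"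

text \<open>
  On an arbitrary subset, analytic means locally the restriction of an analytic map on an open
  set of the ambient space. For an open set this is ordinary analyticity. For an embedded analytic
  submanifold, such as the closed matrix group \<open>G2\<close>, it is analyticity with respect to
  the manifold structure.
\<close>

definition real_analytic_on ::
    "('a::euclidean_space \<Rightarrow> 'b::real_normed_vector) \<Rightarrow> 'a set \<Rightarrow> bool" where
  "real_analytic_on f S \<longleftrightarrow>
     (\<forall>x\<in>S. \<exists>U g. open U \<and> x \<in> U \<and> (\<forall>y\<in>U. real_analytic_at g y) \<and> (\<forall>y\<in>U \<inter> S. g y = f y))"

text \<open>
  \<open>f\<close> restricts to an analytic diffeomorphism between an open neighbourhood of \<open>p\<close> and a
  neighbourhood of \<open>q\<close> that is open in \<open>M\<close>, and takes \<open>p\<close> to \<open>q\<close>.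
\<close>

definition analytic_local_diffeo ::
    "('a::euclidean_space \<Rightarrow> 'b::euclidean_space) \<Rightarrow> 'a \<Rightarrow> 'b set \<Rightarrow> 'b \<Rightarrow> bool" where
  "analytic_local_diffeo f p M q \<longleftrightarrow> f p = q \<and>
     (\<exists>U V g. open U \<and> p \<in> U \<and> openin (top_of_set M) V \<and> q \<in> V \<and>
        homeomorphism U V f g \<and> real_analytic_on f U \<and> real_analytic_on g V)"

end

theory Submission
  imports Defs
begin

text \<open>
  Analytic part: a map Id + f whose power series f starts in degree 2 is inverted by the iteration
  h = y - f(h), which contracts in the norm given by the absolute sum of the coefficients of a power
  series on a small polydisc; hence the inverse is analytic. No manifold structure on G2 is needed.
  If P maps a neighbourhood of 0 into G2, with P(0) = 1 and with derivative L at 0 a bijection onto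
  the derivations, choose a linear left inverse k of L and apply this to the ambient map
  Z |-> P(k Z)(1 + Z - L k Z) - 1, whose derivative at 0 is the identity. A point of G2 near 1 has
  transversal coordinate z = Z - L k Z with 1 + z in G2, so z is a derivation up to an error
  quadratic in z; since k z = 0, it follows that z = 0. So P is onto a neighbourhood of 1 in G2.

  Algebraic part: derivations of the octonions are spanned by the fourteen D's, by linear algebra.
  The exponential of t X is explicit, which gives A and the action of the three letters on the
  coordinates of derivations over Z[sqrt 2]; the determinants follow by triangular factorization.
\<close>

section \<open>Power series on polydiscs\<close>

text \<open>Sup norms would not do: over the reals a uniform limit of analytic maps need not be
  analytic. The weighted absolute sum of the coefficients is submultiplicative and complete, so its
  estimates survive products, substitution and the limit of the iteration. The detour through an
  ambient map serves two ends. The product map goes from dimension 14 to dimension 64 and is not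
  itself a perturbation of the identity; and analyticity on a subset of the matrices asks for an
  analytic map on an open set of matrices, which the inverse of the ambient map supplies. The price
  is the proof that the transversal coordinate vanishes on \<open>G2\<close>. The angle pi / (8 sqrt
  2) is tuned to the frequencies 2 sqrt 2 and 4 sqrt 2 of \<open>X\<close>: they become pi / 4 and
  pi / 2, so 4 A has entries in Z[sqrt 2] and all statements about words reduce to arithmetic with
  integer pairs. Conjugations are checked in the form D' g = g D, cleared of inverses and
  denominators.\<close>

definition mono_val :: "'a::euclidean_space \<Rightarrow> ('a \<Rightarrow> nat) \<Rightarrow> real" where
  "mono_val h \<alpha> = (\<Prod>b\<in>Basis. (h \<bullet> b) ^ \<alpha> b)"

definition mono_deg :: "('a::euclidean_space \<Rightarrow> nat) \<Rightarrow> nat" where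
  "mono_deg \<alpha> = (\<Sum>b\<in>Basis. \<alpha> b)"

definition polydisc :: "real \<Rightarrow> 'a::euclidean_space set" where
  "polydisc r = {h. \<forall>b\<in>Basis. \<bar>h \<bullet> b\<bar> \<le> r}"

abbreviation multi_indices :: "('a::euclidean_space \<Rightarrow> nat) set" where
  "multi_indices \<equiv> Basis \<rightarrow>\<^sub>E UNIV"

text \<open>\<open>B\<close> is an upper bound for the coefficient norm rather than the norm itself,
  so it can be weakened freely. The expansion is required on the closed polydisc, where the weight
  \<open>r ^ mono_deg \<alpha>\<close> dominates each monomial.\<close>

definition has_pser :: "real \<Rightarrow> real \<Rightarrow> ('a::euclidean_space \<Rightarrow> real) \<Rightarrow> (('a \<Rightarrow> nat) \<Rightarrow> real) \<Rightarrow> bool" where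
  "has_pser r B f c \<longleftrightarrow>
     (\<exists>s\<le>B. ((\<lambda>\<alpha>. \<bar>c \<alpha>\<bar> * r ^ mono_deg \<alpha>) has_sum s) multi_indices) \<and>
     (\<forall>h\<in>polydisc r. ((\<lambda>\<alpha>. c \<alpha> * mono_val h \<alpha>) has_sum f h) multi_indices)"

definition pser :: "real \<Rightarrow> real \<Rightarrow> ('a::euclidean_space \<Rightarrow> real) \<Rightarrow> bool" where
  "pser r B f \<longleftrightarrow> (\<exists>c. has_pser r B f c)"

lemma polydisc_0 [simp]: "0 \<le> r \<Longrightarrow> 0 \<in> polydisc r"
  by (simp add: polydisc_def)

lemma polydisc_mono: "r \<le> s \<Longrightarrow> h \<in> polydisc r \<Longrightarrow> h \<in> polydisc s"
  by (force simp: polydisc_def)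

lemma norm_imp_polydisc: "norm h \<le> r \<Longrightarrow> h \<in> polydisc r"
  unfolding polydisc_def using Basis_le_norm order_trans by blast

lemma abs_mono_val_le:
  assumes "h \<in> polydisc r"
  shows "\<bar>mono_val h \<alpha>\<bar> \<le> r ^ mono_deg \<alpha>"
proof -
  have "\<bar>mono_val h \<alpha>\<bar> = (\<Prod>b\<in>Basis. \<bar>h \<bullet> b\<bar> ^ \<alpha> b)"
    by (simp add: mono_val_def abs_prod power_abs)
  also have "\<dots> \<le> (\<Prod>b\<in>Basis. r ^ \<alpha> b)"
    using assms by (intro prod_mono) (auto simp: polydisc_def intro!: power_mono)
  also have "\<dots> = r ^ mono_deg \<alpha>"
    by (simp add: mono_deg_def power_sum)
  finally show ?thesis .
qed

lemma has_sum_abs_le: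
  fixes f :: "'i \<Rightarrow> real"
  assumes "(f has_sum x) A" "(g has_sum y) A" "\<And>i. i \<in> A \<Longrightarrow> \<bar>f i\<bar> \<le> g i"
  shows "\<bar>x\<bar> \<le> y"
proof -
  have "x \<le> y" by (rule has_sum_mono[OF assms(1,2)]) (use assms(3) in force)
  moreover have "- x \<le> y"
    by (rule has_sum_mono[OF _ assms(2), of "\<lambda>i. - f i"])
      (use assms(1,3) in \<open>force simp: has_sum_uminus\<close>)+
  ultimately show ?thesis by simp
qed

lemma summable_on_abs_le:
  fixes f :: "'i \<Rightarrow> real"
  assumes "(g has_sum y) A" "\<And>i. i \<in> A \<Longrightarrow> \<bar>f i\<bar> \<le> g i"
  shows "f summable_on A"
proof -
  have "(\<lambda>i. norm (g i)) summable_on A"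
    using assms(1) has_sum_imp_summable summable_on_iff_abs_summable_on_real by blast
  then have "(\<lambda>i. norm (f i)) summable_on A"
    by (rule Infinite_Sum.abs_summable_on_comparison_test) (use assms(2) in force)
  then show ?thesis by (rule abs_summable_summable)
qed

lemma has_sum_finite_sum:
  fixes f :: "'b \<Rightarrow> 'i \<Rightarrow> 'c::topological_comm_monoid_add"
  assumes "finite J" "\<And>j. j \<in> J \<Longrightarrow> (f j has_sum s j) A"
  shows "((\<lambda>i. \<Sum>j\<in>J. f j i) has_sum (\<Sum>j\<in>J. s j)) A"
  using assms by (induction J rule: finite_induct) (auto intro: has_sum_add)

lemma has_pser_bound:
  assumes "has_pser r B f c" "h \<in> polydisc r"
  shows "\<bar>f h\<bar> \<le> B"
proof -
  obtain s where s: "s \<le> B" "((\<lambda>\<alpha>. \<bar>c \<alpha>\<bar> * r ^ mono_deg \<alpha>) has_sum s) multi_indices"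
    using assms by (auto simp: has_pser_def)
  have "((\<lambda>\<alpha>. c \<alpha> * mono_val h \<alpha>) has_sum f h) multi_indices"
    using assms by (auto simp: has_pser_def)
  then have "\<bar>f h\<bar> \<le> s"
    by (rule has_sum_abs_le[OF _ s(2)])
      (use abs_mono_val_le[OF assms(2)] in \<open>auto simp: abs_mult intro!: mult_left_mono\<close>)
  with s show ?thesis by simp
qed

lemma pser_bound: "pser r B f \<Longrightarrow> h \<in> polydisc r \<Longrightarrow> \<bar>f h\<bar> \<le> B"
  using has_pser_bound by (auto simp: pser_def)

lemma pser_nonneg: "pser r B f \<Longrightarrow> 0 \<le> r \<Longrightarrow> 0 \<le> B"
  using pser_bound[of r B f 0] by (simp add: order_trans[OF abs_ge_zero])

lemma pser_mono: "pser r B f \<Longrightarrow> B \<le> B' \<Longrightarrow> pser r B' f"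
  unfolding pser_def has_pser_def by (meson order_trans)

text \<open>Terms with a common exponent are collected; the absolute values only decrease.\<close>

lemma pser_collect:
  fixes e :: "'i \<Rightarrow> ('a::euclidean_space \<Rightarrow> nat)"
  assumes r: "0 < r" and e: "\<And>i. i \<in> I \<Longrightarrow> e i \<in> multi_indices"
    and abs: "((\<lambda>i. \<bar>a i\<bar> * r ^ mono_deg (e i)) has_sum s) I" and "s \<le> B"
    and f: "\<And>h. h \<in> polydisc r \<Longrightarrow> ((\<lambda>i. a i * mono_val h (e i)) has_sum f h) I"
  shows "pser r B f"
proof -
  \<comment> \<open>The index set splits into the fibres of \<open>e\<close>: a sum over
    \<open>I\<close> becomes a sum over exponents of sums over fibres, and \<open>C \<alpha>\<close>
    is the collected coefficient.\<close>
  define F where "F \<alpha> = {i\<in>I. e i = \<alpha>}" for \<alpha>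
  define C where "C \<alpha> = infsum a (F \<alpha>)" for \<alpha>
  have bij: "bij_betw snd (Sigma multi_indices F) I"
    by (rule bij_betwI[of _ _ _ "\<lambda>i. (e i, i)"]) (use e in \<open>auto simp: F_def\<close>)
  have sum_abs: "((\<lambda>p. \<bar>a (snd p)\<bar> * r ^ mono_deg (e (snd p))) has_sum s) (Sigma multi_indices F)"
    using abs has_sum_reindex_bij_betw[OF bij, of "\<lambda>i. \<bar>a i\<bar> * r ^ mono_deg (e i)" s] by simp
  have fib0: "(\<lambda>i. \<bar>a i\<bar> * r ^ mono_deg (e i)) summable_on F \<alpha>" for \<alpha>
    using has_sum_imp_summable[OF abs] by (rule summable_on_subset_banach) (auto simp: F_def)
  have fib1: "(\<lambda>i. \<bar>a i\<bar> * r ^ mono_deg \<alpha>) summable_on F \<alpha>" for \<alpha>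
    using fib0[of \<alpha>] by (rule summable_on_cong[THEN iffD1, rotated]) (auto simp: F_def)
  have fib2: "(\<lambda>i. \<bar>a i\<bar>) summable_on F \<alpha>" for \<alpha>
    using fib1[of \<alpha>] r by (simp add: summable_on_cmult_left')
  have fib3: "(a has_sum C \<alpha>) (F \<alpha>)" for \<alpha>
    unfolding C_def using fib2[of \<alpha>] abs_summable_summable[of a "F \<alpha>"] by simp
  define T where "T \<alpha> = infsum (\<lambda>i. \<bar>a i\<bar> * r ^ mono_deg \<alpha>) (F \<alpha>)" for \<alpha>
  have T: "((\<lambda>i. \<bar>a i\<bar> * r ^ mono_deg \<alpha>) has_sum T \<alpha>) (F \<alpha>)" for \<alpha>
    unfolding T_def using fib1 by simp
  have Ts: "(T has_sum s) multi_indices"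
  proof (rule has_sum_SigmaD[OF sum_abs])
    fix \<alpha>
    show "((\<lambda>i. \<bar>a (snd (\<alpha>, i))\<bar> * r ^ mono_deg (e (snd (\<alpha>, i)))) has_sum T \<alpha>) (F \<alpha>)"
      using T[of \<alpha>] by (rule has_sum_cong[THEN iffD1, rotated]) (auto simp: F_def)
  qed
  have CT: "\<bar>C \<alpha>\<bar> * r ^ mono_deg \<alpha> \<le> T \<alpha>" for \<alpha>
  proof -
    have "\<bar>C \<alpha> * r ^ mono_deg \<alpha>\<bar> \<le> T \<alpha>"
      by (rule has_sum_abs_le[OF has_sum_cmult_left[OF fib3] T])
        (use r in \<open>auto simp: abs_mult\<close>)
    then show ?thesis using r by (simp add: abs_mult)
  qed
  have "(\<lambda>\<alpha>. \<bar>C \<alpha>\<bar> * r ^ mono_deg \<alpha>) summable_on multi_indices"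
    by (rule summable_on_abs_le[OF Ts]) (use CT r in \<open>auto simp: abs_mult\<close>)
  then obtain s' where s': "((\<lambda>\<alpha>. \<bar>C \<alpha>\<bar> * r ^ mono_deg \<alpha>) has_sum s') multi_indices"
    by (auto simp: summable_on_def)
  have "s' \<le> s" by (rule has_sum_mono[OF s' Ts]) (rule CT)
  moreover have "((\<lambda>\<alpha>. C \<alpha> * mono_val h \<alpha>) has_sum f h) multi_indices" if h: "h \<in> polydisc r" for h
  proof (rule has_sum_SigmaD)
    show "((\<lambda>p. a (snd p) * mono_val h (e (snd p))) has_sum f h) (Sigma multi_indices F)"
      using f[OF h] has_sum_reindex_bij_betw[OF bij, of "\<lambda>i. a i * mono_val h (e i)" "f h"] by simp
    fix \<alpha>
    show "((\<lambda>i. a (snd (\<alpha>, i)) * mono_val h (e (snd (\<alpha>, i)))) has_sum C \<alpha> * mono_val h \<alpha>) (F \<alpha>)"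
      using has_sum_cmult_left[OF fib3]
      by (rule has_sum_cong[THEN iffD1, rotated]) (auto simp: F_def)
  qed
  ultimately show ?thesis
    unfolding pser_def has_pser_def using s' \<open>s \<le> B\<close> by (meson order_trans)
qed

text \<open>Completeness of the coefficient norm: if the bounds \<open>B i\<close> are summable, all
  coefficients together form an absolutely summable family over \<open>I\<close> times the
  multi-indices and may be collected by exponent. Composition, one-variable entire series and the
  limit of the iteration all rest on this.\<close>

lemma pser_series:
  fixes f :: "'i \<Rightarrow> 'a::euclidean_space \<Rightarrow> real"
  assumes r: "0 < r" and f: "\<And>i. i \<in> I \<Longrightarrow> pser r (B i) (f i)" and B: "(B has_sum S) I"
    and F: "\<And>h. h \<in> polydisc r \<Longrightarrow> ((\<lambda>i. f i h) has_sum F h) I"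
  shows "pser r S F"
proof -
  have "\<exists>c. \<forall>i\<in>I. has_pser r (B i) (f i) (c i)"
    using f by (intro bchoice) (auto simp: pser_def)
  then obtain c where c: "\<And>i. i \<in> I \<Longrightarrow> has_pser r (B i) (f i) (c i)" by blast
  then have "\<exists>s. \<forall>i\<in>I. s i \<le> B i \<and> ((\<lambda>\<alpha>. \<bar>c i \<alpha>\<bar> * r ^ mono_deg \<alpha>) has_sum s i) multi_indices"
    by (intro bchoice) (auto simp: has_pser_def)
  then obtain s where cs: "\<And>i. i \<in> I \<Longrightarrow> s i \<le> B i"
    "\<And>i. i \<in> I \<Longrightarrow> ((\<lambda>\<alpha>. \<bar>c i \<alpha>\<bar> * r ^ mono_deg \<alpha>) has_sum s i) multi_indices"
    by blast
  have cs3: "\<And>i h. i \<in> I \<Longrightarrow> h \<in> polydisc r \<Longrightarrow> ((\<lambda>\<alpha>. c i \<alpha> * mono_val h \<alpha>) has_sum f i h) multi_indices"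
    using c by (simp add: has_pser_def)
  let ?J = "Sigma I (\<lambda>_. multi_indices)"
  have s0: "0 \<le> s i" if "i \<in> I" for i
    by (rule has_sum_nonneg[OF cs(2)[OF that]]) (use r in auto)
  have "s summable_on I"
    by (rule summable_on_abs_le[OF B]) (use s0 cs(1) in force)
  then obtain S' where S': "(s has_sum S') I" by (auto simp: summable_on_def)
  have "S' \<le> S" by (rule has_sum_mono[OF S' B]) (rule cs)
  define A where "A p = \<bar>c (fst p) (snd p)\<bar> * r ^ mono_deg (snd p)" for p
  have Asum: "A summable_on ?J"
    by (rule summable_on_SigmaI[where g=s])
      (use cs(2) S' r in \<open>auto simp: A_def summable_on_def\<close>)
  then have AS: "(A has_sum S') ?J"
    by (intro has_sum_SigmaI[OF _ S']) (use cs(2) in \<open>auto simp: A_def\<close>)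
  show ?thesis
  proof (rule pser_collect[where I = ?J and e = snd and a = "\<lambda>p. c (fst p) (snd p)", OF r _ _ \<open>S' \<le> S\<close>])
    show "((\<lambda>p. \<bar>c (fst p) (snd p)\<bar> * r ^ mono_deg (snd p)) has_sum S') ?J"
      using AS by (simp add: A_def[abs_def])
    fix h :: 'a assume h: "h \<in> polydisc r"
    show "((\<lambda>p. c (fst p) (snd p) * mono_val h (snd p)) has_sum F h) ?J"
    proof (rule has_sum_SigmaI[OF _ F[OF h]])
      show "(\<lambda>p. c (fst p) (snd p) * mono_val h (snd p)) summable_on ?J"
        by (rule summable_on_abs_le[OF AS])
          (use abs_mono_val_le[OF h] in \<open>auto simp: A_def abs_mult intro!: mult_left_mono\<close>)
    qed (use cs3 h in auto)
  qed auto
qed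

text \<open>The norm is submultiplicative: degrees add in the Cauchy product, so the absolute double
  sum factors as \<open>s * t\<close>.\<close>

lemma pser_mult:
  fixes f g :: "'a::euclidean_space \<Rightarrow> real"
  assumes r: "0 < r" and f: "pser r B f" and g: "pser r C g"
  shows "pser r (B * C) (\<lambda>h. f h * g h)"
proof -
  obtain c s where c: "s \<le> B" "((\<lambda>\<alpha>. \<bar>c \<alpha>\<bar> * r ^ mono_deg \<alpha>) has_sum s) multi_indices"
    "\<And>h. h\<in>polydisc r \<Longrightarrow> ((\<lambda>\<alpha>. c \<alpha> * mono_val h \<alpha>) has_sum f h) multi_indices"
    using f unfolding pser_def has_pser_def by meson
  obtain d t where d: "t \<le> C" "((\<lambda>\<alpha>. \<bar>d \<alpha>\<bar> * r ^ mono_deg \<alpha>) has_sum t) multi_indices"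
    "\<And>h. h\<in>polydisc r \<Longrightarrow> ((\<lambda>\<alpha>. d \<alpha> * mono_val h \<alpha>) has_sum g h) multi_indices"
    using g unfolding pser_def has_pser_def by meson
  \<comment> \<open>Exponents add; the restriction to \<open>Basis\<close> keeps the sum
    extensional, as \<open>multi_indices\<close> demands.\<close>
  define e where "e p = (\<lambda>b\<in>Basis. fst p b + snd p b)" for p :: "('a \<Rightarrow> nat) \<times> ('a \<Rightarrow> nat)"
  have deg: "mono_deg (e p) = mono_deg (fst p) + mono_deg (snd p)" for p
    by (simp add: mono_deg_def e_def sum.distrib)
  have val: "mono_val h (e p) = mono_val h (fst p) * mono_val h (snd p)" for h p
    by (simp add: mono_val_def e_def power_add prod.distrib)
  let ?J = "Sigma multi_indices (\<lambda>_. multi_indices) :: (('a \<Rightarrow> nat) \<times> ('a \<Rightarrow> nat)) set"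
  define A where "A p = (\<bar>c (fst p)\<bar> * r ^ mono_deg (fst p)) * (\<bar>d (snd p)\<bar> * r ^ mono_deg (snd p))" for p
  have s0: "0 \<le> s" "0 \<le> t"
    by (rule has_sum_nonneg[OF c(2)], use r in force) (rule has_sum_nonneg[OF d(2)], use r in force)
  have "A summable_on ?J"
    by (rule summable_on_SigmaI[where g="\<lambda>\<alpha>. (\<bar>c \<alpha>\<bar> * r ^ mono_deg \<alpha>) * t"])
      (use has_sum_cmult_right[OF d(2)] has_sum_imp_summable[OF has_sum_cmult_left[OF c(2)]] r in \<open>auto simp: A_def\<close>)
  then have AS: "(A has_sum s * t) ?J"
    by (intro has_sum_SigmaI[OF _ has_sum_cmult_left[OF c(2)]])
      (use has_sum_cmult_right[OF d(2)] in \<open>auto simp: A_def\<close>)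
  show ?thesis
  proof (rule pser_collect[where I = ?J and e = e and a = "\<lambda>p. c (fst p) * d (snd p)" and s = "s * t", OF r])
    show "((\<lambda>i. \<bar>c (fst i) * d (snd i)\<bar> * r ^ mono_deg (e i)) has_sum s * t) ?J"
      using AS by (rule has_sum_cong[THEN iffD1, rotated]) (auto simp: A_def deg power_add abs_mult)
    show "s * t \<le> B * C" using c(1) d(1) s0 by (intro mult_mono) auto
    fix h :: 'a assume h: "h \<in> polydisc r"
    show "((\<lambda>i. c (fst i) * d (snd i) * mono_val h (e i)) has_sum f h * g h) ?J"
    proof (rule has_sum_SigmaI[OF _ has_sum_cmult_left[OF c(3)[OF h]]])
      show "(\<lambda>p. c (fst p) * d (snd p) * mono_val h (e p)) summable_on ?J"
      proof (rule summable_on_abs_le[OF AS])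
        fix p
        have "\<bar>c (fst p)\<bar> * \<bar>mono_val h (fst p)\<bar> * (\<bar>d (snd p)\<bar> * \<bar>mono_val h (snd p)\<bar>) \<le> A p"
          unfolding A_def using abs_mono_val_le[OF h] r by (intro mult_mono) auto
        then show "\<bar>c (fst p) * d (snd p) * mono_val h (e p)\<bar> \<le> A p"
          by (simp add: val abs_mult mult_ac)
      qed
      fix \<alpha>
      show "((\<lambda>y. c (fst (\<alpha>, y)) * d (snd (\<alpha>, y)) * mono_val h (e (\<alpha>, y))) has_sum
            c \<alpha> * mono_val h \<alpha> * g h) multi_indices"
        using has_sum_cmult_right[OF d(3)[OF h], of "c \<alpha> * mono_val h \<alpha>"]
        by (simp add: val mult_ac)
    qed
  qed (auto simp: e_def)
qed

lemma pser_const: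
  assumes "0 < r"
  shows "pser r \<bar>k\<bar> (\<lambda>h::'a::euclidean_space. k)"
  by (rule pser_collect[where I = "{()}" and a = "\<lambda>_. k" and e = "\<lambda>_. (\<lambda>b\<in>Basis. 0)" and s = "\<bar>k\<bar>", OF assms])
    (auto simp: mono_deg_def mono_val_def intro!: has_sum_finiteI)

lemma pser_inner_Basis:
  fixes b :: "'a::euclidean_space"
  assumes "0 < r" "b \<in> Basis"
  shows "pser r r (\<lambda>h. h \<bullet> b)"
proof (rule pser_collect[where I = "{()}" and a = "\<lambda>_. 1" and e = "\<lambda>_. (\<lambda>b'\<in>Basis. if b' = b then 1 else 0)" and s = r, OF assms(1)])
  have "mono_val h (\<lambda>b'\<in>Basis. if b' = b then 1 else 0) = (\<Prod>b'\<in>Basis. if b' = b then h \<bullet> b' else 1)" for h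
    unfolding mono_val_def by (rule prod.cong) auto
  then have "mono_val h (\<lambda>b'\<in>Basis. if b' = b then 1 else 0) = h \<bullet> b" for h
    using assms(2) by (simp add: prod.delta)
  then show "((\<lambda>i. 1 * mono_val h (\<lambda>b'\<in>Basis. if b' = b then 1 else 0)) has_sum h \<bullet> b) {()}" for h
    by (auto intro!: has_sum_finiteI)
  have "mono_deg (\<lambda>b'\<in>Basis. if b' = b then 1 else 0) = 1"
    unfolding mono_deg_def using assms(2) by (simp add: sum.delta cong: sum.cong)
  then show "((\<lambda>i. \<bar>1\<bar> * r ^ mono_deg (\<lambda>b'\<in>Basis. if b' = b then 1 else 0)) has_sum r) {()}"
    using assms(1) by (auto intro!: has_sum_finiteI)
qed auto

lemma pser_sum:
  assumes "0 < r" "finite I" "\<And>i. i \<in> I \<Longrightarrow> pser r (B i) (f i)"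
  shows "pser r (\<Sum>i\<in>I. B i) (\<lambda>h. \<Sum>i\<in>I. f i h)"
proof (rule pser_series[where f = f and B = B and I = I, OF assms(1,3)])
  show "(B has_sum sum B I) I" using assms(2) by (rule has_sum_finite)
  show "((\<lambda>i. f i h) has_sum (\<Sum>i\<in>I. f i h)) I" for h using assms(2) by (rule has_sum_finite)
qed

lemma pser_add:
  assumes "0 < r" "pser r B f" "pser r C g"
  shows "pser r (B + C) (\<lambda>h. f h + g h)"
  using pser_sum[of r "UNIV::bool set" "\<lambda>i. if i then B else C" "\<lambda>i. if i then f else g"] assms
  by (simp add: UNIV_bool add.commute)

lemma pser_cmult:
  assumes "0 < r" "pser r B f"
  shows "pser r (\<bar>k\<bar> * B) (\<lambda>h. k * f h)"
  using pser_mult[OF assms(1) pser_const[OF assms(1), of k] assms(2)] .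

lemma pser_diff:
  assumes "0 < r" "pser r B f" "pser r C g"
  shows "pser r (B + C) (\<lambda>h. f h - g h)"
  using pser_add[OF assms(1,2) pser_cmult[OF assms(1,3), of "-1"]] by simp

lemma pser_power:
  assumes "0 < r" "pser r B f"
  shows "pser r (B ^ n) (\<lambda>h. f h ^ n)"
proof (induction n)
  case 0
  then show ?case using pser_const[OF assms(1), of 1] by simp
next
  case (Suc n)
  then show ?case using pser_mult[OF assms(1,2) Suc] by simp
qed

lemma pser_prod:
  assumes "0 < r" "finite I" "\<And>i. i \<in> I \<Longrightarrow> pser r (B i) (f i)"
  shows "pser r (\<Prod>i\<in>I. B i) (\<lambda>h. \<Prod>i\<in>I. f i h)"
  using assms(2,3)
proof (induction I rule: finite_induct)
  case empty
  then show ?case using pser_const[OF assms(1), of 1] by simp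
next
  case (insert x F)
  then show ?case using pser_mult[OF assms(1), of "B x" "f x"] by simp
qed

section \<open>Substitution of power series into power series\<close>

lemma pser_mono_val:
  assumes "0 < r" "\<And>b. b \<in> Basis \<Longrightarrow> pser r R (\<lambda>h. u h \<bullet> b)"
  shows "pser r (R ^ mono_deg \<alpha>) (\<lambda>h. mono_val (u h) \<alpha>)"
  unfolding mono_val_def mono_deg_def power_sum
  by (intro pser_prod pser_power assms) auto

lemma pser_in_polydisc:
  assumes "\<And>b. b \<in> Basis \<Longrightarrow> pser r R (\<lambda>h. u h \<bullet> b)" "h \<in> polydisc r"
  shows "u h \<in> polydisc R"
  using pser_bound[OF assms(1) assms(2)] by (auto simp: polydisc_def)

text \<open>A monomial of degree n in \<open>u\<close> has norm at most \<open>R ^ n\<close>, which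
  is exactly its weight in the norm of \<open>f\<close>. Hence the bound \<open>B\<close> carries
  over unchanged.\<close>

lemma pser_compose:
  assumes r: "0 < r" and f: "pser R B f" and u: "\<And>b. b \<in> Basis \<Longrightarrow> pser r R (\<lambda>h. u h \<bullet> b)"
  shows "pser r B (\<lambda>h. f (u h))"
proof -
  obtain c s where c: "s \<le> B" "((\<lambda>\<alpha>. \<bar>c \<alpha>\<bar> * R ^ mono_deg \<alpha>) has_sum s) multi_indices"
    "\<And>h. h\<in>polydisc R \<Longrightarrow> ((\<lambda>\<alpha>. c \<alpha> * mono_val h \<alpha>) has_sum f h) multi_indices"
    using f unfolding pser_def has_pser_def by meson
  have "pser r s (\<lambda>h. f (u h))"
    by (rule pser_series[OF r _ c(2)], rule pser_cmult[OF r pser_mono_val[OF r u]])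
      (use c(3) pser_in_polydisc[OF u] in auto)
  then show ?thesis using c(1) by (rule pser_mono)
qed

text \<open>At radius \<open>R - q\<close> the coordinates of \<open>p + h\<close> have norm at most
  \<open>q + (R - q) = R\<close>, so translation is a substitution. It moves the expansion point
  from 0 to any point inside the polydisc.\<close>

lemma pser_recenter:
  assumes f: "pser R B f" and p: "p \<in> polydisc q" and "q < R"
  shows "pser (R - q) B (\<lambda>h. f (p + h))"
proof (rule pser_compose[OF _ f])
  show pos: "0 < R - q" using assms(3) by simp
  fix b :: 'a assume b: "b \<in> Basis"
  have "pser (R - q) (\<bar>p \<bullet> b\<bar> + (R - q)) (\<lambda>h. p \<bullet> b + h \<bullet> b)"
    by (intro pser_add pser_const pser_inner_Basis pos b)
  then show "pser (R - q) R (\<lambda>h. (p + h) \<bullet> b)"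
    unfolding inner_add_left by (rule pser_mono) (use p b in \<open>auto simp: polydisc_def\<close>)
qed

text \<open>Constant terms cancel, and every monomial of positive degree gains a factor
  \<open>norm h / r\<close> over its weight.\<close>

lemma pser_diff_at_0:
  fixes f :: "'a::euclidean_space \<Rightarrow> real"
  assumes r: "0 < r" and f: "pser r B f" and h: "norm h \<le> r"
  shows "\<bar>f h - f 0\<bar> \<le> B * (norm h / r)"
proof -
  obtain c s where c: "s \<le> B" "((\<lambda>\<alpha>. \<bar>c \<alpha>\<bar> * r ^ mono_deg \<alpha>) has_sum s) multi_indices"
    "\<And>h. h\<in>polydisc r \<Longrightarrow> ((\<lambda>\<alpha>. c \<alpha> * mono_val h \<alpha>) has_sum f h) multi_indices"
    using f unfolding pser_def has_pser_def by meson
  have "((\<lambda>\<alpha>. c \<alpha> * mono_val h \<alpha> + - (c \<alpha> * mono_val 0 \<alpha>)) has_sum (f h + - f 0)) multi_indices"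
    by (intro has_sum_add) (use c(3) h r in \<open>simp_all add: has_sum_uminus norm_imp_polydisc\<close>)
  then have "\<bar>f h + - f 0\<bar> \<le> s * (norm h / r)"
  proof (rule has_sum_abs_le[OF _ has_sum_cmult_left[OF c(2)]])
    fix \<alpha> :: "'a \<Rightarrow> nat"
    have "\<bar>mono_val h \<alpha> - mono_val 0 \<alpha>\<bar> \<le> r ^ mono_deg \<alpha> * (norm h / r)"
    proof (cases "mono_deg \<alpha>")
      case 0
      then have "mono_val x \<alpha> = 1" for x unfolding mono_val_def mono_deg_def by simp
      then show ?thesis using r by simp
    next
      case (Suc n)
      \<comment> \<open>At radius 0 the bound is \<open>0 ^ mono_deg \<alpha>\<close>, and the
        degree is positive here.\<close>
      have "mono_val 0 \<alpha> = 0" using abs_mono_val_le[of 0 0 \<alpha>] Suc by simp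
      moreover have "\<bar>mono_val h \<alpha>\<bar> \<le> norm h ^ mono_deg \<alpha>"
        by (rule abs_mono_val_le) (simp add: norm_imp_polydisc)
      moreover have "norm h ^ mono_deg \<alpha> \<le> r ^ n * norm h"
        using mult_left_mono[OF power_mono[OF h norm_ge_zero, of n], of "norm h"] by (simp add: Suc mult.commute)
      ultimately show ?thesis using r by (simp add: Suc)
    qed
    then have "\<bar>c \<alpha>\<bar> * \<bar>mono_val h \<alpha> - mono_val 0 \<alpha>\<bar> \<le> \<bar>c \<alpha>\<bar> * (r ^ mono_deg \<alpha> * (norm h / r))"
      by (rule mult_left_mono) simp
    then show "\<bar>c \<alpha> * mono_val h \<alpha> + - (c \<alpha> * mono_val 0 \<alpha>)\<bar> \<le> \<bar>c \<alpha>\<bar> * r ^ mono_deg \<alpha> * (norm h / r)"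
      by (simp flip: abs_mult add: right_diff_distrib mult.assoc)
  qed
  also have "\<dots> \<le> B * (norm h / r)"
    using c(1) r by (intro mult_right_mono) auto
  finally show ?thesis by simp
qed

lemma real_analytic_at_pser:
  fixes f :: "'a::euclidean_space \<Rightarrow> 'b::euclidean_space"
  assumes r: "0 < r" and f: "\<And>b. b \<in> Basis \<Longrightarrow> pser r (B b) (\<lambda>h. f (x + h) \<bullet> b)"
  shows "real_analytic_at f x"
proof -
  have "\<forall>b\<in>Basis. \<exists>c. \<forall>h\<in>polydisc r. ((\<lambda>\<alpha>. c \<alpha> * mono_val h \<alpha>) has_sum (f (x + h) \<bullet> b)) multi_indices"
    using f unfolding pser_def has_pser_def by meson
  then obtain c where c: "\<And>b h. b \<in> Basis \<Longrightarrow> h \<in> polydisc r \<Longrightarrow>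
      ((\<lambda>\<alpha>. c b \<alpha> * mono_val h \<alpha>) has_sum (f (x + h) \<bullet> b)) multi_indices" by metis
  show ?thesis unfolding real_analytic_at_def
  proof (intro exI[of _ "\<lambda>\<alpha>. \<Sum>b\<in>Basis. c b \<alpha> *\<^sub>R b"] exI[of _ r] conjI r allI impI)
    fix h :: 'a assume "norm h < r"
    then have h: "h \<in> polydisc r" by (simp add: norm_imp_polydisc)
    have "((\<lambda>\<alpha>. \<Sum>b\<in>Basis. (c b \<alpha> * mono_val h \<alpha>) *\<^sub>R b) has_sum (\<Sum>b\<in>Basis. (f (x + h) \<bullet> b) *\<^sub>R b)) multi_indices"
      by (intro has_sum_finite_sum has_sum_bounded_linear[OF bounded_linear_scaleR_left] c h) auto
    then show "((\<lambda>\<alpha>. (\<Prod>b\<in>Basis. (h \<bullet> b) ^ \<alpha> b) *\<^sub>R (\<Sum>b\<in>Basis. c b \<alpha> *\<^sub>R b)) has_sum f (x + h)) multi_indices"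
      by (simp add: euclidean_representation mono_val_def scaleR_sum_right mult.commute)
  qed
qed

text \<open>\<open>u\<close> is replaced by \<open>v\<close> one factor at a time, and each of the
  \<open>mono_deg \<alpha>\<close> factors costs one \<open>\<eta>\<close>. The difference is
  measured relative to \<open>\<rho>\<close> because bounds of the shape
  \<open>n * \<rho> ^ n * \<eta>\<close> are then reproduced by products.\<close>

lemma mono_val_diff:
  fixes u v :: "'c::euclidean_space \<Rightarrow> 'a::euclidean_space"
  assumes r: "0 < r"
    and u: "\<And>b. b \<in> Basis \<Longrightarrow> pser r \<rho> (\<lambda>h. u h \<bullet> b)"
    and v: "\<And>b. b \<in> Basis \<Longrightarrow> pser r \<rho> (\<lambda>h. v h \<bullet> b)"
    and uv: "\<And>b. b \<in> Basis \<Longrightarrow> pser r (\<rho> * \<eta>) (\<lambda>h. u h \<bullet> b - v h \<bullet> b)"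
  shows "pser r (real (mono_deg \<alpha>) * \<rho> ^ mono_deg \<alpha> * \<eta>) (\<lambda>h. mono_val (u h) \<alpha> - mono_val (v h) \<alpha>)"
proof -
  have mult: "pser r (real (m + n) * \<rho> ^ (m + n) * \<eta>) (\<lambda>h. f h * g h - f' h * g' h)"
    if "pser r (real m * \<rho> ^ m * \<eta>) (\<lambda>h. f h - f' h)" "pser r (real n * \<rho> ^ n * \<eta>) (\<lambda>h. g h - g' h)"
      "pser r (\<rho> ^ n) g" "pser r (\<rho> ^ m) f'" for m n and f f' g g' :: "'c \<Rightarrow> real"
  proof -
    have "pser r ((real m * \<rho> ^ m * \<eta>) * \<rho> ^ n + \<rho> ^ m * (real n * \<rho> ^ n * \<eta>))
        (\<lambda>h. (f h - f' h) * g h + f' h * (g h - g' h))"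
      by (intro pser_add pser_mult r that)
    then show ?thesis by (simp add: algebra_simps power_add)
  qed
  have power: "pser r (real n * \<rho> ^ n * \<eta>) (\<lambda>h. (u h \<bullet> b) ^ n - (v h \<bullet> b) ^ n)"
    if b: "b \<in> Basis" for b n
  proof (induction n)
    case 0
    then show ?case using pser_const[OF r, of 0] by simp
  next
    case (Suc n)
    have "pser r (real (1 + n) * \<rho> ^ (1 + n) * \<eta>) (\<lambda>h. (u h \<bullet> b) * (u h \<bullet> b) ^ n - (v h \<bullet> b) * (v h \<bullet> b) ^ n)"
      by (rule mult) (use uv[OF b] Suc pser_power[OF r u[OF b]] v[OF b] in simp_all)
    then show ?case by simp
  qed
  have "pser r (real (sum \<alpha> J) * \<rho> ^ sum \<alpha> J * \<eta>)
      (\<lambda>h. (\<Prod>b\<in>J. (u h \<bullet> b) ^ \<alpha> b) - (\<Prod>b\<in>J. (v h \<bullet> b) ^ \<alpha> b))" if "finite J" "J \<subseteq> Basis" for J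
    using that
  proof (induction J rule: finite_induct)
    case empty
    then show ?case using pser_const[OF r, of 0] by simp
  next
    case (insert b J)
    have "pser r (real (\<alpha> b + sum \<alpha> J) * \<rho> ^ (\<alpha> b + sum \<alpha> J) * \<eta>)
      (\<lambda>h. (u h \<bullet> b) ^ \<alpha> b * (\<Prod>b\<in>J. (u h \<bullet> b) ^ \<alpha> b) - (v h \<bullet> b) ^ \<alpha> b * (\<Prod>b\<in>J. (v h \<bullet> b) ^ \<alpha> b))"
    proof (rule mult)
      show "pser r (\<rho> ^ sum \<alpha> J) (\<lambda>h. \<Prod>b\<in>J. (u h \<bullet> b) ^ \<alpha> b)"
        unfolding power_sum using insert by (intro pser_prod pser_power r u) auto
    qed (use insert power in \<open>auto intro!: pser_power r v\<close>)
    then show ?case using insert by simp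
  qed
  from this[of Basis] show ?thesis by (simp add: mono_val_def mono_deg_def)
qed

text \<open>Without terms of degree at most 1, \<open>f\<close> is quadratically small, so its
  Lipschitz constant at radius \<open>\<rho>\<close> is of order \<open>\<rho>\<close>; the
  conditions on \<open>\<rho>\<close> push it down to one half. The estimate compares coefficient
  norms and not only values, which is what makes the limit of the iteration analytic.\<close>

lemma pser_compose_diff:
  fixes u v :: "'c::euclidean_space \<Rightarrow> 'a::euclidean_space"
  assumes f: "has_pser R B f c" and c: "\<And>\<alpha>. \<alpha> \<in> multi_indices \<Longrightarrow> mono_deg \<alpha> \<le> 1 \<Longrightarrow> c \<alpha> = 0"
    and \<rho>: "0 < \<rho>" "\<rho> \<le> R / 2" "4 * B * \<rho> \<le> R\<^sup>2" and r: "0 < r" and \<delta>: "0 \<le> \<delta>"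
    and u: "\<And>b. b \<in> Basis \<Longrightarrow> pser r \<rho> (\<lambda>h. u h \<bullet> b)"
    and v: "\<And>b. b \<in> Basis \<Longrightarrow> pser r \<rho> (\<lambda>h. v h \<bullet> b)"
    and uv: "\<And>b. b \<in> Basis \<Longrightarrow> pser r \<delta> (\<lambda>h. u h \<bullet> b - v h \<bullet> b)"
  shows "pser r (\<delta> / 2) (\<lambda>h. f (u h) - f (v h))"
proof -
  obtain s where s: "s \<le> B" "((\<lambda>\<alpha>. \<bar>c \<alpha>\<bar> * R ^ mono_deg \<alpha>) has_sum s) multi_indices"
    "\<And>h. h\<in>polydisc R \<Longrightarrow> ((\<lambda>\<alpha>. c \<alpha> * mono_val h \<alpha>) has_sum f h) multi_indices"
    using f unfolding has_pser_def by meson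
  have R: "0 < R" using \<rho> by simp
  \<comment> \<open>Absorbs the factor \<open>n\<close> from \<open>mono_val_diff\<close> into a
    power of 2, which the condition \<open>\<rho> \<le> R / 2\<close> pays for.\<close>
  have pow: "real n \<le> 2 * 2 ^ (n - 2)" if "2 \<le> n" for n :: nat
  proof -
    obtain k where k: "n = k + 2" using \<open>2 \<le> n\<close> by (metis add.commute le_Suc_ex)
    have "real k + 2 \<le> 2 * 2 ^ k"
    proof (induction k)
      case (Suc k)
      have "(1::real) \<le> 2 ^ k" by simp
      with Suc show ?case by simp
    qed simp
    then show ?thesis by (simp add: k)
  qed
  \<comment> \<open>The term of degree \<open>n\<close> is compared with its weight
    \<open>R ^ n\<close>. Since \<open>n\<close> is at least 2, two powers of \<open>\<rho>\<close>
    can be set aside; they leave the small factor \<open>2 * \<rho> * \<delta> / R\<^sup>2\<close>,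
    which \<open>4 * B * \<rho> \<le> R\<^sup>2\<close> later turns into one half.\<close>
  have key: "real n * \<rho> ^ n * (\<delta> / \<rho>) \<le> R ^ n * (2 * \<rho> * \<delta> / R\<^sup>2)" if n: "2 \<le> n" for n
  proof -
    obtain k where k: "n = k + 2" using n by (metis add.commute le_Suc_ex)
    have "real n * \<rho> ^ k \<le> (2 * 2 ^ k) * (R / 2) ^ k"
      using pow[OF n] \<rho> by (intro mult_mono power_mono) (auto simp: k)
    also have "\<dots> = 2 * R ^ k" by (simp add: power_divide)
    finally have "real n * \<rho> ^ k * (\<rho> * \<delta>) \<le> 2 * R ^ k * (\<rho> * \<delta>)"
      using \<rho> \<delta> by (intro mult_right_mono) auto
    moreover have "real n * \<rho> ^ n * (\<delta> / \<rho>) = real n * \<rho> ^ k * (\<rho> * \<delta>)"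
      using \<rho>(1) by (simp add: k power2_eq_square)
    moreover have "R ^ n * (2 * \<rho> * \<delta> / R\<^sup>2) = 2 * R ^ k * (\<rho> * \<delta>)"
      using R by (simp add: k power2_eq_square)
    ultimately show ?thesis by simp
  qed
  have dec: "\<delta> = \<rho> * (\<delta> / \<rho>)" using \<rho> by simp
  have "pser r (s * (2 * \<rho> * \<delta> / R\<^sup>2)) (\<lambda>h. f (u h) - f (v h))"
  proof (rule pser_series[OF r _ has_sum_cmult_left[OF s(2)], where f = "\<lambda>\<alpha> h. c \<alpha> * (mono_val (u h) \<alpha> - mono_val (v h) \<alpha>)"])
    fix \<alpha> :: "'a \<Rightarrow> nat" assume \<alpha>: "\<alpha> \<in> multi_indices"
    have p: "pser r (\<bar>c \<alpha>\<bar> * (real (mono_deg \<alpha>) * \<rho> ^ mono_deg \<alpha> * (\<delta> / \<rho>))) (\<lambda>h. c \<alpha> * (mono_val (u h) \<alpha> - mono_val (v h) \<alpha>))"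
      by (intro pser_cmult r mono_val_diff u v) (use uv dec in auto)
    show "pser r (\<bar>c \<alpha>\<bar> * R ^ mono_deg \<alpha> * (2 * \<rho> * \<delta> / R\<^sup>2)) (\<lambda>h. c \<alpha> * (mono_val (u h) \<alpha> - mono_val (v h) \<alpha>))"
    proof (rule pser_mono[OF p], cases "mono_deg \<alpha> \<le> 1")
      case False
      then show "\<bar>c \<alpha>\<bar> * (real (mono_deg \<alpha>) * \<rho> ^ mono_deg \<alpha> * (\<delta> / \<rho>)) \<le> \<bar>c \<alpha>\<bar> * R ^ mono_deg \<alpha> * (2 * \<rho> * \<delta> / R\<^sup>2)"
        unfolding mult.assoc[of "\<bar>c \<alpha>\<bar>"] using key[of "mono_deg \<alpha>"] by (intro mult_left_mono) auto
    qed (use c[OF \<alpha>] in simp)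
  next
    fix h :: 'c assume h: "h \<in> polydisc r"
    have "u h \<in> polydisc R" "v h \<in> polydisc R"
      using pser_in_polydisc[OF u h] pser_in_polydisc[OF v h] \<rho> R polydisc_mono[of \<rho> R] by auto
    then have "((\<lambda>\<alpha>. c \<alpha> * mono_val (u h) \<alpha> + - (c \<alpha> * mono_val (v h) \<alpha>)) has_sum f (u h) + - f (v h)) multi_indices"
      by (intro has_sum_add s(3)) (simp_all add: has_sum_uminus s(3))
    then show "((\<lambda>\<alpha>. c \<alpha> * (mono_val (u h) \<alpha> - mono_val (v h) \<alpha>)) has_sum f (u h) - f (v h)) multi_indices"
      by (simp add: right_diff_distrib)
  qed
  then show ?thesis
  proof (rule pser_mono)
    have "s * (2 * \<rho> * \<delta> / R\<^sup>2) \<le> B * (2 * \<rho> * \<delta> / R\<^sup>2)"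
      using s(1) \<rho> \<delta> by (intro mult_right_mono) auto
    also have "\<dots> = (4 * B * \<rho>) * \<delta> / R\<^sup>2 / 2" by simp
    also have "\<dots> \<le> R\<^sup>2 * \<delta> / R\<^sup>2 / 2"
      using \<rho>(3) \<delta> by (intro divide_right_mono mult_right_mono) auto
    finally show "s * (2 * \<rho> * \<delta> / R\<^sup>2) \<le> \<delta> / 2" using R by simp
  qed
qed

text \<open>On a coordinate axis only the pure powers of one coordinate survive, and
  \<open>f\<close> becomes a one-variable power series whose first two coefficients are read off
  from the value and the derivative at 0. Every multi-index of degree at most 1 is such a pure
  power.\<close>

lemma has_pser_low_coeffs:
  fixes f :: "'a::euclidean_space \<Rightarrow> real"
  assumes r: "0 < r" and f: "has_pser r B f c" and f0: "f 0 = 0"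
    and d: "(f has_derivative (\<lambda>h. 0)) (at 0)" and \<alpha>: "\<alpha> \<in> multi_indices" "mono_deg \<alpha> \<le> 1"
  shows "c \<alpha> = 0"
proof -
  \<comment> \<open>\<open>\<phi> b k\<close> is the exponent of the monomial
    \<open>(h \<bullet> b) ^ k\<close>.\<close>
  define \<phi> where "\<phi> b k = (\<lambda>b'\<in>Basis. if b' = b then k else 0)" for b :: 'a and k :: nat
  have sums: "(\<lambda>k. c (\<phi> b k) * t ^ k) sums f (t *\<^sub>R b)" if b: "b \<in> Basis" and t: "\<bar>t\<bar> \<le> r" for b t
  proof -
    have h: "t *\<^sub>R b \<in> polydisc r" using b t r by (auto simp: polydisc_def inner_Basis)
    have val: "mono_val (t *\<^sub>R b) (\<phi> b k) = t ^ k" for k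
    proof -
      have "mono_val (t *\<^sub>R b) (\<phi> b k) = (\<Prod>b'\<in>Basis. if b' = b then t ^ k else 1)"
        unfolding mono_val_def \<phi>_def by (rule prod.cong) (use b in \<open>auto simp: inner_Basis\<close>)
      then show ?thesis using b by simp
    qed
    have zero: "mono_val (t *\<^sub>R b) \<beta> = 0" if "\<beta> \<in> multi_indices" "\<beta> \<notin> range (\<phi> b)" for \<beta>
    proof -
      have "\<beta> \<noteq> \<phi> b (\<beta> b)" using that(2) by blast
      then obtain x where x: "\<beta> x \<noteq> \<phi> b (\<beta> b) x" by blast
      have "x \<in> Basis" using x that(1) by (metis PiE_arb \<phi>_def restrict_apply)
      then have "x \<noteq> b" "\<beta> x \<noteq> 0" using x by (auto simp: \<phi>_def split: if_splits)
      then have "(t *\<^sub>R b \<bullet> x) ^ \<beta> x = 0" using b \<open>x \<in> Basis\<close> by (simp add: inner_Basis)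
      then show ?thesis unfolding mono_val_def using \<open>x \<in> Basis\<close> by (meson finite_Basis prod_zero)
    qed
    have "((\<lambda>\<beta>. c \<beta> * mono_val (t *\<^sub>R b) \<beta>) has_sum f (t *\<^sub>R b)) multi_indices"
      using f h by (auto simp: has_pser_def)
    then have "((\<lambda>\<beta>. c \<beta> * mono_val (t *\<^sub>R b) \<beta>) has_sum f (t *\<^sub>R b)) (range (\<phi> b))"
      by (rule has_sum_cong_neutral[THEN iffD1, rotated -1]) (use zero in \<open>auto simp: \<phi>_def\<close>)
    moreover have "inj (\<phi> b)"
    proof (rule injI)
      fix j k assume "\<phi> b j = \<phi> b k"
      then have "\<phi> b j b = \<phi> b k b" by simp
      then show "j = k" using b by (simp add: \<phi>_def)
    qed
    ultimately have "((\<lambda>k. c (\<phi> b k) * mono_val (t *\<^sub>R b) (\<phi> b k)) has_sum f (t *\<^sub>R b)) UNIV"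
      by (subst (asm) has_sum_reindex) (auto simp: o_def)
    then show ?thesis by (intro has_sum_imp_sums) (simp add: val)
  qed
  have low: "c (\<phi> b 0) = 0" "c (\<phi> b 1) = 0" if b: "b \<in> Basis" for b
  proof -
    let ?a = "\<lambda>k. c (\<phi> b k)"
    have "?a 0 = f (0 *\<^sub>R b)"
      using sums_unique[OF sums[OF b, of 0]] r powser_zero[of ?a] by simp
    then show "c (\<phi> b 0) = 0" using f0 by simp
    have "summable (\<lambda>k. ?a k * r ^ k)" using sums[OF b, of r] r by (auto simp: sums_iff)
    then have "DERIV (\<lambda>x. \<Sum>n. ?a n * x ^ n) 0 :> (\<Sum>n. diffs ?a n * 0 ^ n)"
      by (rule termdiffs_strong) (use r in simp)
    then have "DERIV (\<lambda>x. \<Sum>n. ?a n * x ^ n) 0 :> ?a 1"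
      unfolding powser_zero by (simp add: diffs_def)
    then have "DERIV (\<lambda>t. f (t *\<^sub>R b)) 0 :> ?a 1"
      by (rule has_field_derivative_transform_within[OF _ r])
        (use sums_unique[OF sums[OF b]] in \<open>auto simp: dist_real_def\<close>)
    moreover have "DERIV (\<lambda>t. f (t *\<^sub>R b)) 0 :> 0"
    proof -
      have "((\<lambda>t. f (t *\<^sub>R b)) has_derivative (\<lambda>t. 0)) (at 0)"
        by (rule has_derivative_compose[of "\<lambda>t. t *\<^sub>R b" "\<lambda>t. t *\<^sub>R b" 0 UNIV f "\<lambda>h. 0"])
          (use d in \<open>auto intro!: derivative_eq_intros\<close>)
      then show ?thesis by (simp only: has_field_derivative_def lambda_zero)
    qed
    ultimately show "c (\<phi> b 1) = 0" by (rule DERIV_unique)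
  qed
  have "\<exists>b\<in>Basis. \<alpha> = \<phi> b 0 \<or> \<alpha> = \<phi> b 1"
  proof (cases "\<exists>b\<in>Basis. \<alpha> b \<noteq> 0")
    case True
    then obtain b where b: "b \<in> Basis" "\<alpha> b \<noteq> 0" by blast
    have "mono_deg \<alpha> = \<alpha> b + (\<Sum>x\<in>Basis - {b}. \<alpha> x)"
      unfolding mono_deg_def using b by (simp add: sum.remove)
    then have "\<alpha> b = 1" "(\<Sum>x\<in>Basis - {b}. \<alpha> x) = 0" using \<alpha>(2) b(2) by linarith+
    then have "\<alpha> = \<phi> b 1"
      using \<alpha>(1) by (intro extensionalityI[of _ Basis]) (auto simp: \<phi>_def PiE_def)
    then show ?thesis using b by blast
  next
    case False
    \<comment> \<open>The zero exponent equals \<open>\<phi> b 0\<close> for every \<open>b\<close>,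
      so any basis vector will do.\<close>
    obtain b :: 'a where "b \<in> Basis" using nonempty_Basis by blast
    moreover have "\<alpha> = \<phi> b 0"
      using \<alpha>(1) False by (intro extensionalityI[of _ Basis]) (auto simp: \<phi>_def PiE_def)
    ultimately show ?thesis by blast
  qed
  then show ?thesis using low by blast
qed

section \<open>The analytic inverse of a perturbation of the identity\<close>

text \<open>The inverse \<open>h\<close> comes with a coefficient bound, from which its analyticity
  follows after recentring. The last estimate yields both injectivity of Id + \<open>f\<close> and
  Lipschitz continuity of \<open>h\<close>; its constant is 2 from the contraction times the
  dimension from comparing the largest coordinate with the norm. Through \<open>\<epsilon>\<close> a
  caller prescribes how small \<open>polydisc \<rho>\<close> must be.\<close>

theorem analytic_perturbation_of_identity:
  fixes f :: "'a::euclidean_space \<Rightarrow> 'a"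
  assumes R: "0 < R" and f: "\<And>b. b \<in> Basis \<Longrightarrow> pser R B (\<lambda>h. f h \<bullet> b)"
    and f0: "f 0 = 0" and d: "(f has_derivative (\<lambda>h. 0)) (at 0)" and \<epsilon>: "0 < \<epsilon>"
  obtains r \<rho> h where "0 < r" "r \<le> \<rho>" "\<rho> \<le> \<epsilon>"
    "\<And>b. b \<in> Basis \<Longrightarrow> pser r (2 * \<rho>) (\<lambda>y. h y \<bullet> b)"
    "\<And>y. y \<in> polydisc r \<Longrightarrow> h y \<in> polydisc \<rho>"
    "\<And>y. y \<in> polydisc r \<Longrightarrow> h y + f (h y) = y"
    "\<And>x y. x \<in> polydisc \<rho> \<Longrightarrow> y \<in> polydisc \<rho> \<Longrightarrow>
       norm (x - y) \<le> 2 * DIM('a) * norm ((x + f x) - (y + f y))"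
proof -
  obtain b0 :: 'a where b0: "b0 \<in> Basis" using nonempty_Basis by blast
  have B: "0 \<le> B" using pser_nonneg[OF f[OF b0]] R by simp
  have "\<exists>c. \<forall>b\<in>Basis. has_pser R B (\<lambda>h. f h \<bullet> b) (c b)"
    using f by (intro bchoice) (auto simp: pser_def)
  then obtain c where c: "\<And>b. b \<in> Basis \<Longrightarrow> has_pser R B (\<lambda>h. f h \<bullet> b) (c b)" by blast
  have low: "c b \<alpha> = 0" if "b \<in> Basis" "\<alpha> \<in> multi_indices" "mono_deg \<alpha> \<le> 1" for b \<alpha>
  proof (rule has_pser_low_coeffs[OF R c[OF that(1)] _ _ that(2,3)])
    show "((\<lambda>h. f h \<bullet> b) has_derivative (\<lambda>h. 0)) (at 0)"
      using has_derivative_inner_left[OF d, of b] by simp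
  qed (simp add: f0)
  \<comment> \<open>These are the smallness conditions of \<open>pser_compose_diff\<close>; the
    \<open>+ 1\<close> keeps the quotient meaningful when \<open>B = 0\<close>.\<close>
  define \<rho> where "\<rho> = min \<epsilon> (min (R / 2) (R\<^sup>2 / (4 * B + 1)))"
  have "0 < \<rho>" using R \<epsilon> B by (simp add: \<rho>_def)
  moreover have "\<rho> \<le> \<epsilon>" "\<rho> \<le> R / 2" "\<rho> \<le> R\<^sup>2 / (4 * B + 1)"
    unfolding \<rho>_def by (meson min.cobounded1 min.cobounded2 order_trans)+
  ultimately have \<rho>: "0 < \<rho>" "\<rho> \<le> \<epsilon>" "\<rho> \<le> R / 2" "\<rho> \<le> R\<^sup>2 / (4 * B + 1)" .
  have "\<rho> * (4 * B + 1) \<le> R\<^sup>2" using \<rho>(4) B by (simp add: pos_le_divide_eq)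
  then have \<rho>': "4 * B * \<rho> \<le> R\<^sup>2" using \<rho>(1) by (simp add: algebra_simps)
  \<comment> \<open>Half of \<open>\<rho>\<close> is left for \<open>y\<close>, because
    \<open>f\<close> of an iterate uses up the other half.\<close>
  define r where "r = \<rho> / 2"
  have r: "0 < r" using \<rho> by (simp add: r_def)
  have contract: "pser r (\<delta> / 2) (\<lambda>y. f (u y) \<bullet> b - f (v y) \<bullet> b)"
    if "0 \<le> \<delta>" "\<And>b. b \<in> Basis \<Longrightarrow> pser r \<rho> (\<lambda>h. u h \<bullet> b)" "\<And>b. b \<in> Basis \<Longrightarrow> pser r \<rho> (\<lambda>h. v h \<bullet> b)"
      "\<And>b. b \<in> Basis \<Longrightarrow> pser r \<delta> (\<lambda>h. u h \<bullet> b - v h \<bullet> b)" "b \<in> Basis"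
    for u v :: "'a \<Rightarrow> 'a" and \<delta> b
    by (rule pser_compose_diff[OF c[OF that(5)] low[OF that(5)] \<rho>(1,3) \<rho>' r that(1-4)])
  have const: "pser r \<rho> (\<lambda>h::'a. x \<bullet> b)" if "x \<in> polydisc \<rho>" "b \<in> Basis" for x b :: 'a
    by (rule pser_mono[OF pser_const[OF r]]) (use that in \<open>auto simp: polydisc_def\<close>)
  \<comment> \<open>Applied to the constant maps with values \<open>x\<close> and \<open>y\<close>,
    the contraction of coefficient norms becomes a Lipschitz bound for values in the maximum
    norm.\<close>
  have lip_inf: "\<bar>f x \<bullet> b - f y \<bullet> b\<bar> \<le> \<delta> / 2"
    if "x \<in> polydisc \<rho>" "y \<in> polydisc \<rho>" "b \<in> Basis" "0 \<le> \<delta>" "\<And>b. b \<in> Basis \<Longrightarrow> \<bar>(x - y) \<bullet> b\<bar> \<le> \<delta>" for x y b \<delta>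
  proof -
    have "pser r \<delta> (\<lambda>h::'a. x \<bullet> b' - y \<bullet> b')" if "b' \<in> Basis" for b'
      by (rule pser_mono[OF pser_const[OF r]]) (use \<open>\<And>b. b \<in> Basis \<Longrightarrow> \<bar>(x - y) \<bullet> b\<bar> \<le> \<delta>\<close>[OF that] in \<open>simp add: inner_diff_left\<close>)
    then have "pser r (\<delta> / 2) (\<lambda>h::'a. f x \<bullet> b - f y \<bullet> b)"
      by (intro contract[where u = "\<lambda>_. x" and v = "\<lambda>_. y"] const that) auto
    from pser_bound[OF this, of 0] show ?thesis using r by simp
  qed
  have lip: "\<bar>f x \<bullet> b - f y \<bullet> b\<bar> \<le> norm (x - y) / 2"
    if "x \<in> polydisc \<rho>" "y \<in> polydisc \<rho>" "b \<in> Basis" for x y b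
    by (rule lip_inf[OF that norm_ge_zero Basis_le_norm])
  have expand: "norm (x - y) \<le> 2 * DIM('a) * norm ((x + f x) - (y + f y))"
    if xy: "x \<in> polydisc \<rho>" "y \<in> polydisc \<rho>" for x y
  proof -
    define \<delta> where "\<delta> = Max ((\<lambda>b. \<bar>(x - y) \<bullet> b\<bar>) ` Basis)"
    have \<delta>: "\<bar>(x - y) \<bullet> b\<bar> \<le> \<delta>" if "b \<in> Basis" for b
      unfolding \<delta>_def using that by (intro Max_ge) auto
    have \<delta>0: "0 \<le> \<delta>" using \<delta>[OF b0] by linarith
    have "\<delta> \<in> (\<lambda>b. \<bar>(x - y) \<bullet> b\<bar>) ` Basis" unfolding \<delta>_def by (intro Max_in) auto
    then obtain b where b: "b \<in> Basis" "\<delta> = \<bar>(x - y) \<bullet> b\<bar>" by blast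
    let ?w = "(x + f x) - (y + f y)"
    have "(x - y) \<bullet> b = ?w \<bullet> b - (f x \<bullet> b - f y \<bullet> b)"
      by (simp add: inner_diff_left inner_add_left)
    moreover have "\<bar>?w \<bullet> b\<bar> \<le> norm ?w" using b(1) by (rule Basis_le_norm)
    moreover have "\<bar>f x \<bullet> b - f y \<bullet> b\<bar> \<le> \<delta> / 2" using lip_inf[OF xy b(1) \<delta>0 \<delta>] .
    ultimately have \<delta>_le: "\<delta> \<le> 2 * norm ?w" unfolding b(2) by linarith
    have "norm (x - y) \<le> (\<Sum>b\<in>Basis. \<bar>(x - y) \<bullet> b\<bar>)" by (rule norm_le_l1)
    also have "\<dots> \<le> real DIM('a) * \<delta>" by (rule sum_bounded_above[OF \<delta>])
    also have "\<dots> \<le> real DIM('a) * (2 * norm ?w)" by (rule mult_left_mono[OF \<delta>_le]) simp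
    finally show ?thesis by (simp add: mult_ac)
  qed
  define it where "it k y = ((\<lambda>x. y - f x) ^^ k) 0" for k :: nat and y
  have it_Suc: "it (Suc k) y = y - f (it k y)" for k y by (simp add: it_def)
  have p\<rho>: "0 \<le> \<rho>" using \<rho> by simp
  have it: "pser r \<rho> (\<lambda>y. it k y \<bullet> b)" if "b \<in> Basis" for k b
    using that
  proof (induction k arbitrary: b)
    case 0
    show ?case using pser_mono[OF pser_const[OF r, of 0]] p\<rho> by (simp add: it_def)
  next
    case (Suc k)
    have "pser r (\<rho> / 2) (\<lambda>y. f (it k y) \<bullet> b - f 0 \<bullet> b)"
      by (rule contract[OF p\<rho>]) (use Suc const[of 0] p\<rho> in auto)
    then have "pser r (r + \<rho> / 2) (\<lambda>y. y \<bullet> b - f (it k y) \<bullet> b)"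
      by (intro pser_diff[OF r pser_inner_Basis[OF r Suc.prems]]) (simp add: f0)
    then show ?case by (simp add: it_Suc inner_diff_left r_def)
  qed
  have it_diff: "pser r (\<rho> * (1 / 2) ^ k) (\<lambda>y. it (Suc k) y \<bullet> b - it k y \<bullet> b)" if "b \<in> Basis" for k b
    using that
  proof (induction k arbitrary: b)
    case 0
    then show ?case using it[OF 0, of 1] by (simp add: it_def)
  next
    case (Suc k)
    have "pser r (\<rho> * (1 / 2) ^ k / 2) (\<lambda>y. f (it (Suc k) y) \<bullet> b - f (it k y) \<bullet> b)"
      by (rule contract) (use Suc it p\<rho> in auto)
    from pser_cmult[OF r this, of "- 1"]
    show ?case by (simp add: it_Suc[of "Suc k"] it_Suc[of k] inner_diff_left algebra_simps)
  qed
  \<comment> \<open>Successive iterates differ by at most \<open>\<rho> * (1 / 2) ^ k\<close> in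
    coefficient norm; the total \<open>2 * \<rho>\<close> bounds the series of the limit.\<close>
  have geo: "((\<lambda>k. \<rho> * (1 / 2) ^ k) has_sum (2 * \<rho>)) UNIV"
  proof (rule sums_nonneg_imp_has_sum)
    show "(\<lambda>k. \<rho> * (1 / 2) ^ k) sums (2 * \<rho>)"
      using sums_mult[OF geometric_sums[of "1/2 :: real"], of \<rho>] by (simp add: mult.commute)
  qed (use p\<rho> in auto)
  define h where "h y = (\<Sum>b\<in>Basis. (\<Sum>\<^sub>\<infinity>k\<in>UNIV. it (Suc k) y \<bullet> b - it k y \<bullet> b) *\<^sub>R b)" for y
  have h_sum: "((\<lambda>k. it (Suc k) y \<bullet> b - it k y \<bullet> b) has_sum h y \<bullet> b) UNIV"
    if y: "y \<in> polydisc r" and b: "b \<in> Basis" for y b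
  proof -
    have "(\<lambda>k. it (Suc k) y \<bullet> b - it k y \<bullet> b) summable_on UNIV"
      by (rule summable_on_abs_le[OF geo]) (use pser_bound[OF it_diff[OF b] y] in auto)
    then show ?thesis using b by (simp add: h_def)
  qed
  have h: "pser r (2 * \<rho>) (\<lambda>y. h y \<bullet> b)" if b: "b \<in> Basis" for b
    by (rule pser_series[OF r it_diff[OF b] geo h_sum[OF _ b]])
  have lim: "(\<lambda>k. it k y) \<longlonglongrightarrow> h y" if y: "y \<in> polydisc r" for y
  proof (subst tendsto_componentwise_iff, intro ballI)
    fix b :: 'a assume b: "b \<in> Basis"
    have "(\<lambda>k. it (Suc k) y \<bullet> b - it k y \<bullet> b) sums (h y \<bullet> b)"
      by (rule has_sum_imp_sums[OF h_sum[OF y b]])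
    then have "(\<lambda>n. \<Sum>k<n. it (Suc k) y \<bullet> b - it k y \<bullet> b) \<longlonglongrightarrow> h y \<bullet> b"
      by (simp add: sums_def)
    then show "(\<lambda>k. it k y \<bullet> b) \<longlonglongrightarrow> h y \<bullet> b"
      by (simp add: sum_lessThan_telescope[where f = "\<lambda>k. it k y \<bullet> b"]) (simp add: it_def)
  qed
  have it_in: "it k y \<in> polydisc \<rho>" if "y \<in> polydisc r" for k y
    using pser_in_polydisc[OF it that] .
  \<comment> \<open>The coefficient bound of \<open>h\<close> would only give
    \<open>2 * \<rho>\<close>. As a limit of iterates, \<open>h y\<close> stays in the closed
    polydisc of radius \<open>\<rho>\<close>, where the Lipschitz bounds hold.\<close>
  have h_in: "h y \<in> polydisc \<rho>" if y: "y \<in> polydisc r" for y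
    unfolding polydisc_def
  proof safe
    fix b :: 'a assume b: "b \<in> Basis"
    have "(\<lambda>k. \<bar>it k y \<bullet> b\<bar>) \<longlonglongrightarrow> \<bar>h y \<bullet> b\<bar>"
      by (intro tendsto_rabs tendsto_inner lim[OF y] tendsto_const)
    then show "\<bar>h y \<bullet> b\<bar> \<le> \<rho>"
      by (rule LIMSEQ_le_const2) (use it_in[OF y] b in \<open>auto simp: polydisc_def\<close>)
  qed
  have fix_pt: "h y + f (h y) = y" if y: "y \<in> polydisc r" for y
  proof -
    have "(\<lambda>k. f (it k y)) \<longlonglongrightarrow> f (h y)"
    proof (subst tendsto_componentwise_iff, intro ballI)
      fix b :: 'a assume b: "b \<in> Basis"
      have "(\<lambda>k. norm (it k y - h y) / 2) \<longlonglongrightarrow> 0"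
        using tendsto_norm_zero[OF LIM_zero[OF lim[OF y]]] by (auto intro: tendsto_eq_intros)
      then have "(\<lambda>k. f (it k y) \<bullet> b - f (h y) \<bullet> b) \<longlonglongrightarrow> 0"
        by (rule Lim_null_comparison[rotated])
          (use lip[OF it_in[OF y] h_in[OF y] b] in \<open>simp add: eventually_sequentially\<close>)
      then show "(\<lambda>k. f (it k y) \<bullet> b) \<longlonglongrightarrow> f (h y) \<bullet> b" by (rule LIM_zero_cancel)
    qed
    then have "(\<lambda>k. it (Suc k) y) \<longlonglongrightarrow> y - f (h y)"
      unfolding it_Suc by (intro tendsto_diff tendsto_const)
    then have "h y = y - f (h y)"
      using LIMSEQ_unique[OF LIMSEQ_Suc[OF lim[OF y]]] by blast
    then show ?thesis by (simp add: algebra_simps)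
  qed
  show ?thesis
    by (rule that[OF r _ \<rho>(2) h h_in fix_pt expand]) (use \<rho> in \<open>simp_all add: r_def\<close>)
qed

section \<open>Entire maps\<close>

text \<open>A series at every radius is demanded, with a bound depending on the radius: sums,
  products and linear substitutions then need no tracking of radii, and recentring is possible at
  every point.\<close>

definition entire :: "('a::euclidean_space \<Rightarrow> 'b::euclidean_space) \<Rightarrow> bool" where
  "entire f \<longleftrightarrow> (\<forall>b\<in>Basis. \<forall>r>0. \<exists>B. pser r B (\<lambda>h. f h \<bullet> b))"

lemma entire_real_iff: "entire f \<longleftrightarrow> (\<forall>r>0. \<exists>B. pser r B f)" for f :: "'a::euclidean_space \<Rightarrow> real"
  by (simp add: entire_def)

lemma entire_componentwise: "entire f \<longleftrightarrow> (\<forall>b\<in>Basis. entire (\<lambda>h. f h \<bullet> b))"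
  by (simp add: entire_def)

lemma entire_recenter:
  fixes f :: "'a::euclidean_space \<Rightarrow> 'b::euclidean_space"
  assumes "entire f" "0 < r" "b \<in> Basis"
  shows "\<exists>B. pser r B (\<lambda>h. f (p + h) \<bullet> b)"
proof -
  obtain B where "pser (norm p + r) B (\<lambda>h. f h \<bullet> b)"
    using assms unfolding entire_def by (meson add_nonneg_pos norm_ge_zero)
  from pser_recenter[OF this norm_imp_polydisc[OF order_refl, of p]] assms(2) show ?thesis by auto
qed

lemma entire_imp_analytic:
  assumes "entire f"
  shows "real_analytic_at f x"
proof -
  have "\<exists>B. \<forall>b\<in>Basis. pser 1 (B b) (\<lambda>h. f (x + h) \<bullet> b)"
    using entire_recenter[OF assms, of 1] by (intro bchoice) auto
  then show ?thesis using real_analytic_at_pser[of 1] by (metis zero_less_one)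
qed

lemma pser_isCont_0:
  fixes f :: "'a::euclidean_space \<Rightarrow> real"
  assumes r: "0 < r" and f: "pser r B f"
  shows "f \<midarrow>0\<rightarrow> f 0"
proof (rule LIM_zero_cancel, rule Lim_null_comparison)
  show "\<forall>\<^sub>F h in at 0. norm (f h - f 0) \<le> B * (norm h / r)"
    unfolding eventually_at using pser_diff_at_0[OF r f] r
    by (intro exI[of _ r]) auto
  have "(\<lambda>h::'a. B * (norm h / r)) \<midarrow>0\<rightarrow> B * (norm (0::'a) / r)"
    using r by (intro tendsto_intros) auto
  then show "(\<lambda>h::'a. B * (norm h / r)) \<midarrow>0\<rightarrow> 0" by simp
qed

lemma entire_imp_continuous:
  fixes f :: "'a::euclidean_space \<Rightarrow> 'b::euclidean_space"
  assumes "entire f"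
  shows "continuous_on S f"
proof -
  have "isCont f p" for p
    unfolding isCont_iff
  proof (subst tendsto_componentwise_iff, intro ballI)
    fix b :: 'b assume b: "b \<in> Basis"
    obtain B where "pser 1 B (\<lambda>h. f (p + h) \<bullet> b)" using entire_recenter[OF assms _ b, of 1] by auto
    from pser_isCont_0[OF _ this] show "(\<lambda>h. f (p + h) \<bullet> b) \<midarrow>0\<rightarrow> f p \<bullet> b" by simp
  qed
  then show ?thesis by (simp add: continuous_at_imp_continuous_on)
qed

lemma entire_const: "entire (\<lambda>h. c)"
  unfolding entire_def using pser_const by blast

lemma entire_add:
  fixes f g :: "'a::euclidean_space \<Rightarrow> 'b::euclidean_space"
  assumes "entire f" "entire g"
  shows "entire (\<lambda>h. f h + g h)"
  unfolding entire_def inner_add_left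
proof (intro ballI allI impI)
  fix b :: 'b and r :: real assume "b \<in> Basis" "0 < r"
  then obtain B C where "pser r B (\<lambda>h. f h \<bullet> b)" "pser r C (\<lambda>h. g h \<bullet> b)"
    using assms unfolding entire_def by meson
  from pser_add[OF \<open>0 < r\<close> this] show "\<exists>B. pser r B (\<lambda>h. f h \<bullet> b + g h \<bullet> b)" by blast
qed

lemma entire_sum:
  fixes f :: "'i \<Rightarrow> 'a::euclidean_space \<Rightarrow> 'b::euclidean_space"
  shows "(\<And>i. i \<in> I \<Longrightarrow> entire (f i)) \<Longrightarrow> entire (\<lambda>h. \<Sum>i\<in>I. f i h)"
  by (induction I rule: infinite_finite_induct) (auto intro: entire_const entire_add)

lemma entire_mult:
  fixes f g :: "'a::euclidean_space \<Rightarrow> real"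
  assumes "entire f" "entire g"
  shows "entire (\<lambda>h. f h * g h)"
  unfolding entire_real_iff
proof (intro allI impI)
  fix r :: real assume "0 < r"
  then obtain B C where "pser r B f" "pser r C g"
    using assms unfolding entire_real_iff by meson
  from pser_mult[OF \<open>0 < r\<close> this] show "\<exists>B. pser r B (\<lambda>h. f h * g h)" by blast
qed

lemma entire_linear:
  fixes f :: "'a::euclidean_space \<Rightarrow> 'b::euclidean_space"
  assumes "linear f"
  shows "entire f"
proof (subst entire_componentwise, intro ballI)
  fix b :: 'b
  have "f h = (\<Sum>a\<in>Basis. (h \<bullet> a) *\<^sub>R f a)" for h
    using linear_sum[OF assms, of "\<lambda>a. (h \<bullet> a) *\<^sub>R a" Basis]
    by (simp add: euclidean_representation linear_scale[OF assms])
  then have eq: "f h \<bullet> b = (\<Sum>a\<in>Basis. (h \<bullet> a) * (f a \<bullet> b))" for h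
    by (metis (no_types, lifting) inner_scaleR_left inner_sum_left sum.cong)
  have "entire (\<lambda>h. \<Sum>a\<in>Basis. (h \<bullet> a) * (f a \<bullet> b))"
  proof (intro entire_sum entire_mult entire_const)
    fix a :: 'a assume "a \<in> Basis"
    then show "entire (\<lambda>h. h \<bullet> a)" using pser_inner_Basis unfolding entire_real_iff by blast
  qed
  moreover have "(\<lambda>h. f h \<bullet> b) = (\<lambda>h. \<Sum>a\<in>Basis. (h \<bullet> a) * (f a \<bullet> b))"
    by (rule ext) (rule eq)
  ultimately show "entire (\<lambda>h. f h \<bullet> b)" by simp
qed

text \<open>If \<open>B\<close> bounds the norm of \<open>f\<close>, the n-th term has norm at most
  \<open>\<bar>a n\<bar> * B ^ n\<close>, and these bounds are summable for every \<open>B\<close>.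
  This is the route to cosine and sine.\<close>

lemma entire_power_series:
  fixes f :: "'a::euclidean_space \<Rightarrow> real"
  assumes f: "entire f" and a: "\<And>x. 0 \<le> x \<Longrightarrow> summable (\<lambda>n. \<bar>a n\<bar> * x ^ n)"
    and F: "\<And>x. (\<lambda>n. a n * x ^ n) sums F x"
  shows "entire (\<lambda>h. F (f h))"
  unfolding entire_real_iff
proof (intro allI impI)
  fix r :: real assume r: "0 < r"
  then obtain B where B: "pser r B f" using f unfolding entire_real_iff by blast
  have B0: "0 \<le> B" using pser_nonneg[OF B] r by simp
  have abs: "summable (\<lambda>n. norm (a n * x ^ n))" for x
    using a[of "\<bar>x\<bar>"] by (simp add: abs_mult power_abs)
  have "(\<lambda>n. \<bar>a n\<bar> * B ^ n) sums suminf (\<lambda>n. \<bar>a n\<bar> * B ^ n)" using a[OF B0] by (rule summable_sums)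
  then have "((\<lambda>n. \<bar>a n\<bar> * B ^ n) has_sum suminf (\<lambda>n. \<bar>a n\<bar> * B ^ n)) UNIV"
    by (rule sums_nonneg_imp_has_sum) (use B0 in auto)
  then have "pser r (suminf (\<lambda>n. \<bar>a n\<bar> * B ^ n)) (\<lambda>h. F (f h))"
    by (rule pser_series[where I = UNIV and f = "\<lambda>n h. a n * f h ^ n", OF r pser_cmult[OF r pser_power[OF r B]]])
      (rule norm_summable_imp_has_sum[OF abs F])
  then show "\<exists>B. pser r B (\<lambda>h. F (f h))" by blast
qed

lemma entire_cos:
  fixes f :: "'a::euclidean_space \<Rightarrow> real"
  assumes "entire f"
  shows "entire (\<lambda>h. cos (f h))"
proof (rule entire_power_series[OF assms, of cos_coeff])
  show "summable (\<lambda>n. \<bar>cos_coeff n\<bar> * x ^ n)" if "0 \<le> x" for x :: real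
    using summable_norm_cos[of x] that by (simp add: abs_mult)
  show "(\<lambda>n. cos_coeff n * x ^ n) sums cos x" for x :: real
    using cos_converges[of x] by simp
qed

lemma entire_sin:
  fixes f :: "'a::euclidean_space \<Rightarrow> real"
  assumes "entire f"
  shows "entire (\<lambda>h. sin (f h))"
proof (rule entire_power_series[OF assms, of sin_coeff])
  show "summable (\<lambda>n. \<bar>sin_coeff n\<bar> * x ^ n)" if "0 \<le> x" for x :: real
    using summable_norm_sin[of x] that by (simp add: abs_mult)
  show "(\<lambda>n. sin_coeff n * x ^ n) sums sin x" for x :: real
    using sin_converges[of x] by simp
qed

lemma entire_scaleR:
  fixes f :: "'a::euclidean_space \<Rightarrow> real" and g :: "'a \<Rightarrow> 'b::euclidean_space"
  assumes "entire f" "entire g"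
  shows "entire (\<lambda>h. f h *\<^sub>R g h)"
proof (subst entire_componentwise, intro ballI)
  fix b :: 'b assume "b \<in> Basis"
  then have "entire (\<lambda>h. g h \<bullet> b)" using assms(2) by (subst (asm) entire_componentwise) blast
  then show "entire (\<lambda>h. (f h *\<^sub>R g h) \<bullet> b)" using entire_mult[OF assms(1)] by simp
qed

lemma entire_cart_iff:
  fixes F :: "'a::euclidean_space \<Rightarrow> real^'n^'m"
  shows "entire F \<longleftrightarrow> (\<forall>i j. entire (\<lambda>h. F h $ i $ j))"
proof -
  have "F h \<bullet> axis i (axis j 1) = F h $ i $ j" for h i j
    by (simp add: inner_axis)
  then show ?thesis
    by (subst entire_componentwise) (auto simp: Basis_vec_def)
qed

lemma entire_matrix_mult:
  fixes F G :: "'a::euclidean_space \<Rightarrow> real^'n^'n"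
  assumes "entire F" "entire G"
  shows "entire (\<lambda>h. F h ** G h)"
  using assms unfolding entire_cart_iff matrix_matrix_mult_def
  by (auto intro!: entire_sum entire_mult)

lemma bounded_bilinear_matrix_mult:
  "bounded_bilinear (\<lambda>A B :: real^'n^'n. A ** B)"
  unfolding bilinear_conv_bounded_bilinear[symmetric] bilinear_def
  by (auto intro!: linearI
      simp: matrix_matrix_mult_def vec_eq_iff sum.distrib sum_distrib_left algebra_simps)

section \<open>Local coordinates on G2\<close>

text \<open>The injective multiplicative map \<open>P\<close> is cancelled from both sides. This
  serves for a factor \<open>mat 1 + z\<close> whose invertibility is not at hand, and for the
  inverse of an element of \<open>G2\<close>.\<close>

lemma G2_left_cancel:
  assumes P: "P \<in> G2" and M: "P ** N \<in> G2"
  shows "N *v (x \<odot> y) = (N *v x) \<odot> (N *v y)"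
proof -
  have "P *v (N *v (x \<odot> y)) = P *v ((N *v x) \<odot> (N *v y))"
    using P M by (simp add: G2_def matrix_vector_mul_assoc)
  moreover obtain Q where "Q ** P = mat 1" using P by (auto simp: G2_def invertible_def)
  then have "Q *v (P *v v) = v" for v by (simp add: matrix_vector_mul_assoc)
  ultimately show ?thesis by metis
qed

lemma bounded_bilinear_oct_mult: "bounded_bilinear (\<odot>)"
  unfolding bilinear_conv_bounded_bilinear[symmetric] bilinear_def
  by (auto intro!: linearI
      simp: oct_mult_def algebra_simps scaleR_sum_right sum.distrib scaleR_add_left)

section \<open>The derivation defect and its quadratic error\<close>

definition derivation_defect :: "oct_matrix \<Rightarrow> octonion^8^8" where
  "derivation_defect Z = (\<chi> i j. Z *v (oct_e i \<odot> oct_e j)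
     - (Z *v oct_e i) \<odot> oct_e j - oct_e i \<odot> (Z *v oct_e j))"

definition product_of_images :: "oct_matrix \<Rightarrow> oct_matrix \<Rightarrow> octonion^8^8" where
  "product_of_images Z W = (\<chi> i j. (Z *v oct_e i) \<odot> (W *v oct_e j))"

lemma linear_derivation_defect: "linear derivation_defect"
proof -
  interpret bounded_bilinear "(\<odot>)" by (rule bounded_bilinear_oct_mult)
  show ?thesis
    by (rule linearI) (simp_all add: derivation_defect_def vec_eq_iff matrix_vector_mult_add_rdistrib
      add_left add_right scaleR_left scaleR_right algebra_simps scaleR_matrix_vector_assoc[symmetric])
qed

lemma bounded_bilinear_product_of_images: "bounded_bilinear product_of_images"
proof -
  interpret bounded_bilinear "(\<odot>)" by (rule bounded_bilinear_oct_mult)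
  show ?thesis
    unfolding bilinear_conv_bounded_bilinear[symmetric] bilinear_def
    by (auto intro!: linearI simp: product_of_images_def vec_eq_iff matrix_vector_mult_add_rdistrib
      add_left add_right scaleR_left scaleR_right scaleR_matrix_vector_assoc[symmetric])
qed

text \<open>In the expansion around \<open>mat 1\<close> the terms of order zero cancel, the linear
  ones form the defect, and the product of \<open>z x\<close> and \<open>z y\<close> remains as the
  error.\<close>

lemma defect_of_automorphism:
  assumes "\<And>x y. (mat 1 + z) *v (x \<odot> y) = ((mat 1 + z) *v x) \<odot> ((mat 1 + z) *v y)"
  shows "derivation_defect z = product_of_images z z"
proof -
  interpret bounded_bilinear "(\<odot>)" by (rule bounded_bilinear_oct_mult)
  show ?thesis
    using assms
    by (simp add: derivation_defect_def product_of_images_def vec_eq_iff matrix_vector_mult_add_rdistrib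
      add_left add_right algebra_simps)
qed

text \<open>
  The transversal coordinate z of a point P(t)(1 + z) of G2 near the identity vanishes:
  z is a derivation up to a quadratic error, and 0 is the only derivation in the transversal.
\<close>

lemma small_transversal_automorphism:
  fixes \<kappa> :: "oct_matrix \<Rightarrow> 'a::euclidean_space" and L :: "'a \<Rightarrow> oct_matrix"
  assumes \<kappa>: "linear \<kappa>" "\<And>t. \<kappa> (L t) = t"
    and der: "\<And>Z. derivation_defect Z = 0 \<Longrightarrow> Z \<in> range L"
  obtains \<delta> where "0 < \<delta>" "\<And>z. norm z < \<delta> \<Longrightarrow> \<kappa> z = 0 \<Longrightarrow>
    (\<And>x y. (mat 1 + z) *v (x \<odot> y) = ((mat 1 + z) *v x) \<odot> ((mat 1 + z) *v y)) \<Longrightarrow> z = 0"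
proof -
  \<comment> \<open>Paired with \<open>\<kappa>\<close>, the defect becomes injective: the kernel
    consists of the derivations killed by \<open>\<kappa>\<close>. In finite dimension
    \<open>N\<close> is therefore bounded below by \<open>c * norm z\<close>, which exceeds the
    quadratic error \<open>norm z * norm z * K\<close> for small nonzero \<open>z\<close>.\<close>
  define N where "N z = (derivation_defect z, \<kappa> z)" for z
  have lin: "linear N"
    using linear_derivation_defect \<kappa>(1)
    by (intro linearI) (simp_all add: N_def linear_add linear_scale)
  have "inj N"
  proof (subst linear_injective_0[OF lin], intro allI impI)
    fix z assume z: "N z = 0"
    then obtain t where t: "z = L t" using der[of z] by (auto simp: N_def zero_prod_def)
    with z \<kappa>(2) have "t = 0" by (simp add: N_def zero_prod_def)
    \<comment> \<open>Linearity of \<open>L\<close> is not among the assumptions; the value at 0 is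
      recovered from the fact that 0 has defect 0 and hence lies in the range of
      \<open>L\<close>.\<close>
    moreover have "L 0 = 0" 
    proof -
      obtain s where "0 = L s" using der[of 0] linear_0[OF linear_derivation_defect] by auto
      moreover from this have "s = 0" using \<kappa> linear_0[OF \<kappa>(1)] by metis
      ultimately show ?thesis by simp
    qed
    ultimately show "z = 0" using t by simp
  qed
  then obtain c where c: "0 < c" "\<And>z. c * norm z \<le> norm (N z)"
    using linear_inj_bounded_below_pos[OF lin] by blast
  obtain K where K: "0 < K" "\<And>z w. norm (product_of_images z w) \<le> norm z * norm w * K"
    using bounded_bilinear.pos_bounded[OF bounded_bilinear_product_of_images] by blast
  show ?thesis
  proof (rule that[of "c / K"])
    show "0 < c / K" using c K by simp
    fix z assume z: "norm z < c / K" "\<kappa> z = 0"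
      "\<And>x y. (mat 1 + z) *v (x \<odot> y) = ((mat 1 + z) *v x) \<odot> ((mat 1 + z) *v y)"
    have "N z = (product_of_images z z, 0)"
      using defect_of_automorphism[OF z(3)] z(2) by (simp add: N_def)
    then have le: "c * norm z \<le> norm z * norm z * K"
      using c(2)[of z] K(2)[of z z] by (simp add: norm_Pair)
    show "z = 0"
    proof (rule ccontr)
      assume "z \<noteq> 0"
      then have "norm z * (norm z * K) < norm z * c"
        using z(1) K(1) by (intro mult_strict_left_mono) (auto simp: pos_less_divide_eq)
      with le show False unfolding mult.assoc mult.commute[of c] by linarith
    qed
  qed
qed

lemma open_strict_polydisc: "open {h::'a::euclidean_space. \<forall>b\<in>Basis. \<bar>h \<bullet> b\<bar> < r}"
proof -
  have "{h::'a. \<forall>b\<in>Basis. \<bar>h \<bullet> b\<bar> < r} = (\<Inter>b\<in>Basis. {h. \<bar>h \<bullet> b\<bar> < r})" by auto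
  also have "open \<dots>"
    by (intro open_INT ballI open_Collect_less continuous_intros) auto
  finally show ?thesis .
qed

text \<open>The assumption \<open>der\<close> is infinitesimal surjectivity: the range of the
  derivative contains every derivation. It replaces any knowledge of the dimension or of charts of
  \<open>G2\<close>.\<close>

theorem analytic_local_diffeo_G2:
  fixes P :: "'a::euclidean_space \<Rightarrow> oct_matrix"
  assumes P: "entire P" and P_G2: "\<And>t. P t \<in> G2" and P0: "P 0 = mat 1"
    and L: "(P has_derivative L) (at 0)" "inj L"
    and der: "\<And>Z. derivation_defect Z = 0 \<Longrightarrow> Z \<in> range L"
  shows "analytic_local_diffeo P 0 G2 (mat 1)"
proof -
  have linL: "linear L" using L(1) by (simp add: has_derivative_def bounded_linear.linear)
  obtain \<kappa> where \<kappa>: "linear \<kappa>" "\<kappa> \<circ> L = id" using linear_injective_left_inverse[OF linL L(2)] by blast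
  have \<kappa>L: "\<kappa> (L t) = t" for t using \<kappa>(2) by (metis comp_apply id_apply)
  obtain \<delta> where \<delta>: "0 < \<delta>" "\<And>z. norm z < \<delta> \<Longrightarrow> \<kappa> z = 0 \<Longrightarrow>
    (\<And>x y. (mat 1 + z) *v (x \<odot> y) = ((mat 1 + z) *v x) \<odot> ((mat 1 + z) *v y)) \<Longrightarrow> z = 0"
    using small_transversal_automorphism[OF \<kappa>(1) \<kappa>L der] by blast
  \<comment> \<open>\<open>\<tau>\<close> is the projection onto the kernel of
    \<open>\<kappa>\<close> along the range of \<open>L\<close>: \<open>Z\<close> splits into the
    tangential part \<open>L (\<kappa> Z)\<close> and the transversal part
    \<open>\<tau> Z\<close>.\<close>
  define \<tau> where "\<tau> Z = Z - L (\<kappa> Z)" for Z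
  have lin\<tau>: "linear \<tau>"
    unfolding \<tau>_def by (intro linear_compose_sub linear_id[unfolded id_def] linear_compose[OF \<kappa>(1) linL, unfolded o_def])
  have \<kappa>\<tau>: "\<kappa> (\<tau> Z) = 0" for Z by (simp add: \<tau>_def linear_diff[OF \<kappa>(1)] \<kappa>L)
  define E where "E Z = P (\<kappa> Z) ** (mat 1 + \<tau> Z)" for Z
  define f where "f Z = E Z - mat 1 - Z" for Z
  have fE: "Z + f Z = E Z - mat 1" for Z by (simp add: f_def)
  have P\<kappa>: "entire (\<lambda>Z. P (\<kappa> Z))"
    unfolding entire_def
  proof (intro ballI allI impI)
    fix b :: oct_matrix and r :: real assume b: "b \<in> Basis" and r: "0 < r"
    have "\<exists>B. \<forall>a\<in>Basis. pser r (B a) (\<lambda>Z. \<kappa> Z \<bullet> a)"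
      using entire_linear[OF \<kappa>(1)] r unfolding entire_def by (intro bchoice) auto
    then obtain B where B: "\<And>a. a \<in> Basis \<Longrightarrow> pser r (B a) (\<lambda>Z. \<kappa> Z \<bullet> a)" by blast
    \<comment> \<open>One radius that dominates the norms of all coordinates of
      \<open>\<kappa>\<close>, as \<open>pser_compose\<close> requires; the summand 1 makes it
      positive.\<close>
    define R where "R = 1 + (\<Sum>a\<in>Basis. B a)"
    have B0: "0 \<le> B a" if "a \<in> Basis" for a using pser_nonneg[OF B[OF that]] r by simp
    have "B a \<le> R" if "a \<in> Basis" for a
      unfolding R_def using member_le_sum[OF that, of B] B0 by fastforce
    then have \<kappa>R: "pser r R (\<lambda>Z. \<kappa> Z \<bullet> a)" if "a \<in> Basis" for a using pser_mono[OF B[OF that]] that by blast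
    have "0 < R" unfolding R_def using sum_nonneg[of Basis B] B0 by (simp add: add_pos_nonneg)
    then obtain C where "pser R C (\<lambda>t. P t \<bullet> b)" using P b unfolding entire_def by blast
    from pser_compose[OF r this \<kappa>R] show "\<exists>B. pser r B (\<lambda>Z. P (\<kappa> Z) \<bullet> b)" by blast
  qed
  have "entire E"
    unfolding E_def by (intro entire_matrix_mult P\<kappa> entire_add entire_const entire_linear lin\<tau>)
  then have "entire (\<lambda>Z. E Z + (- mat 1 + (- 1) *\<^sub>R Z))"
    by (rule entire_add[OF _ entire_add[OF entire_const entire_linear]]) (auto intro: linearI simp: algebra_simps)
  then have ef: "entire f" by (simp add: f_def[abs_def] algebra_simps)
  have "\<exists>B. \<forall>b\<in>Basis. pser 1 (B b) (\<lambda>Z. f Z \<bullet> b)"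
    using ef unfolding entire_def by (intro bchoice) auto
  then obtain B where B: "\<And>b. b \<in> Basis \<Longrightarrow> pser 1 (B b) (\<lambda>Z. f Z \<bullet> b)" by blast
  have B1: "pser 1 (\<Sum>b\<in>Basis. B b) (\<lambda>Z. f Z \<bullet> b)" if b: "b \<in> Basis" for b
    by (rule pser_mono[OF B[OF b]], rule member_le_sum[OF b]) (use pser_nonneg[OF B] in auto)
  have f0: "f 0 = 0" by (simp add: f_def E_def linear_0[OF lin\<tau>] linear_0[OF \<kappa>(1)] P0)
  have d\<kappa>: "(\<kappa> has_derivative \<kappa>) (at 0)" using \<kappa>(1) by (simp add: linear_imp_has_derivative)
  have d\<tau>: "(\<tau> has_derivative \<tau>) (at 0)" using lin\<tau> by (simp add: linear_imp_has_derivative)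
  have dP: "((\<lambda>Z. P (\<kappa> Z)) has_derivative (\<lambda>Z. L (\<kappa> Z))) (at 0)"
    by (rule has_derivative_compose[OF d\<kappa>]) (use L(1) linear_0[OF \<kappa>(1)] in simp)
  have dM: "((\<lambda>Z. mat 1 + \<tau> Z) has_derivative \<tau>) (at 0)"
    using has_derivative_add[OF has_derivative_const d\<tau>] by simp
  have "(E has_derivative (\<lambda>Z. P (\<kappa> 0) ** \<tau> Z + L (\<kappa> Z) ** (mat 1 + \<tau> 0))) (at 0)"
    unfolding E_def by (rule bounded_bilinear.FDERIV[OF bounded_bilinear_matrix_mult dP dM])
  then have "(E has_derivative (\<lambda>Z. Z)) (at 0)"
    by (simp add: linear_0[OF lin\<tau>] linear_0[OF \<kappa>(1)] P0) (simp add: \<tau>_def)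
  then have df: "(f has_derivative (\<lambda>Z. 0)) (at 0)"
    unfolding f_def by (auto intro!: derivative_eq_intros)
  obtain K where K: "0 < K" "\<And>Z. norm (\<tau> Z) \<le> K * norm Z"
    using linear_bounded_pos[OF lin\<tau>] by blast
  \<comment> \<open>On \<open>polydisc \<epsilon>\<close> the norm is at most the dimension times
    \<open>\<epsilon>\<close>, so \<open>\<tau>\<close> is bounded there by
    \<open>\<delta> / 2\<close>.\<close>
  define \<epsilon> where "\<epsilon> = \<delta> / (2 * K * DIM(oct_matrix))"
  have \<epsilon>: "0 < \<epsilon>" using \<delta> K by (simp add: \<epsilon>_def)
  obtain r \<rho> h where h: "0 < r" "r \<le> \<rho>" "\<rho> \<le> \<epsilon>"
    "\<And>b. b \<in> Basis \<Longrightarrow> pser r (2 * \<rho>) (\<lambda>y. h y \<bullet> b)"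
    "\<And>y. y \<in> polydisc r \<Longrightarrow> h y \<in> polydisc \<rho>"
    "\<And>y. y \<in> polydisc r \<Longrightarrow> h y + f (h y) = y"
    "\<And>x y. x \<in> polydisc \<rho> \<Longrightarrow> y \<in> polydisc \<rho> \<Longrightarrow>
       norm (x - y) \<le> 2 * DIM(oct_matrix) * norm ((x + f x) - (y + f y))"
    using analytic_perturbation_of_identity[OF zero_less_one B1 f0 df \<epsilon>] by blast
  have \<tau>_small: "norm (\<tau> Z) < \<delta>" if "Z \<in> polydisc \<rho>" for Z
  proof -
    have "norm Z \<le> (\<Sum>b\<in>Basis. \<bar>Z \<bullet> b\<bar>)" by (rule norm_le_l1)
    also have "\<dots> \<le> real DIM(oct_matrix) * \<epsilon>"
      using that h(3) by (intro sum_bounded_above) (force simp: polydisc_def)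
    finally have "K * norm Z \<le> K * (real DIM(oct_matrix) * \<epsilon>)" using K by simp
    also have "\<dots> = \<delta> / 2" using K by (simp add: \<epsilon>_def)
    also have "\<dots> < \<delta>" using \<delta> by simp
    finally show ?thesis using K(2)[of Z] by linarith
  qed
  define \<Omega> where "\<Omega> s = {h::oct_matrix. \<forall>b\<in>Basis. \<bar>h \<bullet> b\<bar> < s}" for s
  have \<Omega>: "open (\<Omega> s)" "\<Omega> s \<subseteq> polydisc s" "0 < s \<Longrightarrow> 0 \<in> \<Omega> s" for s
    unfolding \<Omega>_def by (rule open_strict_polydisc) (auto simp: polydisc_def)
  \<comment> \<open>The formula makes sense for all matrices near \<open>mat 1\<close> and not only
    on \<open>G2\<close>: it is its own ambient extension in the sense of
    \<open>real_analytic_on\<close>.\<close>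
  define g where "g M = \<kappa> (h (M - mat 1))" for M
  \<comment> \<open>The two conditions in \<open>U\<close> and those in \<open>W\<close> correspond
    under \<open>M = P t\<close> and \<open>h (M - mat 1) = L t\<close>, so that \<open>P\<close>
    and \<open>g\<close> match \<open>U\<close> with \<open>G2 \<inter> W\<close>.\<close>
  define U where "U = {t. L t \<in> \<Omega> \<rho> \<and> P t - mat 1 \<in> \<Omega> r}"
  define W where "W = {M. M - mat 1 \<in> \<Omega> r \<and> h (M - mat 1) \<in> \<Omega> \<rho>}"
  have contP: "continuous_on S P" for S by (rule entire_imp_continuous[OF P])
  have conth: "continuous_on (polydisc r) h"
  proof (rule lipschitz_on_continuous_on[OF lipschitz_onI])
    fix x y :: oct_matrix assume "x \<in> polydisc r" "y \<in> polydisc r"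
    then show "dist (h x) (h y) \<le> 2 * DIM(oct_matrix) * dist x y"
      using h(7)[of "h x" "h y"] h(5,6) by (simp add: dist_norm)
  qed simp
  have cont\<Omega>: "continuous_on {M. M - mat 1 \<in> \<Omega> r} (\<lambda>M. h (M - mat 1))"
    by (rule continuous_on_compose2[OF conth]) (use \<Omega>(2) in \<open>auto intro!: continuous_intros\<close>)
  have openr: "open {M. M - mat 1 \<in> \<Omega> r}"
    using open_vimage[OF \<Omega>(1), of "\<lambda>M. M - mat 1" r] by (simp add: vimage_def continuous_intros)
  have "open U"
  proof -
    have "U = L -` \<Omega> \<rho> \<inter> (\<lambda>t. P t - mat 1) -` \<Omega> r" by (auto simp: U_def)
    moreover have "continuous_on UNIV L" using linL by (simp add: linear_continuous_on linear_conv_bounded_linear)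
    moreover have "continuous_on UNIV (\<lambda>t. P t - mat 1)" by (intro continuous_intros contP)
    ultimately show ?thesis using \<Omega>(1) by (auto intro!: open_Int open_vimage)
  qed
  have "open W"
  proof -
    have "W = {M. M - mat 1 \<in> \<Omega> r} \<inter> (\<lambda>M. h (M - mat 1)) -` \<Omega> \<rho>" by (auto simp: W_def)
    then show ?thesis using continuous_open_preimage[OF cont\<Omega> openr \<Omega>(1)] by simp
  qed
  have EL: "E (L t) = P t" for t
    by (simp add: E_def \<tau>_def \<kappa>L)
  \<comment> \<open>\<open>Z + f Z\<close> takes the value \<open>P t - mat 1\<close> at both
    points, so the expansion estimate identifies them.\<close>
  have hP: "h (P t - mat 1) = L t" if "t \<in> U" for t
  proof -
    have "P t - mat 1 \<in> polydisc r" "L t \<in> polydisc \<rho>" using that \<Omega>(2) by (auto simp: U_def)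
    then have "norm (h (P t - mat 1) - L t) \<le> 0"
      using h(7)[of "h (P t - mat 1)" "L t"] h(5,6) by (simp add: fE[of "L t"] EL)
    then show ?thesis by simp
  qed
  have PU: "P t \<in> G2 \<inter> W" "g (P t) = t" if "t \<in> U" for t
    using P_G2 hP[OF that] that by (auto simp: W_def g_def \<kappa>L U_def)
  have gW: "L (g M) = h (M - mat 1)" "P (g M) = M" "g M \<in> U" if M: "M \<in> G2" "M \<in> W" for M
  proof -
    let ?Z = "h (M - mat 1)"
    have Y: "M - mat 1 \<in> polydisc r" using M \<Omega>(2) by (auto simp: W_def)
    have EM: "E ?Z = M" using h(6)[OF Y] by (simp add: fE)
    \<comment> \<open>Both \<open>M\<close> and its left factor \<open>P (\<kappa> ?Z)\<close> lie
      in \<open>G2\<close>, so the remaining factor \<open>mat 1 + \<tau> ?Z\<close> is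
      multiplicative.\<close>
    have "\<tau> ?Z = 0"
    proof (rule \<delta>(2)[OF \<tau>_small[OF h(5)[OF Y]] \<kappa>\<tau>])
      fix x y
      show "(mat 1 + \<tau> ?Z) *v (x \<odot> y) = ((mat 1 + \<tau> ?Z) *v x) \<odot> ((mat 1 + \<tau> ?Z) *v y)"
        by (rule G2_left_cancel[OF P_G2[of "\<kappa> ?Z"]]) (use EM M in \<open>simp add: E_def\<close>)
    qed
    then show 1: "L (g M) = ?Z" by (simp add: \<tau>_def g_def)
    then show 2: "P (g M) = M" using EM EL[of "g M"] by simp
    show "g M \<in> U" using M 1 2 by (simp add: U_def W_def)
  qed
  have cont_g: "continuous_on (G2 \<inter> W) g"
    unfolding g_def
    by (rule linear_continuous_on_compose[OF continuous_on_subset[OF cont\<Omega>] \<kappa>(1)]) (auto simp: W_def)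
  have ang: "real_analytic_at g M" if "M \<in> W" for M
  proof -
    let ?y = "M - mat 1"
    \<comment> \<open>The least radius of a polydisc around 0 that contains
      \<open>M - mat 1\<close>. The strict inequalities in \<open>\<Omega> r\<close> leave room
      \<open>r - q\<close> for recentring.\<close>
    define q where "q = Max ((\<lambda>b. \<bar>?y \<bullet> b\<bar>) ` Basis)"
    have "q \<in> (\<lambda>b. \<bar>?y \<bullet> b\<bar>) ` Basis" unfolding q_def by (intro Max_in) auto
    then have qr: "q < r" using that by (auto simp: W_def \<Omega>_def)
    have yq: "?y \<in> polydisc q" unfolding polydisc_def q_def by (auto intro!: Max_ge)
    have pos: "0 < r - q" using qr by simp
    show ?thesis
    proof (rule real_analytic_at_pser[OF pos])
      fix a :: 'a assume "a \<in> Basis"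
      have "pser (r - q) (\<Sum>b\<in>Basis. \<bar>\<kappa> b \<bullet> a\<bar> * (2 * \<rho>)) (\<lambda>k. \<Sum>b\<in>Basis. (\<kappa> b \<bullet> a) * (h (?y + k) \<bullet> b))"
        by (intro pser_sum pser_cmult pos pser_recenter h(4) yq qr) auto
      moreover have "g (M + k) \<bullet> a = (\<Sum>b\<in>Basis. (\<kappa> b \<bullet> a) * (h (?y + k) \<bullet> b))" for k
      proof -
        have "\<kappa> (h (?y + k)) = (\<Sum>b\<in>Basis. (h (?y + k) \<bullet> b) *\<^sub>R \<kappa> b)"
          using linear_sum[OF \<kappa>(1), of "\<lambda>b. (h (?y + k) \<bullet> b) *\<^sub>R b" Basis]
          by (simp add: euclidean_representation linear_scale[OF \<kappa>(1)])
        then show ?thesis by (simp add: g_def inner_sum_left mult.commute algebra_simps)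
      qed
      ultimately show "pser (r - q) (\<Sum>b\<in>Basis. \<bar>\<kappa> b \<bullet> a\<bar> * (2 * \<rho>)) (\<lambda>k. g (M + k) \<bullet> a)" by simp
    qed
  qed
  show ?thesis
    unfolding analytic_local_diffeo_def
  proof (intro conjI exI)
    show "P 0 = mat 1" by (rule P0)
    show "open U" by fact
    show "0 \<in> U" using \<Omega>(3) h(1,2) by (simp add: U_def P0 linear_0[OF linL])
    then show "mat 1 \<in> G2 \<inter> W" using PU[of 0] P0 by simp
    show "openin (top_of_set G2) (G2 \<inter> W)" using \<open>open W\<close> by (simp add: openin_open_Int)
    show "homeomorphism U (G2 \<inter> W) P g"
      by (rule homeomorphismI[OF contP cont_g]) (use PU gW in auto)
    show "real_analytic_on P U"
      unfolding real_analytic_on_def using entire_imp_analytic[OF P] by blast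
    show "real_analytic_on g (G2 \<inter> W)"
      unfolding real_analytic_on_def using ang \<open>open W\<close> by blast
  qed
qed

section \<open>Octonion multiplication and matrices indexed by numeral types\<close>

text \<open>Both index types, 8 and 14, have the form \<open>'a bit0\<close>, so a single
  translation between their elements and list positions serves all matrices.\<close>

definition idx :: "'a::finite bit0 \<Rightarrow> nat" where
  "idx i = nat (Rep_bit0 i)"

lemma idx_less: "idx (i::'a::finite bit0) < CARD('a bit0)"
  using Rep_bit0[of i] by (simp add: idx_def nat_less_iff)

lemma of_nat_idx: "of_nat (idx i) = i"
  using Rep_bit0[of i] by (simp add: idx_def bit0.of_nat_eq bit0.Rep_inverse)

lemma idx_of_nat: "k < CARD('a bit0) \<Longrightarrow> idx (of_nat k :: 'a::finite bit0) = k"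
  by (simp add: idx_def bit0.of_nat_eq Abs_bit0_inverse)

lemma bij_betw_of_nat_bit0: "bij_betw (of_nat :: nat \<Rightarrow> 'a::finite bit0) {..<CARD('a bit0)} UNIV"
  by (rule bij_betwI[of _ _ _ idx]) (auto simp: of_nat_idx idx_of_nat idx_less simp del: card_bit0)

lemma sum_of_nat_bit0: "(\<Sum>k<CARD('a bit0). f (of_nat k :: 'a::finite bit0)) = sum f UNIV"
  by (rule sum.reindex_bij_betw[OF bij_betw_of_nat_bit0])

lemma all_bit0_iff: "(\<forall>i::'a::finite bit0. P i) \<longleftrightarrow> (\<forall>k<CARD('a bit0). P (of_nat k))"
  by (metis idx_less of_nat_idx)

lemma forall_8: "(\<forall>i::8. P i) \<longleftrightarrow> P 0 \<and> P 1 \<and> P 2 \<and> P 3 \<and> P 4 \<and> P 5 \<and> P 6 \<and> P 7"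
  by (auto simp: all_bit0_iff eval_nat_numeral All_less_Suc)

lemma sum_8: "sum f (UNIV :: 8 set) = f 0 + f 1 + f 2 + f 3 + f 4 + f 5 + f 6 + f 7"
  by (simp add: sum_of_nat_bit0[symmetric] eval_nat_numeral)

lemma oct_e_nth: "oct_e i $ j = (if j = i then 1 else 0)"
  by (simp add: oct_e_def axis_def)

lemma oct_basis_mult_table:
  "oct_basis_mult 0 j = oct_e j" "oct_basis_mult i 0 = oct_e i"
  "oct_basis_mult 1 1 = - oct_e 0"
  "oct_basis_mult 1 2 = oct_e 3"
  "oct_basis_mult 1 3 = - oct_e 2"
  "oct_basis_mult 1 4 = oct_e 5"
  "oct_basis_mult 1 5 = - oct_e 4"
  "oct_basis_mult 1 6 = - oct_e 7"
  "oct_basis_mult 1 7 = oct_e 6"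
  "oct_basis_mult 2 1 = - oct_e 3"
  "oct_basis_mult 2 2 = - oct_e 0"
  "oct_basis_mult 2 3 = oct_e 1"
  "oct_basis_mult 2 4 = oct_e 6"
  "oct_basis_mult 2 5 = oct_e 7"
  "oct_basis_mult 2 6 = - oct_e 4"
  "oct_basis_mult 2 7 = - oct_e 5"
  "oct_basis_mult 3 1 = oct_e 2"
  "oct_basis_mult 3 2 = - oct_e 1"
  "oct_basis_mult 3 3 = - oct_e 0"
  "oct_basis_mult 3 4 = oct_e 7"
  "oct_basis_mult 3 5 = - oct_e 6"
  "oct_basis_mult 3 6 = oct_e 5"
  "oct_basis_mult 3 7 = - oct_e 4"
  "oct_basis_mult 4 1 = - oct_e 5"
  "oct_basis_mult 4 2 = - oct_e 6"
  "oct_basis_mult 4 3 = - oct_e 7"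
  "oct_basis_mult 4 4 = - oct_e 0"
  "oct_basis_mult 4 5 = oct_e 1"
  "oct_basis_mult 4 6 = oct_e 2"
  "oct_basis_mult 4 7 = oct_e 3"
  "oct_basis_mult 5 1 = oct_e 4"
  "oct_basis_mult 5 2 = - oct_e 7"
  "oct_basis_mult 5 3 = oct_e 6"
  "oct_basis_mult 5 4 = - oct_e 1"
  "oct_basis_mult 5 5 = - oct_e 0"
  "oct_basis_mult 5 6 = - oct_e 3"
  "oct_basis_mult 5 7 = oct_e 2"
  "oct_basis_mult 6 1 = oct_e 7"
  "oct_basis_mult 6 2 = oct_e 4"
  "oct_basis_mult 6 3 = - oct_e 5"
  "oct_basis_mult 6 4 = - oct_e 2"
  "oct_basis_mult 6 5 = oct_e 3"
  "oct_basis_mult 6 6 = - oct_e 0"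
  "oct_basis_mult 6 7 = - oct_e 1"
  "oct_basis_mult 7 1 = - oct_e 6"
  "oct_basis_mult 7 2 = oct_e 5"
  "oct_basis_mult 7 3 = oct_e 4"
  "oct_basis_mult 7 4 = - oct_e 3"
  "oct_basis_mult 7 5 = - oct_e 2"
  "oct_basis_mult 7 6 = oct_e 1"
  "oct_basis_mult 7 7 = - oct_e 0"
  by (simp_all add: oct_basis_mult_def sum_8 oct_oriented_def oct_triples_def)

lemma oct_mult_nth:
  "(x \<odot> y) $ 0 = x$0 * y$0 - x$1 * y$1 - x$2 * y$2 - x$3 * y$3 - x$4 * y$4 - x$5 * y$5 - x$6 * y$6 - x$7 * y$7"
  "(x \<odot> y) $ 1 = x$0 * y$1 + x$1 * y$0 + x$2 * y$3 - x$3 * y$2 + x$4 * y$5 - x$5 * y$4 - x$6 * y$7 + x$7 * y$6"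
  "(x \<odot> y) $ 2 = x$0 * y$2 - x$1 * y$3 + x$2 * y$0 + x$3 * y$1 + x$4 * y$6 + x$5 * y$7 - x$6 * y$4 - x$7 * y$5"
  "(x \<odot> y) $ 3 = x$0 * y$3 + x$1 * y$2 - x$2 * y$1 + x$3 * y$0 + x$4 * y$7 - x$5 * y$6 + x$6 * y$5 - x$7 * y$4"
  "(x \<odot> y) $ 4 = x$0 * y$4 - x$1 * y$5 - x$2 * y$6 - x$3 * y$7 + x$4 * y$0 + x$5 * y$1 + x$6 * y$2 + x$7 * y$3"
  "(x \<odot> y) $ 5 = x$0 * y$5 + x$1 * y$4 - x$2 * y$7 + x$3 * y$6 - x$4 * y$1 + x$5 * y$0 - x$6 * y$3 + x$7 * y$2"
  "(x \<odot> y) $ 6 = x$0 * y$6 + x$1 * y$7 + x$2 * y$4 - x$3 * y$5 - x$4 * y$2 + x$5 * y$3 + x$6 * y$0 - x$7 * y$1"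
  "(x \<odot> y) $ 7 = x$0 * y$7 - x$1 * y$6 + x$2 * y$5 + x$3 * y$4 - x$4 * y$3 - x$5 * y$2 + x$6 * y$1 + x$7 * y$0"
  by (simp_all add: oct_mult_def sum_8 oct_basis_mult_table oct_e_nth)

lemma oct_e_mult_oct_e: "oct_e i \<odot> oct_e j = oct_basis_mult i j"
proof -
  have "(\<Sum>j'\<in>UNIV. (oct_e i $ i' * oct_e j $ j') *\<^sub>R oct_basis_mult i' j') =
      (if i' = i then oct_basis_mult i' j else 0)" for i'
    by (simp add: oct_e_nth if_distrib[of "\<lambda>c. c *\<^sub>R _"] cong: if_cong)
  then show ?thesis by (simp add: oct_mult_def)
qed

section \<open>Matrices over the ring of integers with the square root of 2 adjoined\<close>

type_synonym zr2 = "int \<times> int"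

text \<open>Matrix identities are evaluated on integer pairs, where they are pure computation, and
  carried to the reals by this ring homomorphism.\<close>

definition zr2_val :: "zr2 \<Rightarrow> real" where
  "zr2_val x = of_int (fst x) + of_int (snd x) * sqrt 2"

fun zr2_add :: "zr2 \<Rightarrow> zr2 \<Rightarrow> zr2" where
  "zr2_add (a, b) (c, d) = (a + c, b + d)"

fun zr2_mult :: "zr2 \<Rightarrow> zr2 \<Rightarrow> zr2" where
  "zr2_mult (a, b) (c, d) = (a * c + 2 * (b * d), a * d + b * c)"

lemma zr2_val_add [simp]: "zr2_val (zr2_add x y) = zr2_val x + zr2_val y"
  by (cases x; cases y) (simp add: zr2_val_def algebra_simps)

lemma zr2_val_mult [simp]: "zr2_val (zr2_mult x y) = zr2_val x * zr2_val y"
  by (cases x; cases y) (simp add: zr2_val_def algebra_simps)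

lemma zr2_val_of_int [simp]: "zr2_val (a, 0) = of_int a"
  by (simp add: zr2_val_def)

definition vec_scale :: "zr2 \<Rightarrow> zr2 list \<Rightarrow> zr2 list" where
  "vec_scale c = map (zr2_mult c)"

definition row_mult :: "nat \<Rightarrow> zr2 list \<Rightarrow> zr2 list list \<Rightarrow> zr2 list" where
  "row_mult n r K = foldr (\<lambda>(c, row) acc. map2 zr2_add (vec_scale c row) acc) (zip r K) (replicate n (0, 0))"

definition mat_mult :: "nat \<Rightarrow> zr2 list list \<Rightarrow> zr2 list list \<Rightarrow> zr2 list list" where
  "mat_mult n L K = map (\<lambda>r. row_mult n r K) L"

definition mat_scale :: "zr2 \<Rightarrow> zr2 list list \<Rightarrow> zr2 list list" where
  "mat_scale c = map (vec_scale c)"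

definition mat_add :: "zr2 list list \<Rightarrow> zr2 list list \<Rightarrow> zr2 list list" where
  "mat_add = map2 (map2 zr2_add)"

definition has_dims :: "nat \<Rightarrow> nat \<Rightarrow> zr2 list list \<Rightarrow> bool" where
  "has_dims m n L \<longleftrightarrow> length L = m \<and> list_all (\<lambda>r. length r = n) L"

definition to_mat :: "zr2 list list \<Rightarrow> real ^ 'n::finite bit0 ^ 'm::finite bit0" where
  "to_mat L = (\<chi> i j. zr2_val (L ! idx i ! idx j))"

lemma to_mat_nth: "to_mat L $ i $ j = zr2_val (L ! idx i ! idx j)"
  by (simp add: to_mat_def)

lemma has_dims_nth: "has_dims m n L \<Longrightarrow> i < m \<Longrightarrow> length (L ! i) = n"
  by (auto simp: has_dims_def list_all_length)

text \<open>Length and entries are proved together, since the entries of the componentwise sum are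
  known only once the partial result has the right length.\<close>

lemma row_mult:
  assumes "length r = length K" "list_all (\<lambda>row. length row = n) K"
  shows "length (row_mult n r K) = n \<and>
    (j < n \<longrightarrow> zr2_val (row_mult n r K ! j) = (\<Sum>k<length K. zr2_val (r ! k) * zr2_val (K ! k ! j)))"
  using assms
proof (induction r K rule: list_induct2)
  case Nil
  then show ?case by (simp add: row_mult_def)
next
  case (Cons c r row K)
  have "row_mult n (c # r) (row # K) = map2 zr2_add (vec_scale c row) (row_mult n r K)"
    by (simp add: row_mult_def)
  with Cons show ?case
    by (simp add: vec_scale_def sum.lessThan_Suc_shift del: sum.lessThan_Suc)
qed

lemma length_row_mult: "length r = length K \<Longrightarrow> list_all (\<lambda>row. length row = n) K \<Longrightarrow> length (row_mult n r K) = n"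
  using row_mult by blast

lemma to_mat_mult:
  fixes L K :: "zr2 list list"
  assumes L: "has_dims CARD('m bit0) CARD('k bit0) L" and K: "has_dims CARD('k bit0) CARD('n bit0) K"
  shows "(to_mat L :: real^'k::finite bit0^'m::finite bit0) ** (to_mat K :: real^'n::finite bit0^'k bit0)
    = to_mat (mat_mult CARD('n bit0) L K)"
proof (simp only: vec_eq_iff, intro allI)
  fix i :: "'m bit0" and j :: "'n bit0"
  have len: "length L = CARD('m bit0)" using L by (simp add: has_dims_def)
  have "((to_mat L :: real^'k bit0^'m bit0) ** (to_mat K :: real^'n bit0^'k bit0)) $ i $ j
     = (\<Sum>k\<in>UNIV. zr2_val (L ! idx i ! idx (k::'k bit0)) * zr2_val (K ! idx k ! idx j))"
    by (simp add: matrix_matrix_mult_def to_mat_nth)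
  also have "\<dots> = (\<Sum>k<CARD('k bit0). zr2_val (L ! idx i ! k) * zr2_val (K ! k ! idx j))"
    unfolding sum_of_nat_bit0[symmetric] by (rule sum.cong) (simp_all add: idx_of_nat del: card_bit0)
  also have "\<dots> = zr2_val (row_mult CARD('n bit0) (L ! idx i) K ! idx j)"
    using row_mult[of "L ! idx i" K "CARD('n bit0)" "idx j"] has_dims_nth[OF L idx_less] K idx_less[of j]
    by (simp add: has_dims_def del: card_bit0)
  also have "\<dots> = to_mat (mat_mult CARD('n bit0) L K) $ i $ j"
    using idx_less[of i] by (simp add: to_mat_nth mat_mult_def len del: card_bit0)
  finally show "((to_mat L :: real^'k bit0^'m bit0) ** (to_mat K :: real^'n bit0^'k bit0)) $ i $ j
     = to_mat (mat_mult CARD('n bit0) L K) $ i $ j" .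
qed

lemma to_mat_scale:
  assumes "has_dims CARD('m bit0) CARD('n bit0) L"
  shows "(to_mat (mat_scale c L) :: real^'n::finite bit0^'m::finite bit0) = zr2_val c *\<^sub>R to_mat L"
  using assms has_dims_nth[OF assms idx_less]
  by (simp add: vec_eq_iff to_mat_nth idx_less mat_scale_def vec_scale_def has_dims_def del: card_bit0)

lemma to_mat_add:
  assumes "has_dims CARD('m bit0) CARD('n bit0) L" "has_dims CARD('m bit0) CARD('n bit0) K"
  shows "(to_mat (mat_add L K) :: real^'n::finite bit0^'m::finite bit0) = to_mat L + to_mat K"
  using assms has_dims_nth[OF assms(1) idx_less] has_dims_nth[OF assms(2) idx_less]
  by (simp add: vec_eq_iff to_mat_nth idx_less mat_add_def has_dims_def del: card_bit0)

definition lincomb :: "nat \<Rightarrow> nat \<Rightarrow> zr2 list \<Rightarrow> zr2 list list list \<Rightarrow> zr2 list list" where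
  "lincomb m n v Ms = foldr (\<lambda>(c, M) acc. mat_add (mat_scale c M) acc) (zip v Ms) (replicate m (replicate n (0, 0)))"

lemma has_dims_mat_add: "has_dims m n L \<Longrightarrow> has_dims m n K \<Longrightarrow> has_dims m n (mat_add L K)"
  by (auto simp: has_dims_def mat_add_def list_all_length)

lemma has_dims_mat_scale: "has_dims m n L \<Longrightarrow> has_dims m n (mat_scale c L)"
  by (auto simp: has_dims_def mat_scale_def vec_scale_def list_all_length)

lemma to_mat_lincomb:
  assumes "length v = length Ms" "list_all (has_dims CARD('m bit0) CARD('n bit0)) Ms"
  shows "has_dims CARD('m bit0) CARD('n bit0) (lincomb CARD('m bit0) CARD('n bit0) v Ms) \<and>
    (to_mat (lincomb CARD('m bit0) CARD('n bit0) v Ms) :: real^'n::finite bit0^'m::finite bit0)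
     = (\<Sum>k<length Ms. zr2_val (v ! k) *\<^sub>R to_mat (Ms ! k))"
  using assms
proof (induction v Ms rule: list_induct2)
  case Nil
  have "(to_mat (replicate CARD('m bit0) (replicate CARD('n bit0) (0, 0))) :: real^'n bit0^'m bit0) = 0"
    by (simp add: vec_eq_iff to_mat_nth idx_less del: card_bit0)
  then show ?case by (simp add: lincomb_def has_dims_def list_all_length)
next
  case (Cons c v M Ms)
  have "lincomb CARD('m bit0) CARD('n bit0) (c # v) (M # Ms) =
      mat_add (mat_scale c M) (lincomb CARD('m bit0) CARD('n bit0) v Ms)"
    by (simp add: lincomb_def)
  with Cons show ?case
    by (simp add: to_mat_add to_mat_scale has_dims_mat_add has_dims_mat_scale sum.lessThan_Suc_shift
        del: sum.lessThan_Suc card_bit0)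
qed

definition int_mat :: "int list list \<Rightarrow> zr2 list list" where
  "int_mat = map (map (\<lambda>x. (x, 0)))"

section \<open>Explicit matrices: basis derivations, exponential, adjoint actions and
  certificates\<close>

definition g2_lists :: "zr2 list list list" where
  "g2_lists = map int_mat [
   [[0, 0, 0, 0, 0, 0, 0, 0], [0, 0, -4, 0, 0, 0, 0, 0], [0, 4, 0, 0, 0, 0, 0, 0],
     [0, 0, 0, 0, 0, 0, 0, 0], [0, 0, 0, 0, 0, 0, 0, 2], [0, 0, 0, 0, 0, 0, -2, 0],
     [0, 0, 0, 0, 0, 2, 0, 0], [0, 0, 0, 0, -2, 0, 0, 0]],
   [[0, 0, 0, 0, 0, 0, 0, 0], [0, 0, 0, -4, 0, 0, 0, 0], [0, 0, 0, 0, 0, 0, 0, 0],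
     [0, 4, 0, 0, 0, 0, 0, 0], [0, 0, 0, 0, 0, 0, -2, 0], [0, 0, 0, 0, 0, 0, 0, -2],
     [0, 0, 0, 0, 2, 0, 0, 0], [0, 0, 0, 0, 0, 2, 0, 0]],
   [[0, 0, 0, 0, 0, 0, 0, 0], [0, 0, 0, 0, -4, 0, 0, 0], [0, 0, 0, 0, 0, 0, 0, -2],
     [0, 0, 0, 0, 0, 0, 2, 0], [0, 4, 0, 0, 0, 0, 0, 0], [0, 0, 0, 0, 0, 0, 0, 0],
     [0, 0, 0, -2, 0, 0, 0, 0], [0, 0, 2, 0, 0, 0, 0, 0]],
   [[0, 0, 0, 0, 0, 0, 0, 0], [0, 0, 0, 0, 0, -4, 0, 0], [0, 0, 0, 0, 0, 0, 2, 0],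
     [0, 0, 0, 0, 0, 0, 0, 2], [0, 0, 0, 0, 0, 0, 0, 0], [0, 4, 0, 0, 0, 0, 0, 0],
     [0, 0, -2, 0, 0, 0, 0, 0], [0, 0, 0, -2, 0, 0, 0, 0]],
   [[0, 0, 0, 0, 0, 0, 0, 0], [0, 0, 0, 0, 0, 0, -4, 0], [0, 0, 0, 0, 0, -2, 0, 0],
     [0, 0, 0, 0, -2, 0, 0, 0], [0, 0, 0, 2, 0, 0, 0, 0], [0, 0, 2, 0, 0, 0, 0, 0],
     [0, 4, 0, 0, 0, 0, 0, 0], [0, 0, 0, 0, 0, 0, 0, 0]],
   [[0, 0, 0, 0, 0, 0, 0, 0], [0, 0, 0, 0, 0, 0, 0, -4], [0, 0, 0, 0, 2, 0, 0, 0],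
     [0, 0, 0, 0, 0, -2, 0, 0], [0, 0, -2, 0, 0, 0, 0, 0], [0, 0, 0, 2, 0, 0, 0, 0],
     [0, 0, 0, 0, 0, 0, 0, 0], [0, 4, 0, 0, 0, 0, 0, 0]],
   [[0, 0, 0, 0, 0, 0, 0, 0], [0, 0, 0, 0, 0, 0, 0, 0], [0, 0, 0, -4, 0, 0, 0, 0],
     [0, 0, 4, 0, 0, 0, 0, 0], [0, 0, 0, 0, 0, 2, 0, 0], [0, 0, 0, 0, -2, 0, 0, 0],
     [0, 0, 0, 0, 0, 0, 0, -2], [0, 0, 0, 0, 0, 0, 2, 0]],
   [[0, 0, 0, 0, 0, 0, 0, 0], [0, 0, 0, 0, 0, 0, 0, 2], [0, 0, 0, 0, -4, 0, 0, 0],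
     [0, 0, 0, 0, 0, -2, 0, 0], [0, 0, 4, 0, 0, 0, 0, 0], [0, 0, 0, 2, 0, 0, 0, 0],
     [0, 0, 0, 0, 0, 0, 0, 0], [0, -2, 0, 0, 0, 0, 0, 0]],
   [[0, 0, 0, 0, 0, 0, 0, 0], [0, 0, 0, 0, 0, 0, -2, 0], [0, 0, 0, 0, 0, -4, 0, 0],
     [0, 0, 0, 0, 2, 0, 0, 0], [0, 0, 0, -2, 0, 0, 0, 0], [0, 0, 4, 0, 0, 0, 0, 0],
     [0, 2, 0, 0, 0, 0, 0, 0], [0, 0, 0, 0, 0, 0, 0, 0]],
   [[0, 0, 0, 0, 0, 0, 0, 0], [0, 0, 0, 0, 0, 2, 0, 0], [0, 0, 0, 0, 0, 0, -4, 0],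
     [0, 0, 0, 0, 0, 0, 0, 2], [0, 0, 0, 0, 0, 0, 0, 0], [0, -2, 0, 0, 0, 0, 0, 0],
     [0, 0, 4, 0, 0, 0, 0, 0], [0, 0, 0, -2, 0, 0, 0, 0]],
   [[0, 0, 0, 0, 0, 0, 0, 0], [0, 0, 0, 0, -2, 0, 0, 0], [0, 0, 0, 0, 0, 0, 0, -4],
     [0, 0, 0, 0, 0, 0, -2, 0], [0, 2, 0, 0, 0, 0, 0, 0], [0, 0, 0, 0, 0, 0, 0, 0],
     [0, 0, 0, 2, 0, 0, 0, 0], [0, 0, 4, 0, 0, 0, 0, 0]],
   [[0, 0, 0, 0, 0, 0, 0, 0], [0, 0, 0, 0, 0, 0, 0, 0], [0, 0, 0, 2, 0, 0, 0, 0],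
     [0, 0, -2, 0, 0, 0, 0, 0], [0, 0, 0, 0, 0, -4, 0, 0], [0, 0, 0, 0, 4, 0, 0, 0],
     [0, 0, 0, 0, 0, 0, 0, -2], [0, 0, 0, 0, 0, 0, 2, 0]],
   [[0, 0, 0, 0, 0, 0, 0, 0], [0, 0, 0, -2, 0, 0, 0, 0], [0, 0, 0, 0, 0, 0, 0, 0],
     [0, 2, 0, 0, 0, 0, 0, 0], [0, 0, 0, 0, 0, 0, -4, 0], [0, 0, 0, 0, 0, 0, 0, 2],
     [0, 0, 0, 0, 4, 0, 0, 0], [0, 0, 0, 0, 0, -2, 0, 0]],
   [[0, 0, 0, 0, 0, 0, 0, 0], [0, 0, 2, 0, 0, 0, 0, 0], [0, -2, 0, 0, 0, 0, 0, 0],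
     [0, 0, 0, 0, 0, 0, 0, 0], [0, 0, 0, 0, 0, 0, 0, -4], [0, 0, 0, 0, 0, 0, -2, 0],
     [0, 0, 0, 0, 0, 2, 0, 0], [0, 0, 0, 0, 4, 0, 0, 0]]]"

text \<open>
  Twice the coefficient matrices of 1, cos, sin (frequency 2 sqrt 2) and cos, sin
  (frequency 4 sqrt 2) in the exponential of t X. All matrices below are scaled to have entries
  in the ring: A and its inverse by 4, their adjoint actions by 8, the coordinate matrices by 16.
\<close>

definition P0 :: "zr2 list list" where
  "P0 = [
   [(2, 0), (0, 0), (0, 0), (0, 0), (0, 0), (0, 0), (0, 0), (0, 0)],
   [(0, 0), (0, 0), (0, 0), (0, 0), (0, 0), (0, 0), (0, 0), (0, 0)],
   [(0, 0), (0, 0), (1, 0), (1, 0), (0, 0), (0, 0), (0, 0), (0, 0)],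
   [(0, 0), (0, 0), (1, 0), (1, 0), (0, 0), (0, 0), (0, 0), (0, 0)],
   [(0, 0), (0, 0), (0, 0), (0, 0), (0, 0), (0, 0), (0, 0), (0, 0)],
   [(0, 0), (0, 0), (0, 0), (0, 0), (0, 0), (0, 0), (0, 0), (0, 0)],
   [(0, 0), (0, 0), (0, 0), (0, 0), (0, 0), (0, 0), (0, 0), (0, 0)],
   [(0, 0), (0, 0), (0, 0), (0, 0), (0, 0), (0, 0), (0, 0), (0, 0)]]"

definition P1 :: "zr2 list list" where
  "P1 = [
   [(0, 0), (0, 0), (0, 0), (0, 0), (0, 0), (0, 0), (0, 0), (0, 0)],
   [(0, 0), (2, 0), (0, 0), (0, 0), (0, 0), (0, 0), (0, 0), (0, 0)],
   [(0, 0), (0, 0), (1, 0), (-1, 0), (0, 0), (0, 0), (0, 0), (0, 0)],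
   [(0, 0), (0, 0), (-1, 0), (1, 0), (0, 0), (0, 0), (0, 0), (0, 0)],
   [(0, 0), (0, 0), (0, 0), (0, 0), (0, 0), (0, 0), (0, 0), (0, 0)],
   [(0, 0), (0, 0), (0, 0), (0, 0), (0, 0), (2, 0), (0, 0), (0, 0)],
   [(0, 0), (0, 0), (0, 0), (0, 0), (0, 0), (0, 0), (1, 0), (-1, 0)],
   [(0, 0), (0, 0), (0, 0), (0, 0), (0, 0), (0, 0), (-1, 0), (1, 0)]]"

definition J1 :: "zr2 list list" where
  "J1 = [
   [(0, 0), (0, 0), (0, 0), (0, 0), (0, 0), (0, 0), (0, 0), (0, 0)],
   [(0, 0), (0, 0), (0, 1), (0, -1), (0, 0), (0, 0), (0, 0), (0, 0)],
   [(0, 0), (0, -1), (0, 0), (0, 0), (0, 0), (0, 0), (0, 0), (0, 0)],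
   [(0, 0), (0, 1), (0, 0), (0, 0), (0, 0), (0, 0), (0, 0), (0, 0)],
   [(0, 0), (0, 0), (0, 0), (0, 0), (0, 0), (0, 0), (0, 0), (0, 0)],
   [(0, 0), (0, 0), (0, 0), (0, 0), (0, 0), (0, 0), (0, -1), (0, 1)],
   [(0, 0), (0, 0), (0, 0), (0, 0), (0, 0), (0, 1), (0, 0), (0, 0)],
   [(0, 0), (0, 0), (0, 0), (0, 0), (0, 0), (0, -1), (0, 0), (0, 0)]]"

definition P2 :: "zr2 list list" where
  "P2 = [
   [(0, 0), (0, 0), (0, 0), (0, 0), (0, 0), (0, 0), (0, 0), (0, 0)],
   [(0, 0), (0, 0), (0, 0), (0, 0), (0, 0), (0, 0), (0, 0), (0, 0)],
   [(0, 0), (0, 0), (0, 0), (0, 0), (0, 0), (0, 0), (0, 0), (0, 0)],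
   [(0, 0), (0, 0), (0, 0), (0, 0), (0, 0), (0, 0), (0, 0), (0, 0)],
   [(0, 0), (0, 0), (0, 0), (0, 0), (2, 0), (0, 0), (0, 0), (0, 0)],
   [(0, 0), (0, 0), (0, 0), (0, 0), (0, 0), (0, 0), (0, 0), (0, 0)],
   [(0, 0), (0, 0), (0, 0), (0, 0), (0, 0), (0, 0), (1, 0), (1, 0)],
   [(0, 0), (0, 0), (0, 0), (0, 0), (0, 0), (0, 0), (1, 0), (1, 0)]]"

definition J2 :: "zr2 list list" where
  "J2 = [
   [(0, 0), (0, 0), (0, 0), (0, 0), (0, 0), (0, 0), (0, 0), (0, 0)],
   [(0, 0), (0, 0), (0, 0), (0, 0), (0, 0), (0, 0), (0, 0), (0, 0)],
   [(0, 0), (0, 0), (0, 0), (0, 0), (0, 0), (0, 0), (0, 0), (0, 0)],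
   [(0, 0), (0, 0), (0, 0), (0, 0), (0, 0), (0, 0), (0, 0), (0, 0)],
   [(0, 0), (0, 0), (0, 0), (0, 0), (0, 0), (0, 0), (0, -1), (0, -1)],
   [(0, 0), (0, 0), (0, 0), (0, 0), (0, 0), (0, 0), (0, 0), (0, 0)],
   [(0, 0), (0, 0), (0, 0), (0, 0), (0, 1), (0, 0), (0, 0), (0, 0)],
   [(0, 0), (0, 0), (0, 0), (0, 0), (0, 1), (0, 0), (0, 0), (0, 0)]]"

definition X_list :: "zr2 list list" where
  "X_list = int_mat [[0, 0, 0, 0, 0, 0, 0, 0], [0, 0, 2, -2, 0, 0, 0, 0], [0, -2, 0, 0, 0, 0, 0, 0],
     [0, 2, 0, 0, 0, 0, 0, 0], [0, 0, 0, 0, 0, 0, -4, -4], [0, 0, 0, 0, 0, 0, -2, 2],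
     [0, 0, 0, 0, 4, 2, 0, 0], [0, 0, 0, 0, 4, -2, 0, 0]]"

definition S_list :: "zr2 list list" where
  "S_list = int_mat [[1, 0, 0, 0, 0, 0, 0, 0], [0, 1, 0, 0, 0, 0, 0, 0], [0, 0, 0, 0, 1, 0, 0, 0],
     [0, 0, 0, 0, 0, 1, 0, 0], [0, 0, 1, 0, 0, 0, 0, 0], [0, 0, 0, 1, 0, 0, 0, 0],
     [0, 0, 0, 0, 0, 0, -1, 0], [0, 0, 0, 0, 0, 0, 0, -1]]"

definition A_list :: "zr2 list list" where
  "A_list = [
   [(4, 0), (0, 0), (0, 0), (0, 0), (0, 0), (0, 0), (0, 0), (0, 0)],
   [(0, 0), (0, 2), (2, 0), (-2, 0), (0, 0), (0, 0), (0, 0), (0, 0)],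
   [(0, 0), (-2, 0), (2, 1), (2, -1), (0, 0), (0, 0), (0, 0), (0, 0)],
   [(0, 0), (2, 0), (2, -1), (2, 1), (0, 0), (0, 0), (0, 0), (0, 0)],
   [(0, 0), (0, 0), (0, 0), (0, 0), (0, 0), (0, 0), (0, -2), (0, -2)],
   [(0, 0), (0, 0), (0, 0), (0, 0), (0, 0), (0, 2), (-2, 0), (2, 0)],
   [(0, 0), (0, 0), (0, 0), (0, 0), (0, 2), (2, 0), (0, 1), (0, -1)],
   [(0, 0), (0, 0), (0, 0), (0, 0), (0, 2), (-2, 0), (0, -1), (0, 1)]]"

definition a_list :: "zr2 list list" where
  "a_list = [
   [(4, 0), (0, 0), (0, 0), (0, 0), (0, 0), (0, 0), (0, 0), (0, 0)],
   [(0, 0), (0, 2), (-2, 0), (2, 0), (0, 0), (0, 0), (0, 0), (0, 0)],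
   [(0, 0), (2, 0), (2, 1), (2, -1), (0, 0), (0, 0), (0, 0), (0, 0)],
   [(0, 0), (-2, 0), (2, -1), (2, 1), (0, 0), (0, 0), (0, 0), (0, 0)],
   [(0, 0), (0, 0), (0, 0), (0, 0), (0, 0), (0, 0), (0, 2), (0, 2)],
   [(0, 0), (0, 0), (0, 0), (0, 0), (0, 0), (0, 2), (2, 0), (-2, 0)],
   [(0, 0), (0, 0), (0, 0), (0, 0), (0, -2), (-2, 0), (0, 1), (0, -1)],
   [(0, 0), (0, 0), (0, 0), (0, 0), (0, -2), (2, 0), (0, -1), (0, 1)]]"

text \<open>Row k holds 8 times the coordinates of the conjugate of the k-th basis derivation.\<close>

definition Ad_A :: "zr2 list list" where
  "Ad_A = [
   [(4, 2), (-4, 2), (0, 0), (0, 0), (0, 0), (0, 0), (-4, 0), (0, 0), (0, 0), (0, 0), (0, 0), (0, 0), (0, 0), (0, 0)],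
   [(-4, 2), (4, 2), (0, 0), (0, 0), (0, 0), (0, 0), (-4, 0), (0, 0), (0, 0), (0, 0), (0, 0), (0, 0), (0, 0), (0, 0)],
   [(0, 0), (0, 0), (0, -2), (0, -2), (4, 0), (4, 0), (0, 0), (0, 0), (0, 0), (0, -4), (0, 0), (0, 0), (0, 0), (0, 0)],
   [(0, 0), (0, 0), (-2, 0), (6, 0), (0, 2), (0, 0), (0, 0), (0, 2), (0, -2), (0, 0), (4, 0), (0, 0), (0, 0), (0, 0)],
   [(0, 0), (0, 0), (-4, -1), (0, -1), (2, -2), (-4, 0), (0, 0), (-2, 2), (2, 2), (0, 0), (0, 2), (0, 0), (0, 0), (0, 0)],
   [(0, 0), (0, 0), (-4, 1), (0, 1), (-2, -2), (4, 0), (0, 0), (2, 2), (-2, 2), (0, 0), (0, -2), (0, 0), (0, 0), (0, 0)],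
   [(4, 0), (4, 0), (0, 0), (0, 0), (0, 0), (0, 0), (0, 4), (0, 0), (0, 0), (0, 0), (0, 0), (0, 0), (0, 0), (0, 0)],
   [(0, 0), (0, 0), (2, -2), (2, -2), (0, 2), (0, 2), (0, 0), (0, 0), (0, 0), (4, 0), (0, 4), (0, 0), (0, 0), (0, 0)],
   [(0, 0), (0, 0), (-2, 1), (2, 1), (2, 0), (-4, 2), (0, 0), (-2, 2), (2, 2), (4, 0), (0, -2), (0, 0), (0, 0), (0, 0)],
   [(0, 0), (0, 0), (1, -3), (-3, 1), (2, -1), (-2, 0), (0, 0), (-4, -1), (-4, 1), (0, 2), (-2, 0), (0, 0), (0, 0), (0, 0)],
   [(0, 0), (0, 0), (-1, -1), (3, -1), (2, -3), (2, 0), (0, 0), (0, -3), (0, 3), (0, -2), (2, 0), (0, 0), (0, 0), (0, 0)],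
   [(-4, 0), (-4, 0), (0, 0), (0, 0), (0, 0), (0, 0), (0, -4), (0, 0), (0, 0), (0, 0), (0, 0), (0, -4), (4, 0), (-4, 0)],
   [(0, 2), (0, 2), (0, 0), (0, 0), (0, 0), (0, 0), (-4, 0), (0, 0), (0, 0), (0, 0), (0, 0), (-4, 0), (4, -2), (4, 2)],
   [(0, -2), (0, -2), (0, 0), (0, 0), (0, 0), (0, 0), (4, 0), (0, 0), (0, 0), (0, 0), (0, 0), (4, 0), (4, 2), (4, -2)]]"

definition Ad_a :: "zr2 list list" where
  "Ad_a = [
   [(4, 2), (-4, 2), (0, 0), (0, 0), (0, 0), (0, 0), (4, 0), (0, 0), (0, 0), (0, 0), (0, 0), (0, 0), (0, 0), (0, 0)],
   [(-4, 2), (4, 2), (0, 0), (0, 0), (0, 0), (0, 0), (4, 0), (0, 0), (0, 0), (0, 0), (0, 0), (0, 0), (0, 0), (0, 0)],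
   [(0, 0), (0, 0), (0, -2), (0, -2), (-4, 0), (-4, 0), (0, 0), (0, 0), (0, 0), (0, -4), (0, 0), (0, 0), (0, 0), (0, 0)],
   [(0, 0), (0, 0), (-2, 0), (6, 0), (0, -2), (0, 0), (0, 0), (0, -2), (0, 2), (0, 0), (4, 0), (0, 0), (0, 0), (0, 0)],
   [(0, 0), (0, 0), (4, 1), (0, 1), (2, -2), (-4, 0), (0, 0), (-2, 2), (2, 2), (0, 0), (0, -2), (0, 0), (0, 0), (0, 0)],
   [(0, 0), (0, 0), (4, -1), (0, -1), (-2, -2), (4, 0), (0, 0), (2, 2), (-2, 2), (0, 0), (0, 2), (0, 0), (0, 0), (0, 0)],
   [(-4, 0), (-4, 0), (0, 0), (0, 0), (0, 0), (0, 0), (0, 4), (0, 0), (0, 0), (0, 0), (0, 0), (0, 0), (0, 0), (0, 0)],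
   [(0, 0), (0, 0), (-2, 2), (-2, 2), (0, 2), (0, 2), (0, 0), (0, 0), (0, 0), (-4, 0), (0, -4), (0, 0), (0, 0), (0, 0)],
   [(0, 0), (0, 0), (2, -1), (-2, -1), (2, 0), (-4, 2), (0, 0), (-2, 2), (2, 2), (-4, 0), (0, 2), (0, 0), (0, 0), (0, 0)],
   [(0, 0), (0, 0), (1, -3), (-3, 1), (-2, 1), (2, 0), (0, 0), (4, 1), (4, -1), (0, 2), (-2, 0), (0, 0), (0, 0), (0, 0)],
   [(0, 0), (0, 0), (-1, -1), (3, -1), (-2, 3), (-2, 0), (0, 0), (0, 3), (0, -3), (0, -2), (2, 0), (0, 0), (0, 0), (0, 0)],
   [(4, 0), (4, 0), (0, 0), (0, 0), (0, 0), (0, 0), (0, -4), (0, 0), (0, 0), (0, 0), (0, 0), (0, -4), (-4, 0), (4, 0)],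
   [(0, 2), (0, 2), (0, 0), (0, 0), (0, 0), (0, 0), (4, 0), (0, 0), (0, 0), (0, 0), (0, 0), (4, 0), (4, -2), (4, 2)],
   [(0, -2), (0, -2), (0, 0), (0, 0), (0, 0), (0, 0), (-4, 0), (0, 0), (0, 0), (0, 0), (0, 0), (-4, 0), (4, 2), (4, -2)]]"

definition Ad_S :: "zr2 list list" where
  "Ad_S = [
   [(0, 0), (0, 0), (8, 0), (0, 0), (0, 0), (0, 0), (0, 0), (0, 0), (0, 0), (0, 0), (0, 0), (0, 0), (0, 0), (0, 0)],
   [(0, 0), (0, 0), (0, 0), (8, 0), (0, 0), (0, 0), (0, 0), (0, 0), (0, 0), (0, 0), (0, 0), (0, 0), (0, 0), (0, 0)],
   [(8, 0), (0, 0), (0, 0), (0, 0), (0, 0), (0, 0), (0, 0), (0, 0), (0, 0), (0, 0), (0, 0), (0, 0), (0, 0), (0, 0)],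
   [(0, 0), (8, 0), (0, 0), (0, 0), (0, 0), (0, 0), (0, 0), (0, 0), (0, 0), (0, 0), (0, 0), (0, 0), (0, 0), (0, 0)],
   [(0, 0), (0, 0), (0, 0), (0, 0), (-8, 0), (0, 0), (0, 0), (0, 0), (0, 0), (0, 0), (0, 0), (0, 0), (0, 0), (0, 0)],
   [(0, 0), (0, 0), (0, 0), (0, 0), (0, 0), (-8, 0), (0, 0), (0, 0), (0, 0), (0, 0), (0, 0), (0, 0), (0, 0), (0, 0)],
   [(0, 0), (0, 0), (0, 0), (0, 0), (0, 0), (0, 0), (0, 0), (0, 0), (0, 0), (0, 0), (0, 0), (8, 0), (0, 0), (0, 0)],
   [(0, 0), (0, 0), (0, 0), (0, 0), (0, 0), (0, 0), (0, 0), (-8, 0), (0, 0), (0, 0), (0, 0), (0, 0), (0, 0), (0, 0)],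
   [(0, 0), (0, 0), (0, 0), (0, 0), (-8, 0), (0, 0), (0, 0), (0, 0), (8, 0), (0, 0), (0, 0), (0, 0), (0, 0), (0, 0)],
   [(0, 0), (0, 0), (0, 0), (0, 0), (0, 0), (0, 0), (0, 0), (0, 0), (0, 0), (0, 0), (0, 0), (0, 0), (-8, 0), (0, 0)],
   [(0, 0), (0, 0), (0, 0), (0, 0), (0, 0), (0, 0), (0, 0), (0, 0), (0, 0), (0, 0), (0, 0), (0, 0), (0, 0), (-8, 0)],
   [(0, 0), (0, 0), (0, 0), (0, 0), (0, 0), (0, 0), (8, 0), (0, 0), (0, 0), (0, 0), (0, 0), (0, 0), (0, 0), (0, 0)],
   [(0, 0), (0, 0), (0, 0), (0, 0), (0, 0), (0, 0), (0, 0), (0, 0), (0, 0), (-8, 0), (0, 0), (0, 0), (0, 0), (0, 0)],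
   [(0, 0), (0, 0), (0, 0), (0, 0), (0, 0), (0, 0), (0, 0), (0, 0), (0, 0), (0, 0), (-8, 0), (0, 0), (0, 0), (0, 0)]]"

text \<open>
  Row j of \<open>cols\<close> is 16 times the j-th column of the coordinate matrix. The other three matrices
  certify the determinant of \<open>T = cols\<close>: Q is upper unitriangular, U upper and L lower triangular,
  and Q T U = L. The factor Q makes all leading principal minors nonzero.
\<close>

definition cols_lean :: "zr2 list list" where
  "cols_lean = [
   [(0, 0), (0, 0), (0, 0), (0, 0), (0, 0), (0, 0), (0, 0), (0, 0), (0, 0), (0, 0), (0, 0), (0, 0), (16, 0), (16, 0)],
   [(0, 0), (0, 0), (0, 0), (0, 0), (0, 0), (0, 0), (0, 0), (0, 0), (0, 0), (-16, 0), (-16, 0), (0, 0), (0, 0), (0, 0)],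
   [(0, 0), (0, 0), (0, 8), (0, 0), (-8, 8), (0, 0), (0, 0), (8, 8), (8, -8), (0, 0), (0, 0), (0, 0), (0, 0), (0, 0)],
   [(0, 0), (0, 0), (0, 8), (0, 0), (8, -8), (0, 0), (0, 0), (-8, -8), (-8, 8), (0, 0), (0, 0), (0, 0), (0, 0), (0, 0)],
   [(0, 0), (0, 0), (-8, 0), (-8, 0), (0, 8), (0, 8), (0, 0), (0, 0), (0, 0), (0, 0), (16, 0), (0, 0), (0, 0), (0, 0)],
   [(0, 0), (0, 0), (-8, 0), (-8, 0), (0, -8), (0, -8), (0, 0), (0, 0), (0, 0), (0, 0), (16, 0), (0, 0), (0, 0), (0, 0)],
   [(0, 8), (0, 0), (0, 0), (0, 0), (0, 0), (0, 0), (0, 0), (-8, -8), (8, -8), (0, 0), (0, 0), (0, 0), (0, 0), (0, 0)],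
   [(0, 8), (0, 0), (0, 0), (0, 0), (0, 0), (0, 0), (0, 0), (8, 8), (-8, 8), (0, 0), (0, 0), (0, 0), (0, 0), (0, 0)],
   [(0, 0), (0, 0), (0, -8), (0, 0), (-8, -8), (0, 0), (0, 0), (8, -8), (8, 8), (0, 0), (0, 0), (0, 0), (0, 0), (0, 0)],
   [(4, 4), (4, -4), (-2, 3), (2, -1), (-2, -4), (-12, 4), (0, -4), (-6, 4), (-2, 0), (0, -8), (-4, -6), (0, 0), (0, 0), (0, 0)],
   [(4, 4), (4, -4), (2, -3), (-2, 1), (-2, -4), (-12, 4), (0, 4), (-6, 4), (-2, 0), (0, 8), (4, 6), (0, 0), (0, 0), (0, 0)],
   [(-8, 0), (-8, 0), (0, 0), (0, 0), (0, -8), (0, -8), (0, 0), (0, 0), (0, 0), (0, 0), (0, 0), (0, 0), (0, 0), (-16, 0)],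
   [(0, 0), (0, 0), (0, 8), (0, 0), (8, 0), (0, 0), (0, 0), (-8, 0), (-8, 0), (0, 0), (0, 0), (-8, 0), (-8, -4), (-8, 4)],
   [(-2, 3), (2, -1), (4, 4), (4, -4), (4, 4), (12, -4), (0, 0), (6, -4), (-2, 0), (0, 0), (0, 0), (0, -4), (0, 8), (4, 6)]]"

definition Q_lean :: "zr2 list list" where
  "Q_lean = int_mat [[1, 0, 0, 0, 0, 0, 1, 0, 0, 0, 0, 0, 0, 0], [0, 1, 0, 0, 0, 0, 0, 0, 0, 1, 0, 0, 0, 0], [0, 0, 1, 0, 0, 0, 0, 0, 0, 0, 0, 0, 0, 0],
     [0, 0, 0, 1, 1, 0, 0, 0, 0, 0, 0, 0, 0, 0], [0, 0, 0, 0, 1, 0, 0, 0, 0, 0, 0, 0, 0, 0], [0, 0, 0, 0, 0, 1, 0, 0, 0, 0, 0, 0, 0, 0],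
     [0, 0, 0, 0, 0, 0, 1, 0, 0, 0, 1, 0, 0, 0], [0, 0, 0, 0, 0, 0, 0, 1, 0, 0, 0, 0, 0, 0], [0, 0, 0, 0, 0, 0, 0, 0, 1, 0, 0, 0, 0, 0],
     [0, 0, 0, 0, 0, 0, 0, 0, 0, 1, 0, 0, 0, 0], [0, 0, 0, 0, 0, 0, 0, 0, 0, 0, 1, 0, 0, 1], [0, 0, 0, 0, 0, 0, 0, 0, 0, 0, 0, 1, 1, 0],
     [0, 0, 0, 0, 0, 0, 0, 0, 0, 0, 0, 0, 1, 0], [0, 0, 0, 0, 0, 0, 0, 0, 0, 0, 0, 0, 0, 1]]"

definition U_lean :: "zr2 list list" where
  "U_lean = [
   [(1, 0), (0, 0), (0, 0), (0, 0), (0, 0), (0, 0), (0, 0), (2, 1), (0, 0), (0, 0), (0, 0), (0, 0), (0, -2), (-4, 2)],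
   [(0, 0), (1, 0), (4, 1), (0, 1), (-8, -1), (-1, -4), (-2, -1), (16, 9), (-7, 3), (-2, -2), (0, 0), (0, 0), (-24, -22), (-20, -2)],
   [(0, 0), (0, 0), (4, 0), (0, 0), (-2, 1), (0, 0), (0, 0), (0, 0), (0, 0), (0, 0), (0, 0), (0, 0), (0, 0), (0, 0)],
   [(0, 0), (0, 0), (0, 0), (4, 0), (6, -3), (0, 2), (0, 0), (0, 0), (0, 0), (0, 0), (2, 0), (-4, -2), (-62, -44), (-2, -12)],
   [(0, 0), (0, 0), (0, 0), (0, 0), (2, 0), (0, 0), (0, 0), (-6, -4), (2, 0), (0, 0), (0, 0), (0, 0), (4, 4), (4, 0)],
   [(0, 0), (0, 0), (0, 0), (0, 0), (0, 0), (2, 0), (0, 0), (6, 4), (-2, 0), (0, 0), (0, 0), (0, 0), (-4, -4), (-4, 0)],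
   [(0, 0), (0, 0), (0, 0), (0, 0), (0, 0), (0, 0), (1, 0), (0, 0), (0, 0), (-2, -1), (0, 0), (0, 0), (0, 4), (8, -4)],
   [(0, 0), (0, 0), (0, 0), (0, 0), (0, 0), (0, 0), (0, 0), (2, 0), (-3, 2), (0, 0), (0, 0), (0, 0), (0, 0), (0, 0)],
   [(0, 0), (0, 0), (0, 0), (0, 0), (0, 0), (0, 0), (0, 0), (0, 0), (1, 0), (0, 0), (0, 0), (0, 0), (4, 4), (4, 0)],
   [(0, 0), (0, 0), (0, 0), (0, 0), (0, 0), (0, 0), (0, 0), (0, 0), (0, 0), (1, 0), (-1, 0), (2, 1), (31, 22), (1, 6)],
   [(0, 0), (0, 0), (0, 0), (0, 0), (0, 0), (0, 0), (0, 0), (0, 0), (0, 0), (0, 0), (1, 0), (-2, -1), (-31, -22), (-1, -6)],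
   [(0, 0), (0, 0), (0, 0), (0, 0), (0, 0), (0, 0), (0, 0), (0, 0), (0, 0), (0, 0), (0, 0), (2, 0), (20, 22), (0, 10)],
   [(0, 0), (0, 0), (0, 0), (0, 0), (0, 0), (0, 0), (0, 0), (0, 0), (0, 0), (0, 0), (0, 0), (0, 0), (4, 0), (-16, 4)],
   [(0, 0), (0, 0), (0, 0), (0, 0), (0, 0), (0, 0), (0, 0), (0, 0), (0, 0), (0, 0), (0, 0), (0, 0), (0, 0), (12, 0)]]"

definition L_lean :: "zr2 list list" where
  "L_lean = [
   [(0, 8), (0, 0), (0, 0), (0, 0), (0, 0), (0, 0), (0, 0), (0, 0), (0, 0), (0, 0), (0, 0), (0, 0), (0, 0), (0, 0)],
   [(4, 4), (4, -4), (0, 0), (0, 0), (0, 0), (0, 0), (0, 0), (0, 0), (0, 0), (0, 0), (0, 0), (0, 0), (0, 0), (0, 0)],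
   [(0, 0), (0, 0), (0, 32), (0, 0), (0, 0), (0, 0), (0, 0), (0, 0), (0, 0), (0, 0), (0, 0), (0, 0), (0, 0), (0, 0)],
   [(0, 0), (0, 0), (-32, 32), (-32, 0), (0, 0), (0, 0), (0, 0), (0, 0), (0, 0), (0, 0), (0, 0), (0, 0), (0, 0), (0, 0)],
   [(0, 0), (0, 0), (-32, 0), (-32, 0), (-32, 32), (0, 0), (0, 0), (0, 0), (0, 0), (0, 0), (0, 0), (0, 0), (0, 0), (0, 0)],
   [(0, 0), (0, 0), (-32, 0), (-32, 0), (-32, 0), (0, -32), (0, 0), (0, 0), (0, 0), (0, 0), (0, 0), (0, 0), (0, 0), (0, 0)],
   [(4, 12), (4, -4), (16, -24), (-16, 8), (-56, 40), (8, -8), (0, 8), (0, 0), (0, 0), (0, 0), (0, 0), (0, 0), (0, 0), (0, 0)],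
   [(0, 8), (0, 0), (0, 0), (0, 0), (0, 0), (0, 0), (0, 0), (32, 32), (0, 0), (0, 0), (0, 0), (0, 0), (0, 0), (0, 0)],
   [(0, 0), (0, 0), (0, -32), (0, 0), (-32, 0), (0, 0), (0, 0), (128, 64), (-64, 32), (0, 0), (0, 0), (0, 0), (0, 0), (0, 0)],
   [(4, 4), (4, -4), (0, 0), (0, 0), (0, 0), (0, 0), (0, 0), (0, 0), (0, 0), (16, 0), (0, 0), (0, 0), (0, 0), (0, 0)],
   [(2, 7), (6, -5), (38, -10), (-2, -6), (-14, 14), (22, -15), (-2, 8), (12, -18), (-72, 53), (0, -2), (8, -8), (0, 0), (0, 0), (0, 0)],
   [(-8, 0), (-8, 0), (-32, 24), (0, -8), (96, -24), (8, 16), (16, 8), (-208, -112), (88, -40), (16, 16), (0, 0), (-16, 0), (0, 0), (0, 0)],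
   [(0, 0), (0, 0), (0, 32), (0, 0), (32, -16), (0, 0), (0, 0), (-64, -32), (32, -16), (0, 0), (0, 0), (-16, 0), (-192, -192), (0, 0)],
   [(-2, 3), (2, -1), (22, 14), (14, -14), (42, -26), (14, -7), (-2, 0), (12, -18), (-72, 53), (0, -2), (8, -8), (0, 0), (-64, 0), (64, -64)]]"

definition cols_bal :: "zr2 list list" where
  "cols_bal = [
   [(0, 0), (0, 0), (0, 0), (0, 0), (0, 0), (0, 0), (0, 0), (0, 0), (0, 0), (0, 0), (0, 0), (0, 0), (16, 0), (16, 0)],
   [(0, 0), (0, 0), (-8, 0), (-8, 0), (0, 8), (0, 8), (0, 0), (0, 0), (0, 0), (0, 0), (16, 0), (0, 0), (0, 0), (0, 0)],
   [(0, 0), (0, 0), (-8, 0), (-8, 0), (0, -8), (0, -8), (0, 0), (0, 0), (0, 0), (0, 0), (16, 0), (0, 0), (0, 0), (0, 0)],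
   [(0, 4), (0, -4), (12, 2), (-4, 2), (8, 0), (-4, 4), (-8, 0), (4, 4), (-4, -4), (-8, 4), (0, 0), (0, 0), (0, 0), (0, 0)],
   [(0, 4), (0, -4), (-12, -2), (4, -2), (-8, 0), (4, -4), (-8, 0), (-4, -4), (4, 4), (8, -4), (0, 0), (0, 0), (0, 0), (0, 0)],
   [(0, 4), (0, -4), (-12, -2), (4, -2), (8, 0), (-4, 4), (8, 0), (4, 4), (-4, -4), (8, -4), (0, 0), (0, 0), (0, 0), (0, 0)],
   [(0, 4), (0, -4), (12, 2), (-4, 2), (-8, 0), (4, -4), (8, 0), (-4, -4), (4, 4), (-8, 4), (0, 0), (0, 0), (0, 0), (0, 0)],
   [(-4, -4), (-4, 4), (-6, 3), (-2, 7), (6, 0), (4, -4), (0, 4), (2, 0), (6, 4), (0, 8), (4, -6), (0, 0), (0, 0), (0, 0)],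
   [(-4, -4), (-4, 4), (6, -3), (2, -7), (6, 0), (4, -4), (0, -4), (2, 0), (6, 4), (0, -8), (-4, 6), (0, 0), (0, 0), (0, 0)],
   [(16, 0), (16, 0), (0, 0), (0, 0), (0, 0), (0, 0), (0, 0), (0, 0), (0, 0), (0, 0), (0, 0), (0, 0), (-16, 0), (16, 0)],
   [(12, 2), (-4, 2), (0, 4), (0, -4), (-4, 4), (4, -4), (0, 0), (-4, -4), (-4, -4), (0, 0), (0, 0), (-8, 0), (8, -4), (0, 0)],
   [(-12, -2), (4, -2), (0, 4), (0, -4), (4, -4), (-4, 4), (0, 0), (4, 4), (4, 4), (0, 0), (0, 0), (-8, 0), (-8, 4), (0, 0)],
   [(-12, -2), (4, -2), (0, 4), (0, -4), (-4, 4), (4, -4), (0, 0), (-4, -4), (-4, -4), (0, 0), (0, 0), (8, 0), (-8, 4), (0, 0)],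
   [(12, 2), (-4, 2), (0, 4), (0, -4), (4, -4), (-4, 4), (0, 0), (4, 4), (4, 4), (0, 0), (0, 0), (8, 0), (8, -4), (0, 0)]]"

definition Q_bal :: "zr2 list list" where
  "Q_bal = int_mat [[1, 0, 0, 1, 0, 0, 0, 0, 0, 0, 0, 0, 0, 0], [0, 1, 0, 0, 0, 0, 0, 1, 0, 0, 0, 0, 0, 0], [0, 0, 1, 0, 0, 0, 0, 0, 0, 0, 0, 0, 0, 0],
     [0, 0, 0, 1, 1, 0, 0, 0, 0, 0, 0, 0, 0, 0], [0, 0, 0, 0, 1, 1, 0, 0, 0, 0, 0, 0, 0, 0], [0, 0, 0, 0, 0, 1, 0, 1, 0, 0, 0, 0, 0, 0],
     [0, 0, 0, 0, 0, 0, 1, 0, 0, 0, 0, 0, 0, 0], [0, 0, 0, 0, 0, 0, 0, 1, 0, 1, 0, 0, 0, 0], [0, 0, 0, 0, 0, 0, 0, 0, 1, 0, 1, 0, 0, 0],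
     [0, 0, 0, 0, 0, 0, 0, 0, 0, 1, 1, 0, 0, 0], [0, 0, 0, 0, 0, 0, 0, 0, 0, 0, 1, 1, 0, 0], [0, 0, 0, 0, 0, 0, 0, 0, 0, 0, 0, 1, 1, 0],
     [0, 0, 0, 0, 0, 0, 0, 0, 0, 0, 0, 0, 1, 0], [0, 0, 0, 0, 0, 0, 0, 0, 0, 0, 0, 0, 0, 1]]"

definition U_bal :: "zr2 list list" where
  "U_bal = [
   [(1, 0), (1, 0), (-4, -1), (-3, 3), (-5, 20), (-61, 53), (-49, 7), (-7, -7), (0, 0), (0, 0), (0, 0), (0, 0), (0, -217), (-31, 0)],
   [(0, 0), (1, 0), (0, 11), (-3, -1), (-5, 20), (-61, 53), (-49, -21), (-7, -7), (0, 0), (0, 0), (0, 0), (0, 0), (0, 217), (-31, 0)],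
   [(0, 0), (0, 0), (8, 0), (-2, 0), (-2, -2), (10, -8), (14, 0), (0, 0), (0, 0), (62, -31), (0, 0), (0, 0), (-868, 589), (0, 0)],
   [(0, 0), (0, 0), (0, 0), (2, 0), (2, -6), (6, -16), (-14, 0), (0, 0), (0, 0), (-62, 31), (62, 0), (0, -2), (868, -279), (0, 62)],
   [(0, 0), (0, 0), (0, 0), (0, 0), (8, 0), (8, -8), (-24, -8), (-10, -8), (-8, -5), (70, -30), (16, 2), (0, 0), (-70, 154), (-12, 14)],
   [(0, 0), (0, 0), (0, 0), (0, 0), (0, 0), (16, 0), (24, 8), (10, 8), (8, 5), (-70, 30), (-16, -2), (0, 0), (70, -588), (12, -14)],
   [(0, 0), (0, 0), (0, 0), (0, 0), (0, 0), (0, 0), (28, 0), (0, 0), (0, 0), (0, 0), (0, 0), (0, 0), (-434, 0), (0, 0)],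
   [(0, 0), (0, 0), (0, 0), (0, 0), (0, 0), (0, 0), (0, 0), (14, 0), (7, 7), (377, -352), (10, -22), (0, 0), (-2919, 1127), (-116, 63)],
   [(0, 0), (0, 0), (0, 0), (0, 0), (0, 0), (0, 0), (0, 0), (0, 0), (7, 0), (-213, 78), (-54, 32), (0, 0), (-2205, 1379), (56, -55)],
   [(0, 0), (0, 0), (0, 0), (0, 0), (0, 0), (0, 0), (0, 0), (0, 0), (0, 0), (124, 0), (-31, 0), (0, 1), (-248, 899), (0, -31)],
   [(0, 0), (0, 0), (0, 0), (0, 0), (0, 0), (0, 0), (0, 0), (0, 0), (0, 0), (0, 0), (31, 0), (0, -1), (-434, 155), (0, 31)],
   [(0, 0), (0, 0), (0, 0), (0, 0), (0, 0), (0, 0), (0, 0), (0, 0), (0, 0), (0, 0), (0, 0), (2, 0), (868, -868), (-62, 0)],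
   [(0, 0), (0, 0), (0, 0), (0, 0), (0, 0), (0, 0), (0, 0), (0, 0), (0, 0), (0, 0), (0, 0), (0, 0), (868, 0), (-31, 0)],
   [(0, 0), (0, 0), (0, 0), (0, 0), (0, 0), (0, 0), (0, 0), (0, 0), (0, 0), (0, 0), (0, 0), (0, 0), (0, 0), (31, 0)]]"

definition L_bal :: "zr2 list list" where
  "L_bal = [
   [(0, 4), (0, 0), (0, 0), (0, 0), (0, 0), (0, 0), (0, 0), (0, 0), (0, 0), (0, 0), (0, 0), (0, 0), (0, 0), (0, 0)],
   [(-4, -4), (-8, 0), (0, 0), (0, 0), (0, 0), (0, 0), (0, 0), (0, 0), (0, 0), (0, 0), (0, 0), (0, 0), (0, 0), (0, 0)],
   [(0, 0), (0, 0), (-64, 0), (0, 0), (0, 0), (0, 0), (0, 0), (0, 0), (0, 0), (0, 0), (0, 0), (0, 0), (0, 0), (0, 0)],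
   [(0, 8), (0, 0), (-192, -32), (64, 0), (0, 0), (0, 0), (0, 0), (0, 0), (0, 0), (0, 0), (0, 0), (0, 0), (0, 0), (0, 0)],
   [(0, 8), (0, 0), (-384, -64), (128, 0), (128, 0), (0, 0), (0, 0), (0, 0), (0, 0), (0, 0), (0, 0), (0, 0), (0, 0), (0, 0)],
   [(-4, 0), (-8, 0), (-128, -32), (64, 0), (128, -128), (256, -384), (0, 0), (0, 0), (0, 0), (0, 0), (0, 0), (0, 0), (0, 0), (0, 0)],
   [(0, 4), (0, 0), (0, 0), (0, 0), (-128, 0), (0, 0), (896, 0), (0, 0), (0, 0), (0, 0), (0, 0), (0, 0), (0, 0), (0, 0)],
   [(12, -4), (24, 0), (0, 160), (-96, 32), (-160, 512), (-1696, 1312), (-1568, -224), (-224, -224), (0, 0), (0, 0), (0, 0), (0, 0), (0, 0), (0, 0)],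
   [(8, -2), (0, 4), (152, -80), (-32, -4), (296, -36), (912, -492), (-272, -156), (-216, -156), (-128, -108), (0, 0), (0, 0), (0, 0), (0, 0), (0, 0)],
   [(28, 2), (40, 4), (-72, 128), (-112, 44), (-40, 796), (-1984, 1892), (-1952, -268), (-440, -380), (-128, -108), (0, 1736), (0, 0), (0, 0), (0, 0), (0, 0)],
   [(0, 0), (0, 0), (0, 64), (0, -32), (64, -32), (128, 32), (0, 224), (0, 0), (0, 0), (-992, 992), (0, -496), (0, 0), (0, 0), (0, 0)],
   [(-24, -4), (-16, -8), (16, 192), (32, -88), (-176, -312), (256, -328), (896, 280), (224, 168), (0, 0), (-992, 992), (0, -496), (32, 0), (0, 0), (0, 0)],
   [(-12, -2), (-8, -4), (8, 96), (16, -44), (-120, -124), (96, -164), (512, 12), (8, 12), (-128, -108), (0, 1736), (0, 0), (32, 0), (13888, 0), (0, 0)],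
   [(12, 2), (8, 4), (-8, -32), (-16, 12), (184, 92), (32, 196), (-512, 212), (-8, -12), (128, 108), (-992, -744), (0, -496), (32, 0), (13888, -27776), (-1984, 0)]]"

section \<open>The one-parameter group of X\<close>

lemma idx_8: "idx (0::8) = 0" "idx (1::8) = 1" "idx (2::8) = 2" "idx (3::8) = 3"
  "idx (4::8) = 4" "idx (5::8) = 5" "idx (6::8) = 6" "idx (7::8) = 7"
  using idx_of_nat[where 'a = "4", of 0] idx_of_nat[where 'a = "4", of 1] idx_of_nat[where 'a = "4", of 2]
    idx_of_nat[where 'a = "4", of 3] idx_of_nat[where 'a = "4", of 4] idx_of_nat[where 'a = "4", of 5]
    idx_of_nat[where 'a = "4", of 6] idx_of_nat[where 'a = "4", of 7]
  by simp_all

abbreviation oct_mat :: "zr2 list list \<Rightarrow> oct_matrix" where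
  "oct_mat \<equiv> to_mat"

text \<open>The product of vectors is componentwise, and so is the product with a numeral.\<close>

lemma numeral_times_octonion: "numeral w * x = numeral w *\<^sub>R (x :: octonion)"
  by (simp add: vec_eq_iff numeral_index)

lemmas oct_mult_linear =
  bounded_bilinear.scaleR_left[OF bounded_bilinear_oct_mult]
  bounded_bilinear.scaleR_right[OF bounded_bilinear_oct_mult]
  bounded_bilinear.add_left[OF bounded_bilinear_oct_mult]
  bounded_bilinear.add_right[OF bounded_bilinear_oct_mult]
  bounded_bilinear.minus_left[OF bounded_bilinear_oct_mult]
  bounded_bilinear.minus_right[OF bounded_bilinear_oct_mult]
  bounded_bilinear.diff_left[OF bounded_bilinear_oct_mult]
  bounded_bilinear.diff_right[OF bounded_bilinear_oct_mult]

lemma Dij_nth: "Dij i j $ r $ c =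
    (oct_commutator (oct_commutator (oct_e i) (oct_e j)) (oct_e c)
      - 3 *\<^sub>R oct_associator (oct_e i) (oct_e j) (oct_e c)) $ r"
  by (simp add: Dij_def oct_D_def matrix_def oct_e_def)

lemma g2_basis_to_mat: "g2_basis = map to_mat g2_lists"
  unfolding g2_basis_def g2_lists_def list.map list.inject
  by (intro conjI; simp add: vec_eq_iff forall_8 to_mat_nth int_mat_def idx_8 Dij_nth oct_commutator_def
    oct_associator_def oct_e_mult_oct_e oct_basis_mult_table oct_mult_linear oct_e_nth numeral_times_octonion)

lemma S_mat_to_mat: "S_mat = to_mat S_list"
  by (simp add: vec_eq_iff forall_8 to_mat_nth S_list_def int_mat_def idx_8 S_mat_def matrix_def oct_e_nth axis_def)

lemma S_mat_G2: "S_mat \<in> G2"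
proof -
  have nth: "(S_mat *v x) $ 0 = x $ 0" "(S_mat *v x) $ 1 = x $ 1" "(S_mat *v x) $ 2 = x $ 4"
    "(S_mat *v x) $ 3 = x $ 5" "(S_mat *v x) $ 4 = x $ 2" "(S_mat *v x) $ 5 = x $ 3"
    "(S_mat *v x) $ 6 = - x $ 6" "(S_mat *v x) $ 7 = - x $ 7" for x
    by (simp_all add: matrix_vector_mult_def sum_8 S_mat_to_mat to_mat_nth S_list_def int_mat_def idx_8)
  have "S_mat *v (S_mat *v x) = x" for x by (simp add: vec_eq_iff forall_8 nth)
  then have "S_mat ** S_mat = mat 1" by (simp add: matrix_eq matrix_vector_mul_assoc[symmetric])
  then have "invertible S_mat" unfolding invertible_def by blast
  moreover have "S_mat *v (x \<odot> y) = (S_mat *v x) \<odot> (S_mat *v y)" for x y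
    by (simp add: vec_eq_iff forall_8 nth oct_mult_nth)
  ultimately show ?thesis by (simp add: G2_def)
qed

lemma X_to_mat: "X = to_mat X_list"
proof -
  have "X = g2_basis ! 12 + g2_basis ! 13" by (simp add: X_def g2_basis_def)
  then show ?thesis
    by (simp add: g2_basis_to_mat g2_lists_def X_list_def vec_eq_iff forall_8 to_mat_nth int_mat_def idx_8)
qed

lemma X_derivation: "X *v (x \<odot> y) = (X *v x) \<odot> y + x \<odot> (X *v y)"
proof -
  have nth: "(X *v x) $ 0 = 0" "(X *v x) $ 1 = 2 * x $ 2 - 2 * x $ 3" "(X *v x) $ 2 = - 2 * x $ 1"
    "(X *v x) $ 3 = 2 * x $ 1" "(X *v x) $ 4 = - 4 * x $ 6 - 4 * x $ 7" "(X *v x) $ 5 = 2 * x $ 7 - 2 * x $ 6"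
    "(X *v x) $ 6 = 4 * x $ 4 + 2 * x $ 5" "(X *v x) $ 7 = 4 * x $ 4 - 2 * x $ 5" for x
    by (simp_all add: matrix_vector_mult_def sum_8 X_to_mat to_mat_nth X_list_def int_mat_def idx_8)
  show ?thesis by (simp add: vec_eq_iff forall_8 nth oct_mult_nth algebra_simps)
qed

text \<open>\<open>P0\<close>, \<open>P1\<close>, \<open>P2\<close> play the part of the projections
  onto the eigenspaces of the square of \<open>X\<close> with eigenvalues 0,
  \<open>- \<omega>\<^sup>2\<close> and \<open>- \<mu>\<^sup>2\<close>, and \<open>J1\<close>,
  \<open>J2\<close> are \<open>X\<close> on the last two, divided by the frequency. The exponential
  series then separates into cosine and sine series.\<close>

lemma mat_exp_two_frequencies:
  fixes X P0 P1 J1 P2 J2 :: "real^'n^'n"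
  assumes one: "P0 + P1 + P2 = mat 1" and X0: "X ** P0 = 0"
    and X1: "X ** P1 = \<omega> *\<^sub>R J1" "X ** J1 = (- \<omega>) *\<^sub>R P1"
    and X2: "X ** P2 = \<mu> *\<^sub>R J2" "X ** J2 = (- \<mu>) *\<^sub>R P2"
  shows "mat_exp (t *\<^sub>R X) = P0 + cos (\<omega> * t) *\<^sub>R P1 + sin (\<omega> * t) *\<^sub>R J1
    + cos (\<mu> * t) *\<^sub>R P2 + sin (\<mu> * t) *\<^sub>R J2"
proof -
  interpret bounded_bilinear "\<lambda>A B :: real^'n^'n. A ** B" by (rule bounded_bilinear_matrix_mult)
  have pow: "(1 / fact k) *\<^sub>R ((**) (t *\<^sub>R X) ^^ k) (mat 1) =
      (if k = 0 then 1 else 0 :: real) *\<^sub>R P0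
      + (cos_coeff k * (\<omega> * t) ^ k) *\<^sub>R P1 + (sin_coeff k * (\<omega> * t) ^ k) *\<^sub>R J1
      + (cos_coeff k * (\<mu> * t) ^ k) *\<^sub>R P2 + (sin_coeff k * (\<mu> * t) ^ k) *\<^sub>R J2" for k
  proof (induction k)
    case 0
    then show ?case by (simp add: one)
  next
    case (Suc k)
    have "(1 / fact (Suc k)) *\<^sub>R ((**) (t *\<^sub>R X) ^^ Suc k) (mat 1) =
        (t / real (Suc k)) *\<^sub>R (X ** ((1 / fact k) *\<^sub>R ((**) (t *\<^sub>R X) ^^ k) (mat 1)))"
      by (simp add: scaleR_left scaleR_right)
    also have "\<dots> = (cos_coeff (Suc k) * (\<omega> * t) ^ Suc k) *\<^sub>R P1 + (sin_coeff (Suc k) * (\<omega> * t) ^ Suc k) *\<^sub>R J1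
      + (cos_coeff (Suc k) * (\<mu> * t) ^ Suc k) *\<^sub>R P2 + (sin_coeff (Suc k) * (\<mu> * t) ^ Suc k) *\<^sub>R J2"
      unfolding Suc by (simp add: add_right scaleR_right X0 X1 X2 cos_coeff_Suc sin_coeff_Suc algebra_simps)
    finally show ?case by simp
  qed
  \<comment> \<open>The constant part of the exponential is the term \<open>k = 0\<close> alone,
    because \<open>X\<close> annihilates \<open>P0\<close>.\<close>
  have delta: "(\<lambda>k::nat. (if k = 0 then 1 else 0 :: real) *\<^sub>R P0) sums P0"
    using sums_single[of 0 "\<lambda>_. P0"] by (simp add: if_distrib[of "\<lambda>c. c *\<^sub>R P0"] cong: if_cong)
  have "(\<lambda>k. (1 / fact k) *\<^sub>R ((**) (t *\<^sub>R X) ^^ k) (mat 1)) sums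
    (P0 + cos (\<omega> * t) *\<^sub>R P1 + sin (\<omega> * t) *\<^sub>R J1 + cos (\<mu> * t) *\<^sub>R P2 + sin (\<mu> * t) *\<^sub>R J2)"
    unfolding pow
    by (intro sums_add delta bounded_linear.sums[OF bounded_linear_scaleR_left])
      (use cos_converges[where 'a = real] sin_converges[where 'a = real] in auto)
  then show ?thesis unfolding mat_exp_def by (rule sums_unique[symmetric])
qed

text \<open>The closed form of the exponential of t X; the factor 1 / 2 undoes the doubling of the
  stored coefficient matrices.\<close>

definition \<Phi> :: "real \<Rightarrow> oct_matrix" where
  "\<Phi> t = (1 / 2) *\<^sub>R (oct_mat P0 + cos (2 * sqrt 2 * t) *\<^sub>R oct_mat P1 + sin (2 * sqrt 2 * t) *\<^sub>R oct_mat J1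
    + cos (4 * sqrt 2 * t) *\<^sub>R oct_mat P2 + sin (4 * sqrt 2 * t) *\<^sub>R oct_mat J2)"

text \<open>Products are taken in both orders: those with \<open>X\<close> on the left determine the
  exponential, and agreement with those on the right shows that it commutes with
  \<open>X\<close>.\<close>

lemma lists_P_J:
  shows "has_dims 8 8 P0" "has_dims 8 8 P1" "has_dims 8 8 J1" "has_dims 8 8 P2" "has_dims 8 8 J2" "has_dims 8 8 X_list"
    and "mat_mult 8 X_list P0 = mat_scale (0, 0) P0" "mat_mult 8 P0 X_list = mat_scale (0, 0) P0"
    and "mat_mult 8 X_list P1 = mat_scale (0, 2) J1" "mat_mult 8 P1 X_list = mat_scale (0, 2) J1"
    and "mat_mult 8 X_list J1 = mat_scale (0, - 2) P1" "mat_mult 8 J1 X_list = mat_scale (0, - 2) P1"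
    and "mat_mult 8 X_list P2 = mat_scale (0, 4) J2" "mat_mult 8 P2 X_list = mat_scale (0, 4) J2"
    and "mat_mult 8 X_list J2 = mat_scale (0, - 4) P2" "mat_mult 8 J2 X_list = mat_scale (0, - 4) P2"
  by code_simp+

lemma oct_matrix_to_mat_mult:
  "has_dims 8 8 L \<Longrightarrow> has_dims 8 8 K \<Longrightarrow> (to_mat L :: oct_matrix) ** (to_mat K :: oct_matrix) = to_mat (mat_mult 8 L K)"
  using to_mat_mult[where 'm = 4 and 'k = 4 and 'n = 4] by simp

lemma oct_matrix_to_mat_scale:
  "has_dims 8 8 L \<Longrightarrow> (to_mat (mat_scale c L) :: oct_matrix) = zr2_val c *\<^sub>R to_mat L"
  using to_mat_scale[where 'm = 4 and 'n = 4] by simp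

lemma X_times_P_J:
  "X ** oct_mat P0 = 0" "oct_mat P0 ** X = 0"
  "X ** oct_mat P1 = (2 * sqrt 2) *\<^sub>R oct_mat J1" "oct_mat P1 ** X = (2 * sqrt 2) *\<^sub>R oct_mat J1"
  "X ** oct_mat J1 = (- (2 * sqrt 2)) *\<^sub>R oct_mat P1" "oct_mat J1 ** X = (- (2 * sqrt 2)) *\<^sub>R oct_mat P1"
  "X ** oct_mat P2 = (4 * sqrt 2) *\<^sub>R oct_mat J2" "oct_mat P2 ** X = (4 * sqrt 2) *\<^sub>R oct_mat J2"
  "X ** oct_mat J2 = (- (4 * sqrt 2)) *\<^sub>R oct_mat P2" "oct_mat J2 ** X = (- (4 * sqrt 2)) *\<^sub>R oct_mat P2"
  by (simp_all add: X_to_mat oct_matrix_to_mat_mult lists_P_J oct_matrix_to_mat_scale zr2_val_def)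

lemma sum_P: "(oct_mat P0 :: oct_matrix) + oct_mat P1 + oct_mat P2 = 2 *\<^sub>R mat 1"
  by (simp add: vec_eq_iff forall_8 to_mat_nth idx_8 P0_def P1_def P2_def mat_def zr2_val_def)

lemma mat_exp_X: "mat_exp (t *\<^sub>R X) = \<Phi> t"
proof -
  interpret bounded_bilinear "\<lambda>A B :: oct_matrix. A ** B" by (rule bounded_bilinear_matrix_mult)
  have "(1/2) *\<^sub>R oct_mat P0 + (1/2) *\<^sub>R oct_mat P1 + (1/2) *\<^sub>R oct_mat P2 = (mat 1 :: oct_matrix)"
    using arg_cong[OF sum_P, of "\<lambda>M. (1/2) *\<^sub>R M"] by (simp add: scaleR_add_right)
  then show ?thesis
    using mat_exp_two_frequencies[of "(1/2) *\<^sub>R oct_mat P0" "(1/2) *\<^sub>R oct_mat P1" "(1/2) *\<^sub>R oct_mat P2" X "2 * sqrt 2" "(1/2) *\<^sub>R oct_mat J1" "4 * sqrt 2" "(1/2) *\<^sub>R oct_mat J2" t]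
    by (simp add: scaleR_right X_times_P_J \<Phi>_def scaleR_add_right)
qed

lemma \<Phi>_0: "\<Phi> 0 = mat 1"
  using sum_P by (simp add: \<Phi>_def)

lemma \<Phi>_commute: "\<Phi> t ** X = X ** \<Phi> t"
proof -
  interpret bounded_bilinear "\<lambda>A B :: oct_matrix. A ** B" by (rule bounded_bilinear_matrix_mult)
  show ?thesis by (simp add: \<Phi>_def add_left add_right scaleR_left scaleR_right X_times_P_J)
qed

lemma has_vector_derivative_\<Phi>: "(\<Phi> has_vector_derivative X ** \<Phi> t) (at t)"
proof -
  interpret bounded_bilinear "\<lambda>A B :: oct_matrix. A ** B" by (rule bounded_bilinear_matrix_mult)
  show ?thesis
    unfolding \<Phi>_def
    by (rule has_vector_derivative_eq_rhs, (rule derivative_intros)+)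
      (auto simp: add_right scaleR_right X_times_P_J algebra_simps intro!: derivative_eq_intros)
qed

section \<open>Derivations of the octonions\<close>

definition g2_comb :: "(nat \<Rightarrow> real) \<Rightarrow> oct_matrix" where
  "g2_comb a = (\<Sum>i<14. a i *\<^sub>R (g2_basis ! i))"

lemma sum_lessThan_14:
  fixes f :: "nat \<Rightarrow> 'a::comm_monoid_add"
  shows "(\<Sum>i<14. f i) = f 0 + f 1 + f 2 + f 3 + f 4 + f 5 + f 6 + f 7
    + f 8 + f 9 + f 10 + f 11 + f 12 + f 13"
  by (simp add: eval_nat_numeral)

lemma g2_comb_nth:
  "g2_comb a $ 0 $ 0 = 0"
  "g2_comb a $ 0 $ 1 = 0"
  "g2_comb a $ 0 $ 2 = 0"
  "g2_comb a $ 0 $ 3 = 0"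
  "g2_comb a $ 0 $ 4 = 0"
  "g2_comb a $ 0 $ 5 = 0"
  "g2_comb a $ 0 $ 6 = 0"
  "g2_comb a $ 0 $ 7 = 0"
  "g2_comb a $ 1 $ 0 = 0"
  "g2_comb a $ 1 $ 1 = 0"
  "g2_comb a $ 1 $ 2 = - 4 * a 0 + 2 * a 13"
  "g2_comb a $ 1 $ 3 = - 4 * a 1 - 2 * a 12"
  "g2_comb a $ 1 $ 4 = - 4 * a 2 - 2 * a 10"
  "g2_comb a $ 1 $ 5 = - 4 * a 3 + 2 * a 9"
  "g2_comb a $ 1 $ 6 = - 4 * a 4 - 2 * a 8"
  "g2_comb a $ 1 $ 7 = - 4 * a 5 + 2 * a 7"
  "g2_comb a $ 2 $ 0 = 0"
  "g2_comb a $ 2 $ 1 = 4 * a 0 - 2 * a 13"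
  "g2_comb a $ 2 $ 2 = 0"
  "g2_comb a $ 2 $ 3 = - 4 * a 6 + 2 * a 11"
  "g2_comb a $ 2 $ 4 = 2 * a 5 - 4 * a 7"
  "g2_comb a $ 2 $ 5 = - 2 * a 4 - 4 * a 8"
  "g2_comb a $ 2 $ 6 = 2 * a 3 - 4 * a 9"
  "g2_comb a $ 2 $ 7 = - 2 * a 2 - 4 * a 10"
  "g2_comb a $ 3 $ 0 = 0"
  "g2_comb a $ 3 $ 1 = 4 * a 1 + 2 * a 12"
  "g2_comb a $ 3 $ 2 = 4 * a 6 - 2 * a 11"
  "g2_comb a $ 3 $ 3 = 0"
  "g2_comb a $ 3 $ 4 = - 2 * a 4 + 2 * a 8"
  "g2_comb a $ 3 $ 5 = - 2 * a 5 - 2 * a 7"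
  "g2_comb a $ 3 $ 6 = 2 * a 2 - 2 * a 10"
  "g2_comb a $ 3 $ 7 = 2 * a 3 + 2 * a 9"
  "g2_comb a $ 4 $ 0 = 0"
  "g2_comb a $ 4 $ 1 = 4 * a 2 + 2 * a 10"
  "g2_comb a $ 4 $ 2 = - 2 * a 5 + 4 * a 7"
  "g2_comb a $ 4 $ 3 = 2 * a 4 - 2 * a 8"
  "g2_comb a $ 4 $ 4 = 0"
  "g2_comb a $ 4 $ 5 = 2 * a 6 - 4 * a 11"
  "g2_comb a $ 4 $ 6 = - 2 * a 1 - 4 * a 12"
  "g2_comb a $ 4 $ 7 = 2 * a 0 - 4 * a 13"
  "g2_comb a $ 5 $ 0 = 0"
  "g2_comb a $ 5 $ 1 = 4 * a 3 - 2 * a 9"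
  "g2_comb a $ 5 $ 2 = 2 * a 4 + 4 * a 8"
  "g2_comb a $ 5 $ 3 = 2 * a 5 + 2 * a 7"
  "g2_comb a $ 5 $ 4 = - 2 * a 6 + 4 * a 11"
  "g2_comb a $ 5 $ 5 = 0"
  "g2_comb a $ 5 $ 6 = - 2 * a 0 - 2 * a 13"
  "g2_comb a $ 5 $ 7 = - 2 * a 1 + 2 * a 12"
  "g2_comb a $ 6 $ 0 = 0"
  "g2_comb a $ 6 $ 1 = 4 * a 4 + 2 * a 8"
  "g2_comb a $ 6 $ 2 = - 2 * a 3 + 4 * a 9"
  "g2_comb a $ 6 $ 3 = - 2 * a 2 + 2 * a 10"
  "g2_comb a $ 6 $ 4 = 2 * a 1 + 4 * a 12"
  "g2_comb a $ 6 $ 5 = 2 * a 0 + 2 * a 13"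
  "g2_comb a $ 6 $ 6 = 0"
  "g2_comb a $ 6 $ 7 = - 2 * a 6 - 2 * a 11"
  "g2_comb a $ 7 $ 0 = 0"
  "g2_comb a $ 7 $ 1 = 4 * a 5 - 2 * a 7"
  "g2_comb a $ 7 $ 2 = 2 * a 2 + 4 * a 10"
  "g2_comb a $ 7 $ 3 = - 2 * a 3 - 2 * a 9"
  "g2_comb a $ 7 $ 4 = - 2 * a 0 + 4 * a 13"
  "g2_comb a $ 7 $ 5 = 2 * a 1 - 2 * a 12"
  "g2_comb a $ 7 $ 6 = 2 * a 6 + 2 * a 11"
  "g2_comb a $ 7 $ 7 = 0"
  unfolding g2_comb_def sum_lessThan_14
  by (simp_all add: g2_basis_to_mat g2_lists_def to_mat_nth int_mat_def idx_8)

text \<open>The fourteen coefficients fall into seven pairs, and each pair occurs in two matrix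
  entries as a nonsingular 2 by 2 system.\<close>

lemma g2_comb_inject:
  assumes "g2_comb a = g2_comb b" "i < 14"
  shows "a i = b i"
proof -
  have "a 0 = b 0" "a 13 = b 13"
    using arg_cong[OF assms(1), of "\<lambda>M. M $ 1 $ 2"] arg_cong[OF assms(1), of "\<lambda>M. M $ 4 $ 7"]
    unfolding g2_comb_nth by linarith+
  note * = this
  have "a 1 = b 1" "a 12 = b 12"
    using arg_cong[OF assms(1), of "\<lambda>M. M $ 1 $ 3"] arg_cong[OF assms(1), of "\<lambda>M. M $ 4 $ 6"]
    unfolding g2_comb_nth by linarith+
  note * = this *
  have "a 2 = b 2" "a 10 = b 10"
    using arg_cong[OF assms(1), of "\<lambda>M. M $ 1 $ 4"] arg_cong[OF assms(1), of "\<lambda>M. M $ 2 $ 7"]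
    unfolding g2_comb_nth by linarith+
  note * = this *
  have "a 3 = b 3" "a 9 = b 9"
    using arg_cong[OF assms(1), of "\<lambda>M. M $ 1 $ 5"] arg_cong[OF assms(1), of "\<lambda>M. M $ 2 $ 6"]
    unfolding g2_comb_nth by linarith+
  note * = this *
  have "a 4 = b 4" "a 8 = b 8"
    using arg_cong[OF assms(1), of "\<lambda>M. M $ 1 $ 6"] arg_cong[OF assms(1), of "\<lambda>M. M $ 2 $ 5"]
    unfolding g2_comb_nth by linarith+
  note * = this *
  have "a 5 = b 5" "a 7 = b 7"
    using arg_cong[OF assms(1), of "\<lambda>M. M $ 1 $ 7"] arg_cong[OF assms(1), of "\<lambda>M. M $ 2 $ 4"]
    unfolding g2_comb_nth by linarith+
  note * = this *
  have "a 6 = b 6" "a 11 = b 11"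
    using arg_cong[OF assms(1), of "\<lambda>M. M $ 2 $ 3"] arg_cong[OF assms(1), of "\<lambda>M. M $ 4 $ 5"]
    unfolding g2_comb_nth by linarith+
  note * = this *
  then have "\<forall>i<14. a i = b i"
    using * by (simp add: eval_nat_numeral All_less_Suc)
  then show ?thesis using assms(2) by blast
qed

lemma mult_oct_e_nth: "(Z *v oct_e i) $ r = Z $ r $ i" for Z :: oct_matrix
proof -
  have "(Z *v oct_e i) $ r = (\<Sum>j\<in>UNIV. if j = i then Z $ r $ j else 0)"
    unfolding matrix_vector_mult_def by (simp add: oct_e_nth if_distrib cong: if_cong)
  then show ?thesis by simp
qed

lemma mult_uminus_oct_e_nth: "(Z *v (- oct_e i)) $ r = - Z $ r $ i" for Z :: oct_matrix
  using mult_oct_e_nth[of Z i r] by (simp add: matrix_vector_mult_def sum_negf)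

text \<open>Linear elimination: selected coordinates of the defect express all 64 entries through
  fourteen entries in rows 1, 2 and 4. By skew-symmetry these rows carry the images of
  \<open>e1\<close>, \<open>e2\<close> and \<open>e4\<close>, which generate the octonions, so a
  derivation has no further freedom.\<close>

lemma derivation_in_span_basis:
  assumes "derivation_defect Z = 0"
  shows "\<exists>a. Z = g2_comb a"
proof -
  have d: "derivation_defect Z $ i $ j $ k = 0" for i j k using assms by simp
  \<comment> \<open>The three digits in such a name are \<open>i\<close>, \<open>j\<close>,
    \<open>k\<close> for coordinate \<open>k\<close> of the defect at the i-th and j-th basis
    elements; in the names with two digits below they are row and column.\<close>
  have e000: "- Z $ 0 $ 0 = 0"
    using d[of 0 0 0] by (simp add: derivation_defect_def oct_e_mult_oct_e oct_basis_mult_table oct_mult_nth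
      oct_e_nth mult_oct_e_nth mult_uminus_oct_e_nth)
  have e001: "- Z $ 1 $ 0 = 0"
    using d[of 0 0 1] by (simp add: derivation_defect_def oct_e_mult_oct_e oct_basis_mult_table oct_mult_nth
      oct_e_nth mult_oct_e_nth mult_uminus_oct_e_nth)
  have e002: "- Z $ 2 $ 0 = 0"
    using d[of 0 0 2] by (simp add: derivation_defect_def oct_e_mult_oct_e oct_basis_mult_table oct_mult_nth
      oct_e_nth mult_oct_e_nth mult_uminus_oct_e_nth)
  have e003: "- Z $ 3 $ 0 = 0"
    using d[of 0 0 3] by (simp add: derivation_defect_def oct_e_mult_oct_e oct_basis_mult_table oct_mult_nth
      oct_e_nth mult_oct_e_nth mult_uminus_oct_e_nth)
  have e004: "- Z $ 4 $ 0 = 0"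
    using d[of 0 0 4] by (simp add: derivation_defect_def oct_e_mult_oct_e oct_basis_mult_table oct_mult_nth
      oct_e_nth mult_oct_e_nth mult_uminus_oct_e_nth)
  have e005: "- Z $ 5 $ 0 = 0"
    using d[of 0 0 5] by (simp add: derivation_defect_def oct_e_mult_oct_e oct_basis_mult_table oct_mult_nth
      oct_e_nth mult_oct_e_nth mult_uminus_oct_e_nth)
  have e006: "- Z $ 6 $ 0 = 0"
    using d[of 0 0 6] by (simp add: derivation_defect_def oct_e_mult_oct_e oct_basis_mult_table oct_mult_nth
      oct_e_nth mult_oct_e_nth mult_uminus_oct_e_nth)
  have e007: "- Z $ 7 $ 0 = 0"
    using d[of 0 0 7] by (simp add: derivation_defect_def oct_e_mult_oct_e oct_basis_mult_table oct_mult_nth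
      oct_e_nth mult_oct_e_nth mult_uminus_oct_e_nth)
  have e110: "- Z $ 0 $ 0 + 2 * Z $ 1 $ 1 = 0"
    using d[of 1 1 0] by (simp add: derivation_defect_def oct_e_mult_oct_e oct_basis_mult_table oct_mult_nth
      oct_e_nth mult_oct_e_nth mult_uminus_oct_e_nth)
  have e111: "- Z $ 1 $ 0 - 2 * Z $ 0 $ 1 = 0"
    using d[of 1 1 1] by (simp add: derivation_defect_def oct_e_mult_oct_e oct_basis_mult_table oct_mult_nth
      oct_e_nth mult_oct_e_nth mult_uminus_oct_e_nth)
  have e120: "Z $ 0 $ 3 + Z $ 1 $ 2 + Z $ 2 $ 1 = 0"
    using d[of 1 2 0] by (simp add: derivation_defect_def oct_e_mult_oct_e oct_basis_mult_table oct_mult_nth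
      oct_e_nth mult_oct_e_nth mult_uminus_oct_e_nth)
  have e121: "Z $ 1 $ 3 - Z $ 0 $ 2 + Z $ 3 $ 1 = 0"
    using d[of 1 2 1] by (simp add: derivation_defect_def oct_e_mult_oct_e oct_basis_mult_table oct_mult_nth
      oct_e_nth mult_oct_e_nth mult_uminus_oct_e_nth)
  have e122: "Z $ 2 $ 3 - Z $ 0 $ 1 + Z $ 3 $ 2 = 0"
    using d[of 1 2 2] by (simp add: derivation_defect_def oct_e_mult_oct_e oct_basis_mult_table oct_mult_nth
      oct_e_nth mult_oct_e_nth mult_uminus_oct_e_nth)
  have e124: "Z $ 4 $ 3 + Z $ 5 $ 2 - Z $ 6 $ 1 = 0"
    using d[of 1 2 4] by (simp add: derivation_defect_def oct_e_mult_oct_e oct_basis_mult_table oct_mult_nth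
      oct_e_nth mult_oct_e_nth mult_uminus_oct_e_nth)
  have e125: "Z $ 5 $ 3 - Z $ 4 $ 2 - Z $ 7 $ 1 = 0"
    using d[of 1 2 5] by (simp add: derivation_defect_def oct_e_mult_oct_e oct_basis_mult_table oct_mult_nth
      oct_e_nth mult_oct_e_nth mult_uminus_oct_e_nth)
  have e126: "Z $ 6 $ 3 + Z $ 4 $ 1 - Z $ 7 $ 2 = 0"
    using d[of 1 2 6] by (simp add: derivation_defect_def oct_e_mult_oct_e oct_basis_mult_table oct_mult_nth
      oct_e_nth mult_oct_e_nth mult_uminus_oct_e_nth)
  have e127: "Z $ 7 $ 3 + Z $ 5 $ 1 + Z $ 6 $ 2 = 0"
    using d[of 1 2 7] by (simp add: derivation_defect_def oct_e_mult_oct_e oct_basis_mult_table oct_mult_nth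
      oct_e_nth mult_oct_e_nth mult_uminus_oct_e_nth)
  have e140: "Z $ 0 $ 5 + Z $ 1 $ 4 + Z $ 4 $ 1 = 0"
    using d[of 1 4 0] by (simp add: derivation_defect_def oct_e_mult_oct_e oct_basis_mult_table oct_mult_nth
      oct_e_nth mult_oct_e_nth mult_uminus_oct_e_nth)
  have e141: "Z $ 1 $ 5 - Z $ 0 $ 4 + Z $ 5 $ 1 = 0"
    using d[of 1 4 1] by (simp add: derivation_defect_def oct_e_mult_oct_e oct_basis_mult_table oct_mult_nth
      oct_e_nth mult_oct_e_nth mult_uminus_oct_e_nth)
  have e142: "Z $ 2 $ 5 + Z $ 3 $ 4 + Z $ 6 $ 1 = 0"
    using d[of 1 4 2] by (simp add: derivation_defect_def oct_e_mult_oct_e oct_basis_mult_table oct_mult_nth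
      oct_e_nth mult_oct_e_nth mult_uminus_oct_e_nth)
  have e143: "Z $ 3 $ 5 - Z $ 2 $ 4 + Z $ 7 $ 1 = 0"
    using d[of 1 4 3] by (simp add: derivation_defect_def oct_e_mult_oct_e oct_basis_mult_table oct_mult_nth
      oct_e_nth mult_oct_e_nth mult_uminus_oct_e_nth)
  have e144: "Z $ 4 $ 5 - Z $ 0 $ 1 + Z $ 5 $ 4 = 0"
    using d[of 1 4 4] by (simp add: derivation_defect_def oct_e_mult_oct_e oct_basis_mult_table oct_mult_nth
      oct_e_nth mult_oct_e_nth mult_uminus_oct_e_nth)
  have e146: "Z $ 6 $ 5 - Z $ 2 $ 1 - Z $ 7 $ 4 = 0"
    using d[of 1 4 6] by (simp add: derivation_defect_def oct_e_mult_oct_e oct_basis_mult_table oct_mult_nth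
      oct_e_nth mult_oct_e_nth mult_uminus_oct_e_nth)
  have e147: "Z $ 7 $ 5 - Z $ 3 $ 1 + Z $ 6 $ 4 = 0"
    using d[of 1 4 7] by (simp add: derivation_defect_def oct_e_mult_oct_e oct_basis_mult_table oct_mult_nth
      oct_e_nth mult_oct_e_nth mult_uminus_oct_e_nth)
  have e160: "- Z $ 0 $ 7 + Z $ 1 $ 6 + Z $ 6 $ 1 = 0"
    using d[of 1 6 0] by (simp add: derivation_defect_def oct_e_mult_oct_e oct_basis_mult_table oct_mult_nth
      oct_e_nth mult_oct_e_nth mult_uminus_oct_e_nth)
  have e161: "- Z $ 1 $ 7 - Z $ 0 $ 6 - Z $ 7 $ 1 = 0"
    using d[of 1 6 1] by (simp add: derivation_defect_def oct_e_mult_oct_e oct_basis_mult_table oct_mult_nth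
      oct_e_nth mult_oct_e_nth mult_uminus_oct_e_nth)
  have e162: "- Z $ 2 $ 7 + Z $ 3 $ 6 - Z $ 4 $ 1 = 0"
    using d[of 1 6 2] by (simp add: derivation_defect_def oct_e_mult_oct_e oct_basis_mult_table oct_mult_nth
      oct_e_nth mult_oct_e_nth mult_uminus_oct_e_nth)
  have e163: "- Z $ 3 $ 7 - Z $ 2 $ 6 + Z $ 5 $ 1 = 0"
    using d[of 1 6 3] by (simp add: derivation_defect_def oct_e_mult_oct_e oct_basis_mult_table oct_mult_nth
      oct_e_nth mult_oct_e_nth mult_uminus_oct_e_nth)
  have e164: "- Z $ 4 $ 7 + Z $ 2 $ 1 + Z $ 5 $ 6 = 0"
    using d[of 1 6 4] by (simp add: derivation_defect_def oct_e_mult_oct_e oct_basis_mult_table oct_mult_nth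
      oct_e_nth mult_oct_e_nth mult_uminus_oct_e_nth)
  have e165: "- Z $ 5 $ 7 - Z $ 3 $ 1 - Z $ 4 $ 6 = 0"
    using d[of 1 6 5] by (simp add: derivation_defect_def oct_e_mult_oct_e oct_basis_mult_table oct_mult_nth
      oct_e_nth mult_oct_e_nth mult_uminus_oct_e_nth)
  have e166: "- Z $ 6 $ 7 - Z $ 0 $ 1 - Z $ 7 $ 6 = 0"
    using d[of 1 6 6] by (simp add: derivation_defect_def oct_e_mult_oct_e oct_basis_mult_table oct_mult_nth
      oct_e_nth mult_oct_e_nth mult_uminus_oct_e_nth)
  have e220: "- Z $ 0 $ 0 + 2 * Z $ 2 $ 2 = 0"
    using d[of 2 2 0] by (simp add: derivation_defect_def oct_e_mult_oct_e oct_basis_mult_table oct_mult_nth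
      oct_e_nth mult_oct_e_nth mult_uminus_oct_e_nth)
  have e222: "- Z $ 2 $ 0 - 2 * Z $ 0 $ 2 = 0"
    using d[of 2 2 2] by (simp add: derivation_defect_def oct_e_mult_oct_e oct_basis_mult_table oct_mult_nth
      oct_e_nth mult_oct_e_nth mult_uminus_oct_e_nth)
  have e240: "Z $ 0 $ 6 + Z $ 2 $ 4 + Z $ 4 $ 2 = 0"
    using d[of 2 4 0] by (simp add: derivation_defect_def oct_e_mult_oct_e oct_basis_mult_table oct_mult_nth
      oct_e_nth mult_oct_e_nth mult_uminus_oct_e_nth)
  have e241: "Z $ 1 $ 6 - Z $ 3 $ 4 + Z $ 5 $ 2 = 0"
    using d[of 2 4 1] by (simp add: derivation_defect_def oct_e_mult_oct_e oct_basis_mult_table oct_mult_nth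
      oct_e_nth mult_oct_e_nth mult_uminus_oct_e_nth)
  have e242: "Z $ 2 $ 6 - Z $ 0 $ 4 + Z $ 6 $ 2 = 0"
    using d[of 2 4 2] by (simp add: derivation_defect_def oct_e_mult_oct_e oct_basis_mult_table oct_mult_nth
      oct_e_nth mult_oct_e_nth mult_uminus_oct_e_nth)
  have e243: "Z $ 3 $ 6 + Z $ 1 $ 4 + Z $ 7 $ 2 = 0"
    using d[of 2 4 3] by (simp add: derivation_defect_def oct_e_mult_oct_e oct_basis_mult_table oct_mult_nth
      oct_e_nth mult_oct_e_nth mult_uminus_oct_e_nth)
  have e244: "Z $ 4 $ 6 - Z $ 0 $ 2 + Z $ 6 $ 4 = 0"
    using d[of 2 4 4] by (simp add: derivation_defect_def oct_e_mult_oct_e oct_basis_mult_table oct_mult_nth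
      oct_e_nth mult_oct_e_nth mult_uminus_oct_e_nth)
  have e245: "Z $ 5 $ 6 - Z $ 1 $ 2 + Z $ 7 $ 4 = 0"
    using d[of 2 4 5] by (simp add: derivation_defect_def oct_e_mult_oct_e oct_basis_mult_table oct_mult_nth
      oct_e_nth mult_oct_e_nth mult_uminus_oct_e_nth)
  have e247: "Z $ 7 $ 6 - Z $ 3 $ 2 - Z $ 5 $ 4 = 0"
    using d[of 2 4 7] by (simp add: derivation_defect_def oct_e_mult_oct_e oct_basis_mult_table oct_mult_nth
      oct_e_nth mult_oct_e_nth mult_uminus_oct_e_nth)
  have e330: "- Z $ 0 $ 0 + 2 * Z $ 3 $ 3 = 0"
    using d[of 3 3 0] by (simp add: derivation_defect_def oct_e_mult_oct_e oct_basis_mult_table oct_mult_nth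
      oct_e_nth mult_oct_e_nth mult_uminus_oct_e_nth)
  have e333: "- Z $ 3 $ 0 - 2 * Z $ 0 $ 3 = 0"
    using d[of 3 3 3] by (simp add: derivation_defect_def oct_e_mult_oct_e oct_basis_mult_table oct_mult_nth
      oct_e_nth mult_oct_e_nth mult_uminus_oct_e_nth)
  have e440: "- Z $ 0 $ 0 + 2 * Z $ 4 $ 4 = 0"
    using d[of 4 4 0] by (simp add: derivation_defect_def oct_e_mult_oct_e oct_basis_mult_table oct_mult_nth
      oct_e_nth mult_oct_e_nth mult_uminus_oct_e_nth)
  have e444: "- Z $ 4 $ 0 - 2 * Z $ 0 $ 4 = 0"
    using d[of 4 4 4] by (simp add: derivation_defect_def oct_e_mult_oct_e oct_basis_mult_table oct_mult_nth
      oct_e_nth mult_oct_e_nth mult_uminus_oct_e_nth)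
  have e550: "- Z $ 0 $ 0 + 2 * Z $ 5 $ 5 = 0"
    using d[of 5 5 0] by (simp add: derivation_defect_def oct_e_mult_oct_e oct_basis_mult_table oct_mult_nth
      oct_e_nth mult_oct_e_nth mult_uminus_oct_e_nth)
  have e555: "- Z $ 5 $ 0 - 2 * Z $ 0 $ 5 = 0"
    using d[of 5 5 5] by (simp add: derivation_defect_def oct_e_mult_oct_e oct_basis_mult_table oct_mult_nth
      oct_e_nth mult_oct_e_nth mult_uminus_oct_e_nth)
  have e660: "- Z $ 0 $ 0 + 2 * Z $ 6 $ 6 = 0"
    using d[of 6 6 0] by (simp add: derivation_defect_def oct_e_mult_oct_e oct_basis_mult_table oct_mult_nth
      oct_e_nth mult_oct_e_nth mult_uminus_oct_e_nth)
  have e666: "- Z $ 6 $ 0 - 2 * Z $ 0 $ 6 = 0"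
    using d[of 6 6 6] by (simp add: derivation_defect_def oct_e_mult_oct_e oct_basis_mult_table oct_mult_nth
      oct_e_nth mult_oct_e_nth mult_uminus_oct_e_nth)
  have e770: "- Z $ 0 $ 0 + 2 * Z $ 7 $ 7 = 0"
    using d[of 7 7 0] by (simp add: derivation_defect_def oct_e_mult_oct_e oct_basis_mult_table oct_mult_nth
      oct_e_nth mult_oct_e_nth mult_uminus_oct_e_nth)
  have e777: "- Z $ 7 $ 0 - 2 * Z $ 0 $ 7 = 0"
    using d[of 7 7 7] by (simp add: derivation_defect_def oct_e_mult_oct_e oct_basis_mult_table oct_mult_nth
      oct_e_nth mult_oct_e_nth mult_uminus_oct_e_nth)
  have z00: "Z $ 0 $ 0 = 0"
    using e000 by linarith
  have z01: "Z $ 0 $ 1 = 0"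
    using e001 e111 by linarith
  have z02: "Z $ 0 $ 2 = 0"
    using e002 e222 by linarith
  have z03: "Z $ 0 $ 3 = 0"
    using e003 e333 by linarith
  have z04: "Z $ 0 $ 4 = 0"
    using e004 e444 by linarith
  have z05: "Z $ 0 $ 5 = 0"
    using e005 e555 by linarith
  have z06: "Z $ 0 $ 6 = 0"
    using e006 e666 by linarith
  have z07: "Z $ 0 $ 7 = 0"
    using e007 e777 by linarith
  have z10: "Z $ 1 $ 0 = 0"
    using e001 by linarith
  have z11: "Z $ 1 $ 1 = 0"
    using e000 e110 by linarith
  have z20: "Z $ 2 $ 0 = 0"
    using e002 by linarith
  have z21: "Z $ 2 $ 1 = - Z $ 1 $ 2"
    using e003 e120 e333 by linarith
  have z22: "Z $ 2 $ 2 = 0"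
    using e000 e220 by linarith
  have z30: "Z $ 3 $ 0 = 0"
    using e003 by linarith
  have z31: "Z $ 3 $ 1 = - Z $ 1 $ 3"
    using e002 e121 e222 by linarith
  have z32: "Z $ 3 $ 2 = - Z $ 2 $ 3"
    using e001 e111 e122 by linarith
  have z33: "Z $ 3 $ 3 = 0"
    using e000 e330 by linarith
  have z34: "Z $ 3 $ 4 = Z $ 1 $ 6 - Z $ 2 $ 5"
    using e007 e142 e160 e777 by linarith
  have z35: "Z $ 3 $ 5 = Z $ 1 $ 7 + Z $ 2 $ 4"
    using e006 e143 e161 e666 by linarith
  have z36: "Z $ 3 $ 6 = - Z $ 1 $ 4 + Z $ 2 $ 7"
    using e005 e140 e162 e555 by linarith
  have z37: "Z $ 3 $ 7 = - Z $ 1 $ 5 - Z $ 2 $ 6"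
    using e004 e141 e163 e444 by linarith
  have z40: "Z $ 4 $ 0 = 0"
    using e004 by linarith
  have z41: "Z $ 4 $ 1 = - Z $ 1 $ 4"
    using e005 e140 e555 by linarith
  have z42: "Z $ 4 $ 2 = - Z $ 2 $ 4"
    using e006 e240 e666 by linarith
  have z43: "Z $ 4 $ 3 = - Z $ 1 $ 6 + Z $ 2 $ 5"
    using e007 e124 e142 e160 e241 e777 by linarith
  have z44: "Z $ 4 $ 4 = 0"
    using e000 e440 by linarith
  have z50: "Z $ 5 $ 0 = 0"
    using e005 by linarith
  have z51: "Z $ 5 $ 1 = - Z $ 1 $ 5"
    using e004 e141 e444 by linarith
  have z52: "Z $ 5 $ 2 = - Z $ 2 $ 5"
    using e007 e142 e160 e241 e777 by linarith
  have z53: "Z $ 5 $ 3 = - Z $ 1 $ 7 - Z $ 2 $ 4"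
    using e006 e125 e161 e240 e666 by linarith
  have z54: "Z $ 5 $ 4 = - Z $ 4 $ 5"
    using e001 e111 e144 by linarith
  have z55: "Z $ 5 $ 5 = 0"
    using e000 e550 by linarith
  have z56: "Z $ 5 $ 6 = Z $ 1 $ 2 + Z $ 4 $ 7"
    using e003 e120 e164 e333 by linarith
  have z57: "Z $ 5 $ 7 = Z $ 1 $ 3 - Z $ 4 $ 6"
    using e002 e121 e165 e222 by linarith
  have z60: "Z $ 6 $ 0 = 0"
    using e006 by linarith
  have z61: "Z $ 6 $ 1 = - Z $ 1 $ 6"
    using e007 e160 e777 by linarith
  have z62: "Z $ 6 $ 2 = - Z $ 2 $ 6"
    using e004 e242 e444 by linarith
  have z63: "Z $ 6 $ 3 = Z $ 1 $ 4 - Z $ 2 $ 7"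
    using e005 e126 e140 e162 e243 e555 by linarith
  have z64: "Z $ 6 $ 4 = - Z $ 4 $ 6"
    using e002 e222 e244 by linarith
  have z65: "Z $ 6 $ 5 = - Z $ 1 $ 2 - Z $ 4 $ 7"
    using e003 e120 e146 e164 e245 e333 by linarith
  have z66: "Z $ 6 $ 6 = 0"
    using e000 e660 by linarith
  have z67: "Z $ 6 $ 7 = Z $ 2 $ 3 + Z $ 4 $ 5"
    using e001 e111 e122 e144 e166 e247 by linarith
  have z70: "Z $ 7 $ 0 = 0"
    using e007 by linarith
  have z71: "Z $ 7 $ 1 = - Z $ 1 $ 7"
    using e006 e161 e666 by linarith
  have z72: "Z $ 7 $ 2 = - Z $ 2 $ 7"
    using e005 e140 e162 e243 e555 by linarith
  have z73: "Z $ 7 $ 3 = Z $ 1 $ 5 + Z $ 2 $ 6"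
    using e004 e127 e141 e242 e444 by linarith
  have z74: "Z $ 7 $ 4 = - Z $ 4 $ 7"
    using e003 e120 e164 e245 e333 by linarith
  have z75: "Z $ 7 $ 5 = - Z $ 1 $ 3 + Z $ 4 $ 6"
    using e121 e147 e244 by linarith
  have z76: "Z $ 7 $ 6 = - Z $ 2 $ 3 - Z $ 4 $ 5"
    using e001 e111 e122 e144 e247 by linarith
  have z77: "Z $ 7 $ 7 = 0"
    using e000 e770 by linarith
  \<comment> \<open>The solutions of the seven 2 by 2 systems behind \<open>g2_comb_inject\<close>.
    Each has determinant 12, whence the coefficients 4/12 and 2/12 up to sign.\<close>
  define a where "a = (!) [- 1 / 3 * Z $ 1 $ 2 - 1 / 6 * Z $ 4 $ 7,
    - 1 / 3 * Z $ 1 $ 3 + 1 / 6 * Z $ 4 $ 6,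
    - 1 / 3 * Z $ 1 $ 4 + 1 / 6 * Z $ 2 $ 7,
    - 1 / 3 * Z $ 1 $ 5 - 1 / 6 * Z $ 2 $ 6,
    - 1 / 3 * Z $ 1 $ 6 + 1 / 6 * Z $ 2 $ 5,
    - 1 / 3 * Z $ 1 $ 7 - 1 / 6 * Z $ 2 $ 4,
    - 1 / 3 * Z $ 2 $ 3 - 1 / 6 * Z $ 4 $ 5,
    - 1 / 6 * Z $ 1 $ 7 - 1 / 3 * Z $ 2 $ 4,
    1 / 6 * Z $ 1 $ 6 - 1 / 3 * Z $ 2 $ 5,
    - 1 / 6 * Z $ 1 $ 5 - 1 / 3 * Z $ 2 $ 6,
    1 / 6 * Z $ 1 $ 4 - 1 / 3 * Z $ 2 $ 7,
    - 1 / 6 * Z $ 2 $ 3 - 1 / 3 * Z $ 4 $ 5,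
    1 / 6 * Z $ 1 $ 3 - 1 / 3 * Z $ 4 $ 6,
    - 1 / 6 * Z $ 1 $ 2 - 1 / 3 * Z $ 4 $ 7]"
  have a: "a 0 = - 1 / 3 * Z $ 1 $ 2 - 1 / 6 * Z $ 4 $ 7"
    "a 1 = - 1 / 3 * Z $ 1 $ 3 + 1 / 6 * Z $ 4 $ 6"
    "a 2 = - 1 / 3 * Z $ 1 $ 4 + 1 / 6 * Z $ 2 $ 7"
    "a 3 = - 1 / 3 * Z $ 1 $ 5 - 1 / 6 * Z $ 2 $ 6"
    "a 4 = - 1 / 3 * Z $ 1 $ 6 + 1 / 6 * Z $ 2 $ 5"
    "a 5 = - 1 / 3 * Z $ 1 $ 7 - 1 / 6 * Z $ 2 $ 4"
    "a 6 = - 1 / 3 * Z $ 2 $ 3 - 1 / 6 * Z $ 4 $ 5"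
    "a 7 = - 1 / 6 * Z $ 1 $ 7 - 1 / 3 * Z $ 2 $ 4"
    "a 8 = 1 / 6 * Z $ 1 $ 6 - 1 / 3 * Z $ 2 $ 5"
    "a 9 = - 1 / 6 * Z $ 1 $ 5 - 1 / 3 * Z $ 2 $ 6"
    "a 10 = 1 / 6 * Z $ 1 $ 4 - 1 / 3 * Z $ 2 $ 7"
    "a 11 = - 1 / 6 * Z $ 2 $ 3 - 1 / 3 * Z $ 4 $ 5"
    "a 12 = 1 / 6 * Z $ 1 $ 3 - 1 / 3 * Z $ 4 $ 6"
    "a 13 = - 1 / 6 * Z $ 1 $ 2 - 1 / 3 * Z $ 4 $ 7"
    by (simp_all add: a_def)
  have c12: "Z $ 1 $ 2 = g2_comb a $ 1 $ 2"
    unfolding g2_comb_nth a by (simp add: field_simps)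
  have c13: "Z $ 1 $ 3 = g2_comb a $ 1 $ 3"
    unfolding g2_comb_nth a by (simp add: field_simps)
  have c14: "Z $ 1 $ 4 = g2_comb a $ 1 $ 4"
    unfolding g2_comb_nth a by (simp add: field_simps)
  have c15: "Z $ 1 $ 5 = g2_comb a $ 1 $ 5"
    unfolding g2_comb_nth a by (simp add: field_simps)
  have c16: "Z $ 1 $ 6 = g2_comb a $ 1 $ 6"
    unfolding g2_comb_nth a by (simp add: field_simps)
  have c17: "Z $ 1 $ 7 = g2_comb a $ 1 $ 7"
    unfolding g2_comb_nth a by (simp add: field_simps)
  have c21: "Z $ 2 $ 1 = g2_comb a $ 2 $ 1"
    unfolding g2_comb_nth a using z21 by (simp add: field_simps)
  have c23: "Z $ 2 $ 3 = g2_comb a $ 2 $ 3"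
    unfolding g2_comb_nth a by (simp add: field_simps)
  have c24: "Z $ 2 $ 4 = g2_comb a $ 2 $ 4"
    unfolding g2_comb_nth a by (simp add: field_simps)
  have c25: "Z $ 2 $ 5 = g2_comb a $ 2 $ 5"
    unfolding g2_comb_nth a by (simp add: field_simps)
  have c26: "Z $ 2 $ 6 = g2_comb a $ 2 $ 6"
    unfolding g2_comb_nth a by (simp add: field_simps)
  have c27: "Z $ 2 $ 7 = g2_comb a $ 2 $ 7"
    unfolding g2_comb_nth a by (simp add: field_simps)
  have c31: "Z $ 3 $ 1 = g2_comb a $ 3 $ 1"
    unfolding g2_comb_nth a using z31 by (simp add: field_simps)
  have c32: "Z $ 3 $ 2 = g2_comb a $ 3 $ 2"
    unfolding g2_comb_nth a using z32 by (simp add: field_simps)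
  have c34: "Z $ 3 $ 4 = g2_comb a $ 3 $ 4"
    unfolding g2_comb_nth a using z34 by (simp add: field_simps)
  have c35: "Z $ 3 $ 5 = g2_comb a $ 3 $ 5"
    unfolding g2_comb_nth a using z35 by (simp add: field_simps)
  have c36: "Z $ 3 $ 6 = g2_comb a $ 3 $ 6"
    unfolding g2_comb_nth a using z36 by (simp add: field_simps)
  have c37: "Z $ 3 $ 7 = g2_comb a $ 3 $ 7"
    unfolding g2_comb_nth a using z37 by (simp add: field_simps)
  have c41: "Z $ 4 $ 1 = g2_comb a $ 4 $ 1"
    unfolding g2_comb_nth a using z41 by (simp add: field_simps)
  have c42: "Z $ 4 $ 2 = g2_comb a $ 4 $ 2"
    unfolding g2_comb_nth a using z42 by (simp add: field_simps)
  have c43: "Z $ 4 $ 3 = g2_comb a $ 4 $ 3"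
    unfolding g2_comb_nth a using z43 by (simp add: field_simps)
  have c45: "Z $ 4 $ 5 = g2_comb a $ 4 $ 5"
    unfolding g2_comb_nth a by (simp add: field_simps)
  have c46: "Z $ 4 $ 6 = g2_comb a $ 4 $ 6"
    unfolding g2_comb_nth a by (simp add: field_simps)
  have c47: "Z $ 4 $ 7 = g2_comb a $ 4 $ 7"
    unfolding g2_comb_nth a by (simp add: field_simps)
  have c51: "Z $ 5 $ 1 = g2_comb a $ 5 $ 1"
    unfolding g2_comb_nth a using z51 by (simp add: field_simps)
  have c52: "Z $ 5 $ 2 = g2_comb a $ 5 $ 2"
    unfolding g2_comb_nth a using z52 by (simp add: field_simps)
  have c53: "Z $ 5 $ 3 = g2_comb a $ 5 $ 3"
    unfolding g2_comb_nth a using z53 by (simp add: field_simps)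
  have c54: "Z $ 5 $ 4 = g2_comb a $ 5 $ 4"
    unfolding g2_comb_nth a using z54 by (simp add: field_simps)
  have c56: "Z $ 5 $ 6 = g2_comb a $ 5 $ 6"
    unfolding g2_comb_nth a using z56 by (simp add: field_simps)
  have c57: "Z $ 5 $ 7 = g2_comb a $ 5 $ 7"
    unfolding g2_comb_nth a using z57 by (simp add: field_simps)
  have c61: "Z $ 6 $ 1 = g2_comb a $ 6 $ 1"
    unfolding g2_comb_nth a using z61 by (simp add: field_simps)
  have c62: "Z $ 6 $ 2 = g2_comb a $ 6 $ 2"
    unfolding g2_comb_nth a using z62 by (simp add: field_simps)
  have c63: "Z $ 6 $ 3 = g2_comb a $ 6 $ 3"
    unfolding g2_comb_nth a using z63 by (simp add: field_simps)
  have c64: "Z $ 6 $ 4 = g2_comb a $ 6 $ 4"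
    unfolding g2_comb_nth a using z64 by (simp add: field_simps)
  have c65: "Z $ 6 $ 5 = g2_comb a $ 6 $ 5"
    unfolding g2_comb_nth a using z65 by (simp add: field_simps)
  have c67: "Z $ 6 $ 7 = g2_comb a $ 6 $ 7"
    unfolding g2_comb_nth a using z67 by (simp add: field_simps)
  have c71: "Z $ 7 $ 1 = g2_comb a $ 7 $ 1"
    unfolding g2_comb_nth a using z71 by (simp add: field_simps)
  have c72: "Z $ 7 $ 2 = g2_comb a $ 7 $ 2"
    unfolding g2_comb_nth a using z72 by (simp add: field_simps)
  have c73: "Z $ 7 $ 3 = g2_comb a $ 7 $ 3"
    unfolding g2_comb_nth a using z73 by (simp add: field_simps)
  have c74: "Z $ 7 $ 4 = g2_comb a $ 7 $ 4"
    unfolding g2_comb_nth a using z74 by (simp add: field_simps)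
  have c75: "Z $ 7 $ 5 = g2_comb a $ 7 $ 5"
    unfolding g2_comb_nth a using z75 by (simp add: field_simps)
  have c76: "Z $ 7 $ 6 = g2_comb a $ 7 $ 6"
    unfolding g2_comb_nth a using z76 by (simp add: field_simps)
  have "Z = g2_comb a"
    unfolding vec_eq_iff forall_8
    by (intro conjI c12 c13 c14 c15 c16 c17 c21 c23 c24 c25 c26 c27 c31 c32 c34 c35 c36 c37 c41 c42 c43
      c45 c46 c47 c51 c52 c53 c54 c56 c57 c61 c62 c63 c64 c65 c67 c71 c72 c73 c74 c75 c76;
      simp only: g2_comb_nth z00 z01 z02 z03 z04 z05 z06 z07 z10 z11 z20 z22 z30 z33 z40 z44 z50 z55 z60
        z66 z70 z77)
  then show ?thesis by blast
qed

section \<open>The letters and their action on derivations\<close>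

lemma constant_of_zero_vector_derivative:
  fixes f :: "real \<Rightarrow> 'a::real_normed_vector"
  assumes "\<And>t. (f has_vector_derivative 0) (at t)"
  shows "f s = f t"
  using has_derivative_zero_constant[of UNIV f] assms
  by (auto simp: has_vector_derivative_def)

lemma bounded_bilinear_matrix_vector_mult:
  "bounded_bilinear (\<lambda>(A :: real^'n^'m) x. A *v x)"
  unfolding bilinear_conv_bounded_bilinear[symmetric] bilinear_def
  by (auto intro!: linearI
      simp: matrix_vector_mult_def vec_eq_iff sum.distrib sum_distrib_left algebra_simps)

lemma has_vector_derivative_\<Phi>_minus: "((\<lambda>t. \<Phi> (- t)) has_vector_derivative - (\<Phi> (- t) ** X)) (at t)"
proof -
  have "(uminus has_vector_derivative (- 1 :: real)) (at t)"
    by (intro has_vector_derivative_minus has_vector_derivative_id)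
  from vector_diff_chain_at[OF this has_vector_derivative_\<Phi>]
  show ?thesis by (simp add: o_def \<Phi>_commute)
qed

text \<open>The derivative of the product vanishes because \<open>X\<close> commutes with
  \<open>\<Phi>\<close>; this bypasses trigonometric identities and products among the coefficient
  matrices.\<close>

lemma \<Phi>_minus_mult: "\<Phi> (- t) ** \<Phi> t = mat 1"
proof -
  have "((\<lambda>t. \<Phi> (- t) ** \<Phi> t) has_vector_derivative
      (\<Phi> (- t) ** (X ** \<Phi> t) + (- (\<Phi> (- t) ** X)) ** \<Phi> t)) (at t)" for t
    by (rule bounded_bilinear.has_vector_derivative[OF bounded_bilinear_matrix_mult
        has_vector_derivative_\<Phi>_minus has_vector_derivative_\<Phi>])
  then have "((\<lambda>t. \<Phi> (- t) ** \<Phi> t) has_vector_derivative 0) (at t)" for t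
    by (simp add: bounded_bilinear.minus_left[OF bounded_bilinear_matrix_mult] matrix_mul_assoc)
  from constant_of_zero_vector_derivative[OF this, of t 0] show ?thesis by (simp add: \<Phi>_0)
qed

text \<open>Both sides of the automorphism identity solve the linear equation u' = X u.\<close>

lemma \<Phi>_mult_oct: "\<Phi> t *v (x \<odot> y) = (\<Phi> t *v x) \<odot> (\<Phi> t *v y)"
proof -
  interpret mv: bounded_bilinear "\<lambda>(A :: oct_matrix) x. A *v x" by (rule bounded_bilinear_matrix_vector_mult)
  have d: "((\<lambda>t. \<Phi> t *v z) has_vector_derivative X *v (\<Phi> t *v z)) (at t)" for t z
    using mv.has_vector_derivative[OF has_vector_derivative_\<Phi> has_vector_derivative_const]
    by (simp add: matrix_vector_mul_assoc)
  \<comment> \<open>Pulled back by \<open>\<Phi> (- t)\<close>, the product of the images has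
    derivative 0: the derivation property of \<open>X\<close> makes the two contributions
    cancel.\<close>
  define u where "u t = \<Phi> (- t) *v ((\<Phi> t *v x) \<odot> (\<Phi> t *v y))" for t
  have "(u has_vector_derivative \<Phi> (- t) *v ((\<Phi> t *v x) \<odot> (X *v (\<Phi> t *v y)) + (X *v (\<Phi> t *v x)) \<odot> (\<Phi> t *v y))
      + (- (\<Phi> (- t) ** X)) *v ((\<Phi> t *v x) \<odot> (\<Phi> t *v y))) (at t)" for t
    unfolding u_def
    by (rule mv.has_vector_derivative[OF has_vector_derivative_\<Phi>_minus
        bounded_bilinear.has_vector_derivative[OF bounded_bilinear_oct_mult d d]])
  then have "(u has_vector_derivative 0) (at t)" for t
    by (simp add: mv.minus_left matrix_vector_mul_assoc[symmetric] X_derivation add.commute)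
  from constant_of_zero_vector_derivative[OF this, of t 0] have "u t = x \<odot> y"
    by (simp add: u_def \<Phi>_0)
  then have "\<Phi> t *v (\<Phi> (- t) *v ((\<Phi> t *v x) \<odot> (\<Phi> t *v y))) = \<Phi> t *v (x \<odot> y)" by (simp add: u_def)
  then show ?thesis using \<Phi>_minus_mult[of "- t"] by (simp add: matrix_vector_mul_assoc)
qed

lemma matrix_inv_inverse:
  fixes A :: "'a::semiring_1^'n^'n"
  assumes "invertible A"
  shows "A ** matrix_inv A = mat 1" "matrix_inv A ** A = mat 1"
  using someI_ex[OF assms[unfolded invertible_def]] unfolding matrix_inv_def by auto

lemma matrix_inv_eqI:
  fixes A B :: "'a::semiring_1^'n^'n"
  assumes "A ** B = mat 1" "B ** A = mat 1"
  shows "matrix_inv A = B"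
  using matrix_inv_inverse[of A] assms
  by (metis invertible_def matrix_mul_assoc matrix_mul_lid matrix_mul_rid)

lemma \<Phi>_G2: "\<Phi> t \<in> G2"
  unfolding G2_def invertible_def using \<Phi>_mult_oct \<Phi>_minus_mult[of t] \<Phi>_minus_mult[of "- t"] by auto

lemma G2_mult: "M \<in> G2 \<Longrightarrow> N \<in> G2 \<Longrightarrow> M ** N \<in> G2"
  by (simp add: G2_def invertible_mult matrix_vector_mul_assoc[symmetric])

lemma G2_one: "mat 1 \<in> G2"
  by (auto simp: G2_def invertible_def intro: exI[of _ "mat 1"])

lemma G2_matrix_inv:
  assumes "M \<in> G2"
  shows "matrix_inv M \<in> G2"
proof -
  have inv: "M ** matrix_inv M = mat 1" "matrix_inv M ** M = mat 1"
    using assms matrix_inv_inverse by (auto simp: G2_def)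
  then have "invertible (matrix_inv M)" by (auto simp: invertible_def)
  moreover have "matrix_inv M *v (x \<odot> y) = (matrix_inv M *v x) \<odot> (matrix_inv M *v y)" for x y
    using G2_left_cancel[OF assms, of "matrix_inv M"] inv(1) G2_one by simp
  ultimately show ?thesis by (simp add: G2_def)
qed

lemma A_mat_eq_\<Phi>: "A_mat = \<Phi> (pi / (8 * sqrt 2))"
  by (simp add: A_mat_def mat_exp_X)

lemma matrix_inv_A_mat: "matrix_inv A_mat = \<Phi> (- (pi / (8 * sqrt 2)))"
  unfolding A_mat_eq_\<Phi>
  using \<Phi>_minus_mult[of "pi / (8 * sqrt 2)"] \<Phi>_minus_mult[of "- (pi / (8 * sqrt 2))"]
  by (intro matrix_inv_eqI) simp_all

lemma letter_mat_G2: "letter_mat l \<in> G2"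
  by (cases l) (simp_all add: A_mat_eq_\<Phi> \<Phi>_G2 G2_matrix_inv S_mat_G2)

lemma word_mat_Nil: "word_mat [] = mat 1"
  by (simp add: word_mat_def mat_list_prod_def)

lemma word_mat_Cons: "word_mat (l # w) = letter_mat l ** word_mat w"
  by (simp add: word_mat_def mat_list_prod_def)

lemma word_mat_G2: "word_mat w \<in> G2"
  by (induction w) (simp_all add: word_mat_Nil word_mat_Cons G2_one G2_mult letter_mat_G2)

section \<open>Matrices of the letters and their adjoint action\<close>

fun letter_list :: "letter \<Rightarrow> zr2 list list" where
  "letter_list LA = A_list"
| "letter_list La = a_list"
| "letter_list LS = mat_scale (4, 0) S_list"

fun Ad_list :: "letter \<Rightarrow> zr2 list list" where
  "Ad_list LA = Ad_A"
| "Ad_list La = Ad_a"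
| "Ad_list LS = Ad_S"

text \<open>The scalars are four times the coefficients 1/2, cos(pi/4)/2, sin(pi/4)/2, cos(pi/2)/2,
  sin(pi/2)/2 occurring in \<open>\<Phi>\<close>; for the inverse the sines change sign.\<close>

lemma A_lists:
  "lincomb 8 8 [(2, 0), (0, 1), (0, 1), (0, 0), (2, 0)] [P0, P1, J1, P2, J2] = A_list"
  "lincomb 8 8 [(2, 0), (0, 1), (0, - 1), (0, 0), (- 2, 0)] [P0, P1, J1, P2, J2] = a_list"
  "has_dims 8 8 S_list" "has_dims 8 8 A_list" "has_dims 8 8 a_list"
  by code_simp+

lemma oct_mat_lincomb:
  assumes "length v = length Ms" "list_all (has_dims 8 8) Ms"
  shows "has_dims 8 8 (lincomb 8 8 v Ms)"
    and "oct_mat (lincomb 8 8 v Ms) = (\<Sum>k<length Ms. zr2_val (v ! k) *\<^sub>R oct_mat (Ms ! k))"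
  using to_mat_lincomb[where 'm = 4 and 'n = 4, of v Ms] assms by simp_all

lemma letter_mat_list: "letter_mat l = (1 / 4) *\<^sub>R oct_mat (letter_list l)"
proof -
  have angle: "2 * sqrt 2 * (pi / (8 * sqrt 2)) = pi / 4" "4 * sqrt 2 * (pi / (8 * sqrt 2)) = pi / 2"
    by simp_all
  have P: "list_all (has_dims 8 8) [P0, P1, J1, P2, J2]" by (simp add: lists_P_J)
  have "A_mat = (1 / 4) *\<^sub>R oct_mat A_list"
    unfolding A_mat_eq_\<Phi> \<Phi>_def angle A_lists(1)[symmetric]
    by (subst oct_mat_lincomb(2)[OF _ P])
      (simp_all add: cos_45 sin_45 eval_nat_numeral zr2_val_def scaleR_add_right scaleR_diff_right)
  moreover have "matrix_inv A_mat = (1 / 4) *\<^sub>R oct_mat a_list"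
    unfolding matrix_inv_A_mat \<Phi>_def mult_minus_right cos_minus sin_minus angle A_lists(2)[symmetric]
    by (subst oct_mat_lincomb(2)[OF _ P])
      (simp_all add: cos_45 sin_45 eval_nat_numeral zr2_val_def scaleR_add_right scaleR_diff_right)
  moreover have "S_mat = (1 / 4) *\<^sub>R oct_mat (mat_scale (4, 0) S_list)"
    by (simp add: oct_matrix_to_mat_scale A_lists S_mat_to_mat)
  ultimately show ?thesis by (cases l) simp_all
qed

text \<open>Conjugation by a letter g is tested as D' g = 8 g D, without the inverse of g. The
  factor 4 contained in \<open>letter_list\<close> occurs on both sides.\<close>

lemma Ad_list_check:
  "list_all2 (\<lambda>v D. length v = 14 \<and>
     mat_mult 8 (lincomb 8 8 v g2_lists) (letter_list l) = mat_scale (8, 0) (mat_mult 8 (letter_list l) D))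
   (Ad_list l) g2_lists"
  by (cases l) (simp only:, code_simp)+

lemma g2_lists_dims: "length g2_lists = 14" "list_all (has_dims 8 8) g2_lists"
  by code_simp+

section \<open>The coordinate matrices\<close>

abbreviation g2_val :: "zr2 list \<Rightarrow> oct_matrix" where
  "g2_val v \<equiv> g2_comb (\<lambda>i. zr2_val (v ! i))"

text \<open>A row of coordinates is multiplied by the matrix whose rows are the conjugated basis
  derivations, so each letter contributes one factor 8 to the scale. The initial row is
  \<open>X\<close>, the sum of the last two basis elements.\<close>

fun conj_coords :: "letter list \<Rightarrow> zr2 list" where
  "conj_coords [] = replicate 12 (0, 0) @ [(1, 0), (1, 0)]"
| "conj_coords (l # w) = row_mult 14 (conj_coords w) (Ad_list l)"

lemma Ad_list_dims: "length (Ad_list l) = 14" "list_all (\<lambda>v. length v = 14) (Ad_list l)"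
  using Ad_list_check[of l] g2_lists_dims
  by (auto simp: list_all2_conv_all_nth list_all_length)

lemma length_conj_coords: "length (conj_coords w) = 14"
  by (induction w) (simp_all add: length_row_mult Ad_list_dims)

lemma g2_val_lincomb:
  assumes "length v = 14"
  shows "has_dims 8 8 (lincomb 8 8 v g2_lists)" "g2_val v = oct_mat (lincomb 8 8 v g2_lists)"
  using oct_mat_lincomb[of v g2_lists] assms g2_lists_dims
  by (simp_all add: g2_comb_def g2_basis_to_mat)

lemma letter_list_dims: "has_dims 8 8 (letter_list l)"
  by (cases l) (simp_all add: A_lists has_dims_mat_scale)

lemma Ad_list_nth:
  assumes k: "k < 14"
  shows "g2_val (Ad_list l ! k) ** letter_mat l = 8 *\<^sub>R (letter_mat l ** (g2_basis ! k))"
proof -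
  let ?v = "Ad_list l ! k" and ?D = "g2_lists ! k"
  have v: "length ?v = 14"
    "mat_mult 8 (lincomb 8 8 ?v g2_lists) (letter_list l) = mat_scale (8, 0) (mat_mult 8 (letter_list l) ?D)"
    using Ad_list_check[of l] k by (auto simp: list_all2_conv_all_nth Ad_list_dims)
  have D: "has_dims 8 8 ?D" using g2_lists_dims k by (simp add: list_all_length)
  have LD: "has_dims 8 8 (mat_mult 8 (letter_list l) ?D)"
    using letter_list_dims[of l] D by (auto simp: has_dims_def mat_mult_def list_all_length length_row_mult)
  have "oct_mat (lincomb 8 8 ?v g2_lists) ** oct_mat (letter_list l) = 8 *\<^sub>R (oct_mat (letter_list l) ** oct_mat ?D)"
    by (simp add: oct_matrix_to_mat_mult g2_val_lincomb(1)[OF v(1)] letter_list_dims v(2)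
        oct_matrix_to_mat_scale[OF LD] D)
  moreover have "g2_basis ! k = oct_mat ?D" using k by (simp add: g2_basis_to_mat g2_lists_dims)
  ultimately show ?thesis
    by (simp add: letter_mat_list g2_val_lincomb(2)[OF v(1)]
        bounded_bilinear.scaleR_left[OF bounded_bilinear_matrix_mult]
        bounded_bilinear.scaleR_right[OF bounded_bilinear_matrix_mult])
qed

lemma g2_comb_sum: "g2_comb (\<lambda>i. \<Sum>k\<in>K. c k * a k i) = (\<Sum>k\<in>K. c k *\<^sub>R g2_comb (a k))"
  unfolding g2_comb_def scaleR_sum_left scaleR_sum_right
  by (subst sum.swap) simp

lemma g2_comb_cong: "(\<And>i. i < 14 \<Longrightarrow> a i = b i) \<Longrightarrow> g2_comb a = g2_comb b"
  by (simp add: g2_comb_def)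

lemma g2_val_Ad:
  assumes v: "length v = 14"
  shows "g2_val (row_mult 14 v (Ad_list l)) ** letter_mat l = 8 *\<^sub>R (letter_mat l ** g2_val v)"
proof -
  interpret bounded_bilinear "\<lambda>A B :: oct_matrix. A ** B" by (rule bounded_bilinear_matrix_mult)
  have "g2_val (row_mult 14 v (Ad_list l)) = g2_comb (\<lambda>i. \<Sum>k<14. zr2_val (v ! k) * zr2_val (Ad_list l ! k ! i))"
    by (rule g2_comb_cong) (use row_mult[of v "Ad_list l" 14] v Ad_list_dims in simp)
  also have "\<dots> = (\<Sum>k<14. zr2_val (v ! k) *\<^sub>R g2_val (Ad_list l ! k))" by (rule g2_comb_sum)
  finally have "g2_val (row_mult 14 v (Ad_list l)) ** letter_mat l
      = (\<Sum>k<14. zr2_val (v ! k) *\<^sub>R (g2_val (Ad_list l ! k) ** letter_mat l))"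
    by (simp add: sum_left scaleR_left)
  also have "\<dots> = (\<Sum>k<14. zr2_val (v ! k) *\<^sub>R (8 *\<^sub>R (letter_mat l ** (g2_basis ! k))))"
    by (simp add: Ad_list_nth)
  also have "\<dots> = 8 *\<^sub>R (letter_mat l ** g2_val v)"
    by (simp add: g2_comb_def sum_right scaleR_right scaleR_sum_right mult.commute)
  finally show ?thesis .
qed

text \<open>As for a single letter, the word is kept on the right of the conjugated element, so that
  no inverse enters the induction.\<close>

lemma word_mat_times_X: "8 ^ length w *\<^sub>R (word_mat w ** X) = g2_val (conj_coords w) ** word_mat w"
proof (induction w)
  case Nil
  have "g2_val (conj_coords []) = g2_basis ! 12 + g2_basis ! 13"
    by (simp add: g2_comb_def sum_lessThan_14 eval_nat_numeral)
  then show ?case by (simp add: word_mat_Nil X_def g2_basis_def)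
next
  case (Cons l w)
  interpret bounded_bilinear "\<lambda>A B :: oct_matrix. A ** B" by (rule bounded_bilinear_matrix_mult)
  have "g2_val (conj_coords (l # w)) ** word_mat (l # w)
      = (g2_val (row_mult 14 (conj_coords w) (Ad_list l)) ** letter_mat l) ** word_mat w"
    by (simp add: word_mat_Cons matrix_mul_assoc)
  also have "\<dots> = 8 *\<^sub>R (letter_mat l ** (g2_val (conj_coords w) ** word_mat w))"
    by (simp add: g2_val_Ad length_conj_coords scaleR_left matrix_mul_assoc)
  also have "\<dots> = 8 ^ length (l # w) *\<^sub>R (word_mat (l # w) ** X)"
    by (simp add: Cons[symmetric] scaleR_right word_mat_Cons matrix_mul_assoc)
  finally show ?case by simp
qed

definition conj_X :: "letter list \<Rightarrow> oct_matrix" where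
  "conj_X w = word_mat w ** X ** matrix_inv (word_mat w)"

lemma conj_X_coords: "8 ^ length w *\<^sub>R conj_X w = g2_val (conj_coords w)"
proof -
  interpret bounded_bilinear "\<lambda>A B :: oct_matrix. A ** B" by (rule bounded_bilinear_matrix_mult)
  have inv: "word_mat w ** matrix_inv (word_mat w) = mat 1"
    using word_mat_G2[of w] by (intro matrix_inv_inverse) (simp add: G2_def)
  have "8 ^ length w *\<^sub>R conj_X w = (8 ^ length w *\<^sub>R (word_mat w ** X)) ** matrix_inv (word_mat w)"
    by (simp add: conj_X_def scaleR_left)
  then show ?thesis by (simp add: word_mat_times_X matrix_mul_assoc[symmetric] inv)
qed

definition column_matrix :: "zr2 list list \<Rightarrow> real^14^14" where
  "column_matrix T = (1 / 16) *\<^sub>R transpose (to_mat T)"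

text \<open>Cross-multiplied to avoid division: \<open>conj_coords w\<close> carries the factor
  \<open>8 ^ length w\<close>, a row of \<open>T\<close> the factor 16.\<close>

definition column_check :: "letter list list \<Rightarrow> zr2 list list \<Rightarrow> bool" where
  "column_check W T \<longleftrightarrow> length W = 14 \<and> has_dims 14 14 T \<and>
     list_all2 (\<lambda>w c. vec_scale (16, 0) (conj_coords w) = vec_scale (8 ^ length w, 0) c) W T"

lemma conj_X_column:
  assumes T: "column_check W T" and j: "j < 14"
  shows "conj_X (W ! j) = g2_comb (\<lambda>i. column_matrix T $ of_nat i $ of_nat j)"
proof -
  let ?w = "W ! j" and ?c = "T ! j"
  have eq: "vec_scale (16, 0) (conj_coords ?w) = vec_scale (8 ^ length ?w, 0) ?c"
    using T j by (auto simp: column_check_def list_all2_conv_all_nth)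
  have len: "length ?c = 14" using T j has_dims_nth by (auto simp: column_check_def)
  have val: "zr2_val (conj_coords ?w ! i) = 8 ^ length ?w * (column_matrix T $ of_nat i $ of_nat j)" if i: "i < 14" for i
  proof -
    have "zr2_val (vec_scale (16, 0) (conj_coords ?w) ! i) = zr2_val (vec_scale (8 ^ length ?w, 0) ?c ! i)"
      by (simp only: eq)
    then have "16 * zr2_val (conj_coords ?w ! i) = 8 ^ length ?w * zr2_val (?c ! i)"
      using i len by (simp add: vec_scale_def length_conj_coords)
    moreover have "zr2_val (?c ! i) = 16 * (column_matrix T $ of_nat i $ of_nat j)"
      using i j idx_of_nat[where 'a = "7", of i] idx_of_nat[where 'a = "7", of j]
      by (simp add: column_matrix_def transpose_def to_mat_nth)
    ultimately show ?thesis by simp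
  qed
  have "8 ^ length ?w *\<^sub>R conj_X ?w = g2_comb (\<lambda>i. 8 ^ length ?w * (column_matrix T $ of_nat i $ of_nat j))"
    unfolding conj_X_coords by (rule g2_comb_cong) (rule val)
  also have "\<dots> = 8 ^ length ?w *\<^sub>R g2_comb (\<lambda>i. column_matrix T $ of_nat i $ of_nat j)"
    by (simp add: g2_comb_def scaleR_sum_right)
  finally show ?thesis by simp
qed

text \<open>\<open>C_mat\<close> is a definite description, so besides a solution it needs
  uniqueness, which is the linear independence of the basis derivations.\<close>

lemma C_mat_eqI:
  assumes C: "\<And>j. j < 14 \<Longrightarrow> conj_X (W ! j) = g2_comb (\<lambda>i. C $ of_nat i $ of_nat j)"
  shows "C_mat W = C"
  unfolding C_mat_def
proof (rule the_equality)
  show "\<forall>j<14. word_mat (W ! j) ** X ** matrix_inv (word_mat (W ! j)) =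
       (\<Sum>i<14. (C $ of_nat i $ of_nat j) *\<^sub>R (g2_basis ! i))"
    using C by (simp add: conj_X_def g2_comb_def)
  fix C' :: "real^14^14"
  assume C': "\<forall>j<14. word_mat (W ! j) ** X ** matrix_inv (word_mat (W ! j)) =
       (\<Sum>i<14. (C' $ of_nat i $ of_nat j) *\<^sub>R (g2_basis ! i))"
  have "C' $ of_nat i $ of_nat j = C $ of_nat i $ of_nat j" if "i < 14" "j < 14" for i j
  proof (rule g2_comb_inject[of "\<lambda>i. C' $ of_nat i $ of_nat j" "\<lambda>i. C $ of_nat i $ of_nat j" i])
    show "g2_comb (\<lambda>i. C' $ of_nat i $ of_nat j) = g2_comb (\<lambda>i. C $ of_nat i $ of_nat j)"
      using C'[rule_format, OF that(2)] C[OF that(2)] by (simp add: conj_X_def g2_comb_def)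
  qed (rule that)
  then show "C' = C"
    by (simp add: vec_eq_iff all_bit0_iff)
qed

section \<open>Determinants from triangular certificates\<close>

definition upper_triangular :: "zr2 list list \<Rightarrow> bool" where
  "upper_triangular L \<longleftrightarrow> list_all (\<lambda>i. list_all (\<lambda>j. L ! i ! j = (0, 0)) [0..<i]) [0..<length L]"

definition lower_triangular :: "zr2 list list \<Rightarrow> bool" where
  "lower_triangular L \<longleftrightarrow> list_all (\<lambda>i. list_all (\<lambda>j. L ! i ! j = (0, 0)) [Suc i..<length L]) [0..<length L]"

definition diag_prod :: "zr2 list list \<Rightarrow> zr2" where
  "diag_prod L = foldr zr2_mult (map (\<lambda>i. L ! i ! i) [0..<length L]) (1, 0)"

lemma idx_less_iff: "idx i < idx j \<longleftrightarrow> i < j" for i j :: "'a::finite bit0"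
  using Rep_bit0[of i] Rep_bit0[of j] by (auto simp: idx_def less_bit0_def nat_less_eq_zless)

lemma zr2_val_diag_prod:
  assumes "length L = CARD('n bit0)"
  shows "zr2_val (diag_prod L) = (\<Prod>i\<in>UNIV. (to_mat L :: real^'n::finite bit0^'n bit0) $ i $ i)"
proof -
  have "zr2_val (foldr zr2_mult xs (1, 0)) = prod_list (map zr2_val xs)" for xs
    by (induction xs) simp_all
  then have "zr2_val (diag_prod L) = prod_list (map (\<lambda>i. zr2_val (L ! i ! i)) [0..<length L])"
    by (simp add: diag_prod_def o_def)
  also have "\<dots> = (\<Prod>i<CARD('n bit0). zr2_val (L ! i ! i))"
    using prod.distinct_set_conv_list[of "[0..<length L]" "\<lambda>i. zr2_val (L ! i ! i)"] assms
    by (simp add: atLeast0LessThan del: card_bit0)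
  also have "\<dots> = (\<Prod>i<CARD('n bit0). (to_mat L :: real^'n bit0^'n bit0) $ of_nat i $ of_nat i)"
    by (rule prod.cong) (simp_all add: to_mat_nth idx_of_nat del: card_bit0)
  also have "\<dots> = (\<Prod>i\<in>UNIV. (to_mat L :: real^'n bit0^'n bit0) $ i $ i)"
    by (rule prod.reindex_bij_betw[OF bij_betw_of_nat_bit0])
  finally show ?thesis .
qed

lemma det_triangular:
  assumes "length L = CARD('n bit0)" "upper_triangular L \<or> lower_triangular L"
  shows "det (to_mat L :: real^'n::finite bit0^'n bit0) = zr2_val (diag_prod L)"
  using assms(2)
proof
  assume "upper_triangular L"
  then have "\<And>i j. i < CARD('n bit0) \<Longrightarrow> j < i \<Longrightarrow> L ! i ! j = (0, 0)"
    using assms(1) by (auto simp: upper_triangular_def list_all_iff simp del: card_bit0)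
  then have "(to_mat L :: real^'n bit0^'n bit0) $ i $ j = 0" if "j < i" for i j
    using that idx_less[of i] by (simp add: to_mat_nth idx_less_iff del: card_bit0)
  then show ?thesis unfolding zr2_val_diag_prod[OF assms(1)] by (rule det_upperdiagonal)
next
  assume "lower_triangular L"
  then have "\<And>i j. i < j \<Longrightarrow> j < CARD('n bit0) \<Longrightarrow> L ! i ! j = (0, 0)"
    using assms(1) by (auto simp: lower_triangular_def list_all_iff simp del: card_bit0)
  then have "(to_mat L :: real^'n bit0^'n bit0) $ i $ j = 0" if "i < j" for i j
    using that idx_less[of j] by (simp add: to_mat_nth idx_less_iff del: card_bit0)
  then show ?thesis unfolding zr2_val_diag_prod[OF assms(1)] by (rule det_lowerdiagonal)
qed

text \<open>\<open>d\<close> is the claimed determinant of \<open>T\<close>. The diagonal of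
  \<open>U\<close> multiplies to an integer \<open>u\<close>, and testing \<open>diag_prod L\<close>
  against \<open>zr2_mult d (u, 0)\<close> postpones the division by \<open>u\<close> to the
  reals.\<close>

definition lu_check :: "zr2 list list \<Rightarrow> zr2 list list \<Rightarrow> zr2 list list \<Rightarrow> zr2 list list \<Rightarrow> zr2 \<Rightarrow> int \<Rightarrow> bool" where
  "lu_check Q T U L d u \<longleftrightarrow> has_dims 14 14 Q \<and> has_dims 14 14 T \<and> has_dims 14 14 U \<and> length L = 14 \<and>
     upper_triangular Q \<and> upper_triangular U \<and> lower_triangular L \<and>
     diag_prod Q = (1, 0) \<and> diag_prod U = (u, 0) \<and> u \<noteq> 0 \<and> diag_prod L = zr2_mult d (u, 0) \<and>
     mat_mult 14 (mat_mult 14 Q T) U = L"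

lemma det_lu:
  assumes "lu_check Q T U L d u"
  shows "det (to_mat T :: real^14^14) = zr2_val d"
proof -
  note * = assms[unfolded lu_check_def]
  have QT: "(to_mat Q :: real^14^14) ** (to_mat T :: real^14^14) = to_mat (mat_mult 14 Q T)"
    using to_mat_mult[where 'm = 7 and 'k = 7 and 'n = 7, of Q T] * by simp
  have dims: "has_dims 14 14 (mat_mult 14 Q T)"
    using * by (auto simp: has_dims_def mat_mult_def list_all_length length_row_mult)
  have "(to_mat (mat_mult 14 Q T) :: real^14^14) ** (to_mat U :: real^14^14) = to_mat L"
    using to_mat_mult[where 'm = 7 and 'k = 7 and 'n = 7, of "mat_mult 14 Q T" U] dims * by simp
  then have "det ((to_mat Q :: real^14^14) ** (to_mat T :: real^14^14) ** (to_mat U :: real^14^14)) = det (to_mat L :: real^14^14)"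
    by (simp add: QT)
  moreover have "det (to_mat Q :: real^14^14) = 1" "det (to_mat U :: real^14^14) = of_int u"
    "det (to_mat L :: real^14^14) = zr2_val d * of_int u"
    using det_triangular[where 'n = 7, of Q] det_triangular[where 'n = 7, of U] det_triangular[where 'n = 7, of L] *
    by (auto simp: has_dims_def)
  ultimately show ?thesis using * by (simp add: det_mul)
qed

lemma det_column_matrix: "det (column_matrix T) = det (to_mat T :: real^14^14) / 16 ^ 14"
proof -
  have "column_matrix T = (\<chi> i. (1 / 16) *s (transpose (to_mat T) $ i))"
    by (simp add: column_matrix_def vec_eq_iff)
  then have "det (column_matrix T) = (\<Prod>i\<in>(UNIV::14 set). 1 / 16) * det (transpose (to_mat T) :: real^14^14)"
    using det_rows_mul[of "\<lambda>_. 1 / 16" "\<lambda>i. transpose (to_mat T :: real^14^14) $ i"] by simp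
  then show ?thesis by (simp add: det_transpose power_divide)
qed

text \<open>The determinant of the scaled matrix is \<open>2 ^ 51 * (10 - 7 * sqrt 2)\<close>: the
  scale 16 in each of 14 rows accounts for \<open>2 ^ 56\<close>.\<close>

lemma lean_checks:
  "column_check W_lean cols_lean"
  "lu_check Q_lean cols_lean U_lean L_lean (22517998136852480, - 15762598695796736) 12288"
  by code_simp+

text \<open>Here the scaled determinant is \<open>- 2 ^ 52 * (140 + 91 * sqrt 2)\<close>, again
  \<open>2 ^ 56\<close> times the determinant of the coordinate matrix.\<close>

lemma bal_checks:
  "column_check W_bal cols_bal"
  "lu_check Q_bal cols_bal U_bal L_bal (- 630503947831869440, - 409827566090715136) 1162542538293248"
  by code_simp+

lemma C_mat_lean: "C_mat W_lean = column_matrix cols_lean" "det (C_mat W_lean) = (10 - 7 * sqrt 2) / 32"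
proof -
  show "C_mat W_lean = column_matrix cols_lean"
    by (rule C_mat_eqI) (rule conj_X_column[OF lean_checks(1)])
  then show "det (C_mat W_lean) = (10 - 7 * sqrt 2) / 32"
    by (simp add: det_column_matrix det_lu[OF lean_checks(2)] zr2_val_def field_simps)
qed

lemma C_mat_bal: "C_mat W_bal = column_matrix cols_bal" "det (C_mat W_bal) = - (140 + 91 * sqrt 2) / 16"
proof -
  show "C_mat W_bal = column_matrix cols_bal"
    by (rule C_mat_eqI) (rule conj_X_column[OF bal_checks(1)])
  then show "det (C_mat W_bal) = - (140 + 91 * sqrt 2) / 16"
    by (simp add: det_column_matrix det_lu[OF bal_checks(2)] zr2_val_def field_simps)
qed

section \<open>The product maps\<close>

lemma entire_\<Phi>:
  assumes "linear f"
  shows "entire (\<lambda>h. \<Phi> (f h))"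
proof -
  have "linear (\<lambda>h. c * f h)" for c :: real
    using linear_compose_scale_right[OF assms, of c] by simp
  then show ?thesis
    unfolding \<Phi>_def
    by (intro entire_scaleR entire_add entire_cos entire_sin entire_const) (auto intro: entire_linear)
qed

lemma entire_prod_list:
  fixes F :: "'i \<Rightarrow> 'a::euclidean_space \<Rightarrow> real^'n^'n"
  assumes "\<And>i. entire (F i)"
  shows "entire (\<lambda>h. mat_list_prod (map (\<lambda>i. F i h) is))"
  unfolding mat_list_prod_def
  by (induction "is") (auto intro: entire_const entire_matrix_mult assms)

text \<open>All factors are the identity at 0, so the product rule leaves the plain sum of their
  derivatives. The value of the product at 0 is carried along because the induction step multiplies
  by it.\<close>

lemma has_derivative_prod_list_at_one:
  fixes F :: "'i \<Rightarrow> 'a::real_normed_vector \<Rightarrow> real^'n^'n"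
  assumes "\<And>i. F i 0 = mat 1" "\<And>i. (F i has_derivative D i) (at 0)"
  shows "((\<lambda>h. mat_list_prod (map (\<lambda>i. F i h) is)) has_derivative (\<lambda>h. \<Sum>i\<leftarrow>is. D i h)) (at 0)
    \<and> mat_list_prod (map (\<lambda>i. F i 0) is) = mat 1"
proof (induction "is")
  case Nil
  then show ?case by (simp add: mat_list_prod_def)
next
  case (Cons i "is")
  let ?P = "\<lambda>h. mat_list_prod (map (\<lambda>i. F i h) is)"
  have "((\<lambda>h. F i h ** ?P h) has_derivative (\<lambda>h. F i 0 ** (\<Sum>i\<leftarrow>is. D i h) + D i h ** ?P 0)) (at 0)"
    by (rule bounded_bilinear.FDERIV[OF bounded_bilinear_matrix_mult assms(2)]) (use Cons in blast)
  then show ?case using Cons by (simp add: mat_list_prod_def assms(1) add.commute)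
qed

lemma mat_list_prod_G2: "(\<And>M. M \<in> set Ms \<Longrightarrow> M \<in> G2) \<Longrightarrow> mat_list_prod Ms \<in> G2"
  unfolding mat_list_prod_def by (induction Ms) (auto intro: G2_one G2_mult)

definition one_parameter_factor :: "letter list list \<Rightarrow> nat \<Rightarrow> real^14 \<Rightarrow> oct_matrix" where
  "one_parameter_factor W j t = word_mat (W ! j) ** \<Phi> (t $ of_nat j) ** matrix_inv (word_mat (W ! j))"

lemma Psi_eq: "Psi W t = mat_list_prod (map (\<lambda>j. one_parameter_factor W j t) [0..<14])"
  by (simp add: Psi_def one_parameter_factor_def mat_exp_X)

lemma Psi_G2: "Psi W t \<in> G2"
  unfolding Psi_eq
  by (rule mat_list_prod_G2)
    (auto simp: one_parameter_factor_def intro!: G2_mult G2_matrix_inv word_mat_G2 \<Phi>_G2)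

lemma entire_Psi: "entire (Psi W)"
  unfolding Psi_eq[abs_def] one_parameter_factor_def
  by (intro entire_prod_list entire_matrix_mult entire_const entire_\<Phi>)
    (simp add: linear_conv_bounded_linear bounded_linear_vec_nth)

text \<open>The derivative of \<open>\<Phi>\<close> at 0 is \<open>X\<close>, so the partial
  derivative in direction j is the conjugate of \<open>X\<close> by the j-th word, that is, column j
  of the coordinate matrix.\<close>

lemma Psi_derivative:
  shows "(Psi W has_derivative (\<lambda>h. \<Sum>j<14. h $ of_nat j *\<^sub>R conj_X (W ! j))) (at 0)" and "Psi W 0 = mat 1"
proof -
  interpret bounded_bilinear "\<lambda>A B :: oct_matrix. A ** B" by (rule bounded_bilinear_matrix_mult)
  have one: "one_parameter_factor W j 0 = mat 1" for j
    using word_mat_G2[of "W ! j"] by (simp add: one_parameter_factor_def \<Phi>_0 matrix_inv_inverse G2_def)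
  have d: "(one_parameter_factor W j has_derivative (\<lambda>h. h $ of_nat j *\<^sub>R conj_X (W ! j))) (at 0)" for j
  proof -
    have "((\<lambda>t::real^14. t $ of_nat j) has_derivative (\<lambda>h. h $ of_nat j)) (at 0)"
      by (rule bounded_linear_imp_has_derivative[OF bounded_linear_vec_nth])
    moreover have "(\<Phi> has_derivative (\<lambda>s. s *\<^sub>R X)) (at ((0::real^14) $ of_nat j))"
      using has_vector_derivative_\<Phi>[of 0] by (simp add: has_vector_derivative_def \<Phi>_0)
    ultimately have "((\<lambda>t::real^14. \<Phi> (t $ of_nat j)) has_derivative (\<lambda>h. h $ of_nat j *\<^sub>R X)) (at 0)"
      by (rule has_derivative_compose)
    from bounded_linear.has_derivative[OF bounded_linear_left[of "matrix_inv (word_mat (W ! j))"]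
        bounded_linear.has_derivative[OF bounded_linear_right[of "word_mat (W ! j)"] this]]
    show ?thesis by (simp add: one_parameter_factor_def[abs_def] conj_X_def scaleR_left scaleR_right)
  qed
  have "(\<Sum>j\<leftarrow>[0..<14]. h $ of_nat j *\<^sub>R conj_X (W ! j)) = (\<Sum>j<14. h $ of_nat j *\<^sub>R conj_X (W ! j))" for h :: "real^14"
    using sum.distinct_set_conv_list[of "[0..<14]" "\<lambda>j. h $ of_nat j *\<^sub>R conj_X (W ! j)"]
    by (simp add: atLeast0LessThan)
  with has_derivative_prod_list_at_one[of "one_parameter_factor W", OF one d, of "[0..<14]"]
  show "(Psi W has_derivative (\<lambda>h. \<Sum>j<14. h $ of_nat j *\<^sub>R conj_X (W ! j))) (at 0)" "Psi W 0 = mat 1"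
    by (simp_all add: Psi_eq[abs_def])
qed

text \<open>In the coordinates of the basis derivations the derivative at 0 is multiplication by
  \<open>C\<close>. Linear independence turns invertibility of \<open>C\<close> into injectivity,
  and the spanning property turns it into surjectivity onto the derivations.\<close>

lemma Psi_local_diffeo:
  fixes C :: "real^14^14"
  assumes C: "\<And>j. j < 14 \<Longrightarrow> conj_X (W ! j) = g2_comb (\<lambda>i. C $ of_nat i $ of_nat j)"
    and det: "det C \<noteq> 0"
  shows "analytic_local_diffeo (Psi W) 0 G2 (mat 1)"
proof -
  define L where "L h = (\<Sum>j<14. h $ of_nat j *\<^sub>R conj_X (W ! j))" for h :: "real^14"
  have L: "L h = g2_comb (\<lambda>i. (C *v h) $ of_nat i)" for h
  proof -
    have "L h = (\<Sum>j<14. h $ of_nat j *\<^sub>R g2_comb (\<lambda>i. C $ of_nat i $ of_nat j))"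
      unfolding L_def by (rule sum.cong) (simp_all add: C)
    also have "\<dots> = g2_comb (\<lambda>i. \<Sum>j<14. h $ of_nat j * C $ of_nat i $ of_nat j)"
      by (simp add: g2_comb_sum)
    also have "\<dots> = g2_comb (\<lambda>i. (C *v h) $ of_nat i)"
      using sum_of_nat_bit0[where 'a = 7, of "\<lambda>j. C $ _ $ j * h $ j"]
      by (simp add: matrix_vector_mult_def mult.commute)
    finally show ?thesis .
  qed
  have Cinv: "invertible C" using det by (simp add: invertible_det_nz)
  have der: "(Psi W has_derivative L) (at 0)"
    using Psi_derivative(1) by (simp add: L_def[abs_def])
  have inj: "inj L"
  proof (rule injI)
    fix h h' assume "L h = L h'"
    then have "(C *v h) $ of_nat i = (C *v h') $ of_nat i" if "i < 14" for i
      using g2_comb_inject that unfolding L by blast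
    then have "C *v h = C *v h'" by (simp add: vec_eq_iff all_bit0_iff)
    then have "matrix_inv C *v (C *v h) = matrix_inv C *v (C *v h')" by simp
    then show "h = h'" by (simp add: matrix_vector_mul_assoc matrix_inv_inverse[OF Cinv])
  qed
  have range: "Z \<in> range L" if defect: "derivation_defect Z = 0" for Z
  proof -
    obtain a where a: "Z = g2_comb a" using derivation_in_span_basis[OF defect] by blast
    have "C *v (matrix_inv C *v v) = v" for v
      by (simp add: matrix_vector_mul_assoc matrix_inv_inverse[OF Cinv])
    then have "L (matrix_inv C *v (\<chi> i. a (idx i))) = g2_comb (\<lambda>i. a (idx (of_nat i :: 14)))"
      by (simp add: L)
    also have "\<dots> = g2_comb a"
      by (rule g2_comb_cong) (use idx_of_nat[where 'a = 7] in simp)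
    finally show ?thesis using a by (metis rangeI)
  qed
  show ?thesis
    by (rule analytic_local_diffeo_G2[OF entire_Psi Psi_G2 Psi_derivative(2) der inj range])
qed

theorem proposition10p1:
  shows "det (C_mat W_lean) = (10 - 7 * sqrt 2) / 32 \<and> det (C_mat W_lean) \<noteq> 0 \<and>
         det (C_mat W_bal) = - (140 + 91 * sqrt 2) / 16 \<and> det (C_mat W_bal) \<noteq> 0 \<and>
         range (Psi W_lean) \<subseteq> G2 \<and> analytic_local_diffeo (Psi W_lean) 0 G2 (mat 1) \<and>
         range (Psi W_bal) \<subseteq> G2 \<and> analytic_local_diffeo (Psi W_bal) 0 G2 (mat 1)"
proof -
  \<comment> \<open>The squares are 98 and 100.\<close>
  have "sqrt 2 * 7 \<noteq> 10"
  proof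
    assume "sqrt 2 * 7 = (10::real)"
    then have "(sqrt 2 * 7)\<^sup>2 = (10::real)\<^sup>2" by simp
    then show False by (simp add: power_mult_distrib)
  qed
  then have lean: "det (C_mat W_lean) \<noteq> 0" by (simp add: C_mat_lean(2) mult.commute)
  have "0 < sqrt (2::real)" by simp
  then have "140 + 91 * sqrt 2 \<noteq> (0::real)" by linarith
  then have bal: "det (C_mat W_bal) \<noteq> 0" by (simp add: C_mat_bal(2))
  have "analytic_local_diffeo (Psi W_lean) 0 G2 (mat 1)"
    using lean by (intro Psi_local_diffeo[of W_lean "column_matrix cols_lean"] conj_X_column[OF lean_checks(1)])
      (simp_all add: C_mat_lean(1))
  moreover have "analytic_local_diffeo (Psi W_bal) 0 G2 (mat 1)"
    using bal by (intro Psi_local_diffeo[of W_bal "column_matrix cols_bal"] conj_X_column[OF bal_checks(1)])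
      (simp_all add: C_mat_bal(1))
  ultimately show ?thesis using C_mat_lean(2) C_mat_bal(2) lean bal Psi_G2 by auto
qed

end
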